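(* Let $n\ge1$, let $f$ satisfy (F1)-(F4), let $\kappa>0$, and let $v\in C^2(\mathbb{R}^n)$, $0<v<1$, be a solution of $$-\Delta v+\kappa\,\partial_n v=f(v)\quad\text{in }\mathbb{R}^n$$ with $\sup_{\mathbb{R}^n}v=1$ and $$v(x)\to0\quad\text{uniformly as }\mathrm{dist}\big(x,\{v\ge1-b_0\}\big)\to+\infty.$$ Then $\kappa\ge\kappa_\ast$. Furthermore, if $\kappa=\kappa_\ast$, then there exists a constant $t\in\mathbb{R}$ such that $v(x)=g(x_n+t)$ for all $x\in\mathbb{R}^n$.
   Context: Hypotheses on $f:[0,1]\to\mathbb{R}$: (F1) $f$ is Lipschitz on $[0,1]$, $f(0)=f(1)=0$, and $f\in C^{1,\alpha}([0,\gamma)\cup(1-\gamma,1])$ for some $\alpha,\gamma\in(0,1)$; (F2) $f'(1)<0$; (F3) $\int_0^1 f(u)\,du>0$; (F4) there is $\theta\in(0,1)$ with $f>0$ in $(\theta,1)$ and either $f<0$ in $(0,\theta)$ with $f'(0)<0$ (bistable), or $f\equiv0$ in $(0,\theta)$ (combustion). Under (F1)-(F4), there are a unique constant $\kappa_\ast>0$ and a solution $g$, unique up to translation, of $-g''+\kappa_\ast g'=f(g)$ on $\mathbb{R}$, $g(-\infty)=0$, $g(+\infty)=1$; fix one such $g$. Points of $\mathbb{R}^n$ are written $x=(x',x_n)$; $\mathrm{dist}$ is Euclidean distance. The constant $b_0\in(0,1)$ is a fixed constant depending only on $n$ and $f$ such that every entire (smooth, defined on all of $\mathbb{R}^n\times\mathbb{R}$)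 solution $w$ of $\partial_t w-\Delta w=f(w)$, $0<w<1$, with $\sup_{x}w(x,t)=1$ for all $t$ satisfies: (a) for each $\lambda\in[1-b_0,1)$, $\{w=\lambda\}$ is the graph $\{t=h_\lambda(x)\}$ of a globally Lipschitz function on $\mathbb{R}^n$; (b) $\partial_t w\ge c_0(1-w)$ and $|\nabla w|+|\partial_t w|\le C_0(1-w)$ in $\{w>1-b_0\}$, with constants $c_0,C_0>0$ depending only on $n$ and $f$. (If $v$ is as in the claim, $w(x,t)=v(x+\kappa te_n)$ is such an entire solution.) *)

theory Defs
  imports "HOL-Analysis.Analysis"
begin

section \<open>Partial derivatives and classes of differentiability\<close>

definition partial :: "'a::euclidean_space \<Rightarrow> ('a \<Rightarrow> real) \<Rightarrow> 'a \<Rightarrow> real" where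
  "partial b u x = deriv (\<lambda>s. u (x + s *\<^sub>R b)) 0"

text \<open>
  \<open>C_class k u\<close>: all partial derivatives of \<open>u\<close> of order at most \<open>k\<close> exist and are
  continuous on the whole space. The existence clause is needed because \<^const>\<open>deriv\<close> is total.
\<close>

primrec C_class :: "nat \<Rightarrow> ('a::euclidean_space \<Rightarrow> real) \<Rightarrow> bool" where
  "C_class 0 u \<longleftrightarrow> continuous_on UNIV u"
| "C_class (Suc k) u \<longleftrightarrow> continuous_on UNIV u \<and>
     (\<forall>b\<in>Basis. (\<forall>x. (\<lambda>s. u (x + s *\<^sub>R b)) differentiable at 0) \<and> C_class k (partial b u))"

definition gradient :: "('a::euclidean_space \<Rightarrow> real) \<Rightarrow> 'a \<Rightarrow> 'a" where
  "gradient u x = (\<Sum>b\<in>Basis. partial b u x *\<^sub>R b)"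

definition laplacian :: "('a::euclidean_space \<Rightarrow> real) \<Rightarrow> 'a \<Rightarrow> real" where
  "laplacian u x = (\<Sum>b\<in>Basis. partial b (partial b u) x)"

section \<open>The nonlinearity\<close>

text \<open>
  A nonlinearity on \<open>[0,1]\<close> is represented by a function on the reals whose values outside
  \<open>[0,1]\<close> are never used; derivatives at \<open>0\<close> and \<open>1\<close> are one-sided.
\<close>

definition C1_holder_on :: "real set \<Rightarrow> real \<Rightarrow> (real \<Rightarrow> real) \<Rightarrow> bool" where
  "C1_holder_on S \<alpha> f \<longleftrightarrow>
     (\<exists>f' C. (\<forall>u\<in>S. (f has_real_derivative f' u) (at u within S)) \<and>
             (\<forall>u\<in>S. \<forall>v\<in>S. \<bar>f' u - f' v\<bar> \<le> C * \<bar>u - v\<bar> powr \<alpha>))"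

definition F1 :: "(real \<Rightarrow> real) \<Rightarrow> bool" where
  "F1 f \<longleftrightarrow> (\<exists>L. L-lipschitz_on {0..1} f) \<and> f 0 = 0 \<and> f 1 = 0 \<and>
     (\<exists>\<alpha>\<in>{0<..<1}. \<exists>\<gamma>\<in>{0<..<1}. C1_holder_on ({0..<\<gamma>} \<union> {1-\<gamma><..1}) \<alpha> f)"

definition F2 :: "(real \<Rightarrow> real) \<Rightarrow> bool" where
  "F2 f \<longleftrightarrow> (\<exists>d<0. (f has_real_derivative d) (at 1 within {0..1}))"

definition F3 :: "(real \<Rightarrow> real) \<Rightarrow> bool" where
  "F3 f \<longleftrightarrow> integral {0..1} f > 0"

definition bistable :: "real \<Rightarrow> (real \<Rightarrow> real) \<Rightarrow> bool" where
  "bistable \<theta> f \<longleftrightarrow> (\<forall>u\<in>{0<..<\<theta>}. f u < 0) \<and>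
     (\<exists>d<0. (f has_real_derivative d) (at 0 within {0..1}))"

definition combustion :: "real \<Rightarrow> (real \<Rightarrow> real) \<Rightarrow> bool" where
  "combustion \<theta> f \<longleftrightarrow> (\<forall>u\<in>{0<..<\<theta>}. f u = 0)"

definition F4 :: "(real \<Rightarrow> real) \<Rightarrow> bool" where
  "F4 f \<longleftrightarrow> (\<exists>\<theta>\<in>{0<..<1}. (\<forall>u\<in>{\<theta><..<1}. f u > 0) \<and> (bistable \<theta> f \<or> combustion \<theta> f))"

section \<open>The planar travelling wave\<close>

text \<open>
  Under the hypotheses on \<open>f\<close>, \<open>travelling_wave f \<kappa> g\<close> with \<open>\<kappa> > 0\<close> determines \<open>\<kappa>\<close> uniquely and \<open>g\<close>
  uniquely up to translation. The range condition makes \<open>f (g s)\<close> meaningful.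
\<close>

definition travelling_wave :: "(real \<Rightarrow> real) \<Rightarrow> real \<Rightarrow> (real \<Rightarrow> real) \<Rightarrow> bool" where
  "travelling_wave f \<kappa> g \<longleftrightarrow>
     (\<forall>s. g s \<in> {0..1}) \<and>
     (\<forall>s. g differentiable at s) \<and> (\<forall>s. deriv g differentiable at s) \<and>
     (\<forall>s. - deriv (deriv g) s + \<kappa> * deriv g s = f (g s)) \<and>
     (g \<longlongrightarrow> 0) at_bot \<and> (g \<longlongrightarrow> 1) at_top"

section \<open>Entire solutions and the constant \<open>b\<^sub>0\<close>\<close>

abbreviation time_deriv :: "('a \<times> real \<Rightarrow> real) \<Rightarrow> 'a \<Rightarrow> real \<Rightarrow> real" where
  "time_deriv w x t \<equiv> deriv (\<lambda>s. w (x, s)) t"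

text \<open>
  As \<open>f\<close> is only Lipschitz, smoothness of an entire solution is understood as membership in
  \<open>C\<^sup>2\<close>; this class contains \<open>(x, t) \<mapsto> v (x + \<kappa> t e\<^sub>n)\<close> for every \<open>v\<close> of class \<open>C\<^sup>2\<close>.
\<close>

definition entire_solution ::
  "(real \<Rightarrow> real) \<Rightarrow> ((real ^ 'n) \<times> real \<Rightarrow> real) \<Rightarrow> bool" where
  "entire_solution f w \<longleftrightarrow> C_class 2 w \<and> (\<forall>x t. 0 < w (x, t) \<and> w (x, t) < 1) \<and>
     (\<forall>x t. time_deriv w x t - laplacian (\<lambda>y. w (y, t)) x = f (w (x, t)))"

text \<open>
  \<open>admissible_b0 TYPE('n) f b0\<close>: \<open>b0\<close> has the properties by which the constant \<open>b\<^sub>0\<close>, depending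
  only on the dimension \<open>CARD('n)\<close> and on \<open>f\<close>, is specified.
\<close>

definition admissible_b0 :: "'n::finite itself \<Rightarrow> (real \<Rightarrow> real) \<Rightarrow> real \<Rightarrow> bool" where
  "admissible_b0 (_ :: 'n itself) f b0 \<longleftrightarrow> 0 < b0 \<and> b0 < 1 \<and>
     (\<exists>c0>0. \<exists>C0>0. \<forall>w :: (real ^ 'n) \<times> real \<Rightarrow> real.
        entire_solution f w \<and> (\<forall>t. (SUP x. w (x, t)) = 1) \<longrightarrow>
          (\<forall>l\<in>{1 - b0..<1}. \<exists>h L. L-lipschitz_on UNIV h \<and>
              {p. w p = l} = {(x, t). t = h x}) \<and>
          (\<forall>x t. w (x, t) > 1 - b0 \<longrightarrow>
              time_deriv w x t \<ge> c0 * (1 - w (x, t)) \<and>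
              norm (gradient (\<lambda>y. w (y, t)) x) + \<bar>time_deriv w x t\<bar> \<le> C0 * (1 - w (x, t))))"

end

theory Submission
  imports Defs
begin

text \<open>
  In the frame moving with the front the solution is \<open>w(x,t) = v(x + \<kappa> t e)\<close>, \<open>e\<close> the unit
  vector of the distinguished coordinate, and the properties of \<open>b\<^sub>0\<close> say that \<open>{v \<ge> 1 - b\<^sub>0}\<close> lies on one side of a Lipschitz
  graph over \<open>e\<^sup>\<bottom>\<close>. The height \<open>depth\<close> above this graph is globally Lipschitz, increases at unit
  rate along \<open>e\<close>, and \<open>v\<close> tends to 1 or 0, uniformly, as \<open>depth\<close> tends to \<open>+\<infinity>\<close> or \<open>-\<infinity>\<close>
  (\<open>front_depth_function\<close>). From here on, only this function matters, and everything is done with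
  the maximum principle and explicit barriers; no compactness of families of solutions is used.

  Speed. A large ball on which \<open>w\<close> is close to 1 grows at least at speed \<open>\<kappa>\<^sub>1\<close>, for every \<open>\<kappa>\<^sub>1 < \<kappa>\<^sub>*\<close>, because
  a planar profile wrapped around the ball, lowered by a small constant, is a subsolution
  (\<open>front_spreading\<close>). The front advances only at speed \<open>\<kappa>\<close> in the direction \<open>-e\<close>, and hence
  \<open>\<kappa> \<ge> \<kappa>\<^sub>*\<close> (\<open>speed_at_least_planar\<close>).

  Rigidity. Let \<open>\<kappa> = \<kappa>\<^sub>*\<close>. A ball that grows at speed almost \<open>\<kappa>\<^sub>*\<close> while its centre moves up at
  speed \<open>\<kappa>\<^sub>*\<close> stays almost tangent to a horizontal plane, and so the graph grows sublinearly,
  uniformly in the base point (\<open>depth_sublinear\<close>). Now fix \<open>h\<close> orthogonal to \<open>e\<close> and slide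
  \<open>v(x + h + \<tau> e)\<close> down over \<open>v\<close>. It lies above \<open>v\<close> for large \<open>\<tau>\<close>. If the sliding stopped at some
  \<open>\<tau> > 0\<close>, the two functions would almost touch in the transition layer, by a Harnack argument
  (\<open>positivity_propagation\<close>) they would be almost equal on large balls there, and \<open>v\<close> would be
  almost periodic with period \<open>h + \<tau> e\<close>. But \<open>M\<close> periods lead to depth at least \<open>M \<tau> - o(M)\<close>,
  where \<open>v\<close> is close to 1. So \<open>\<tau> = 0\<close> is reached and \<open>v(x + h) \<ge> v(x)\<close>
  (\<open>monotone_along_transversal\<close>). The same for \<open>-h\<close> shows that \<open>v\<close> depends on \<open>x \<bullet> e\<close> only, and a
  phase plane argument identifies the profile with \<open>g\<close> (\<open>travelling_wave_unique\<close>).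
\<close>

section \<open>Touching from below\<close>

text \<open>
  Only one-dimensional second derivative tests along the basis vectors are needed below. A jet
  records exactly what they use and applies to solutions and to barriers alike.
\<close>

definition jet :: "('a::euclidean_space \<Rightarrow> real) \<Rightarrow> 'a \<Rightarrow> 'a \<Rightarrow> real \<Rightarrow> real \<Rightarrow> bool" where
  "jet u x b p q \<longleftrightarrow> (\<exists>u'. (\<forall>s. ((\<lambda>s. u (x + s *\<^sub>R b)) has_real_derivative u' s) (at s)) \<and>
     u' 0 = p \<and> (u' has_real_derivative q) (at 0))"

lemma jet_diff:
  assumes "jet u x b p q" "jet w x b p' q'"
  shows "jet (\<lambda>x. u x - w x) x b (p - p') (q - q')"
proof -
  obtain u' w' where "\<forall>s. ((\<lambda>s. u (x + s *\<^sub>R b)) has_real_derivative u' s) (at s)" "u' 0 = p"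
    "(u' has_real_derivative q) (at 0)"
    "\<forall>s. ((\<lambda>s. w (x + s *\<^sub>R b)) has_real_derivative w' s) (at s)" "w' 0 = p'"
    "(w' has_real_derivative q') (at 0)"
    using assms unfolding jet_def by blast
  then show ?thesis
    unfolding jet_def by (intro exI[of _ "\<lambda>s. u' s - w' s"]) (auto intro!: DERIV_diff)
qed

lemma jet_add_const:
  assumes "jet u x b p q"
  shows "jet (\<lambda>x. u x + c) x b p q"
proof -
  obtain u' where "\<forall>s. ((\<lambda>s. u (x + s *\<^sub>R b)) has_real_derivative u' s) (at s)" "u' 0 = p"
    "(u' has_real_derivative q) (at 0)"
    using assms unfolding jet_def by blast
  then show ?thesis
    unfolding jet_def by (intro exI[of _ u']) (auto intro!: derivative_eq_intros)
qed

lemma jet_uminus: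
  assumes "jet u x b p q"
  shows "jet (\<lambda>x. - u x) x b (- p) (- q)"
proof -
  obtain u' where "\<forall>s. ((\<lambda>s. u (x + s *\<^sub>R b)) has_real_derivative u' s) (at s)" "u' 0 = p"
    "(u' has_real_derivative q) (at 0)"
    using assms unfolding jet_def by blast
  then show ?thesis
    unfolding jet_def by (intro exI[of _ "\<lambda>s. - u' s"]) (auto intro!: DERIV_minus)
qed

lemma jet_translate:
  assumes "jet u (x + h) b p q"
  shows "jet (\<lambda>x. u (x + h)) x b p q"
  using assms unfolding jet_def by (simp add: algebra_simps)

lemma local_min_second_derivative:
  fixes F F' :: "real \<Rightarrow> real"
  assumes F: "\<And>s. (F has_real_derivative F' s) (at s)"
    and F': "(F' has_real_derivative q) (at 0)"
    and min: "\<forall>\<^sub>F s in nhds 0. F 0 \<le> F s"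
  shows "F' 0 = 0 \<and> q \<ge> 0"
proof -
  obtain d where d: "d > 0" "\<And>s. \<bar>s\<bar> < d \<Longrightarrow> F 0 \<le> F s"
    using min unfolding eventually_nhds_metric by (auto simp: dist_real_def)
  have crit: "F' 0 = 0"
    using DERIV_local_min[OF F d(1)] d(2) by auto
  moreover have "q \<ge> 0"
  proof (rule ccontr)
    assume "\<not> q \<ge> 0"
    then obtain d' where d': "d' > 0" "\<And>h. h > 0 \<Longrightarrow> h < d' \<Longrightarrow> F' h < 0"
      using DERIV_neg_dec_right[OF F'] crit by force
    define s where "s = min d d' / 2"
    have s: "s > 0" "s < d" "s < d'" using d(1) d'(1) by (auto simp: s_def min_def)
    have "F s < F 0"
      by (rule DERIV_neg_imp_decreasing_open[OF s(1)])
        (use F d'(2) s in \<open>auto intro!: continuous_at_imp_continuous_on exI[of _ "F' _"] intro: DERIV_isCont\<close>)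
    then show False using d(2)[of s] s by auto
  qed
  ultimately show ?thesis by blast
qed

text \<open>
  Summed over the basis this is the comparison of Laplacians at a touching point.
\<close>

lemma jet_touching:
  assumes "jet u x b p q" "jet w x b p' q'"
    and min: "\<forall>\<^sub>F y in nhds x. u x - w x \<le> u y - w y"
  shows "p = p' \<and> q \<ge> q'"
proof -
  obtain F' where F': "\<And>s. ((\<lambda>s. u (x + s *\<^sub>R b) - w (x + s *\<^sub>R b)) has_real_derivative F' s) (at s)"
    "F' 0 = p - p'" "(F' has_real_derivative q - q') (at 0)"
    using jet_diff[OF assms(1,2)] unfolding jet_def by blast
  have "((\<lambda>s. x + s *\<^sub>R b) \<longlongrightarrow> x + 0 *\<^sub>R b) (nhds 0)"
    by (intro tendsto_intros) (simp add: filterlim_ident)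
  then have "\<forall>\<^sub>F s in nhds 0. u x - w x \<le> u (x + s *\<^sub>R b) - w (x + s *\<^sub>R b)"
    using eventually_compose_filterlim[OF min] by simp
  then have "F' 0 = 0 \<and> q - q' \<ge> 0"
    using local_min_second_derivative[OF F'(1,3)] by simp
  then show ?thesis using F'(2) by simp
qed

lemma C_class_DERIV_along:
  assumes "C_class (Suc k) u" "b \<in> Basis"
  shows "((\<lambda>s. u (y + s *\<^sub>R b)) has_real_derivative partial b u (y + s *\<^sub>R b)) (at s)"
proof -
  have "((\<lambda>r. u ((y + s *\<^sub>R b) + r *\<^sub>R b)) has_real_derivative partial b u (y + s *\<^sub>R b)) (at 0)"
    using assms unfolding partial_def by (simp add: DERIV_deriv_iff_real_differentiable)
  then have "((\<lambda>r. u (y + (r + s) *\<^sub>R b)) has_real_derivative partial b u (y + s *\<^sub>R b)) (at 0)"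
    by (simp add: algebra_simps)
  then show ?thesis
    using DERIV_shift[of "\<lambda>r. u (y + r *\<^sub>R b)" _ 0 s] by simp
qed

lemma jet_partial:
  assumes C2: "C_class 2 v" and b: "b \<in> Basis"
  shows "jet v x b (partial b v x) (partial b (partial b v) x)"
proof -
  have "C_class (Suc 1) v" "C_class (Suc 0) (partial b v)" using C2 b by (simp_all add: numeral_2_eq_2)
  from C_class_DERIV_along[OF this(1) b, of x] C_class_DERIV_along[OF this(2) b, of x 0] show ?thesis
    unfolding jet_def by (intro exI[of _ "\<lambda>s. partial b v (x + s *\<^sub>R b)"]) simp
qed

section \<open>Positivity spreads\<close>

text \<open>
  For large \<open>\<alpha>\<close> the Gaussian is a strict subsolution away from its centre: the term \<open>4 \<alpha>\<^sup>2 |x - y|\<^sup>2\<close>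
  in its Laplacian beats all lower order terms. This is the barrier of the Hopf lemma.
\<close>

lemma jet_gaussian:
  fixes x y b :: "'a::euclidean_space"
  assumes "b \<in> Basis"
  shows "jet (\<lambda>x. c * (exp (- \<alpha> * (norm (x - y))\<^sup>2) - k)) x b
    (- 2 * \<alpha> * ((x - y) \<bullet> b) * (c * exp (- \<alpha> * (norm (x - y))\<^sup>2)))
    ((4 * \<alpha>\<^sup>2 * ((x - y) \<bullet> b)\<^sup>2 - 2 * \<alpha>) * (c * exp (- \<alpha> * (norm (x - y))\<^sup>2)))"
proof -
  define m where "m = (x - y) \<bullet> b"
  have nrm: "(norm (x + s *\<^sub>R b - y))\<^sup>2 = (norm (x - y))\<^sup>2 + 2 * s * m + s\<^sup>2" for s
  proof -
    have "(norm ((x - y) + s *\<^sub>R b))\<^sup>2 = (norm (x - y))\<^sup>2 + 2 * s * m + s\<^sup>2"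
      using assms unfolding power2_norm_eq_inner m_def
      by (simp add: inner_add_left inner_add_right inner_commute power2_eq_square)
    then show ?thesis by (simp add: algebra_simps)
  qed
  show ?thesis
    unfolding jet_def nrm m_def[symmetric]
    by (rule exI[of _ "\<lambda>s. c * (exp (- \<alpha> * ((norm (x - y))\<^sup>2 + 2 * s * m + s\<^sup>2)) * (- \<alpha> * (2 * m + 2 * s)))"])
      (auto intro!: derivative_eq_intros simp: algebra_simps power2_eq_square)
qed

text \<open>
  A weak Harnack inequality, with a constant that depends on neither the function nor the place.
  On \<open>cball y R\<close> the barrier \<open>a (exp (-\<alpha> |x - y|\<^sup>2) - exp (-\<alpha> R\<^sup>2))\<close> is at most \<open>a\<close>, vanishes on the
  boundary sphere and is a strict subsolution outside \<open>cball y r\<close>, and so \<open>\<zeta>\<close> lies above it. A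
  contact can occur only where \<open>\<zeta> < a\<close>, which is why the differential inequality is assumed only
  there; the comparison of shifted solutions below relies on this.
\<close>

lemma positivity_propagation:
  fixes e :: "'a::euclidean_space"
  assumes "e \<in> Basis" "0 < r" "r < R" "0 \<le> R0" "R0 < R" "0 \<le> K" "0 \<le> \<kappa>"
  shows "\<exists>c>0. \<forall>a>0. \<forall>y. \<forall>\<zeta> P Q. continuous_on UNIV \<zeta> \<longrightarrow>
      (\<forall>x. \<forall>b\<in>Basis. jet \<zeta> x b (P x b) (Q x b)) \<longrightarrow> (\<forall>x. 0 \<le> \<zeta> x) \<longrightarrow>
      (\<forall>x. \<zeta> x < a \<longrightarrow> (\<Sum>b\<in>Basis. Q x b) - \<kappa> * P x e \<le> K * \<zeta> x) \<longrightarrow>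
      (\<forall>x\<in>cball y r. a \<le> \<zeta> x) \<longrightarrow> (\<forall>x\<in>cball y R0. c * a \<le> \<zeta> x)"
proof -
  define N where "N = real DIM('a)"
  define \<alpha> where "\<alpha> = max 1 ((2 * N + 2 * \<kappa> * R + K + 1) / (4 * r\<^sup>2))"
  have \<alpha>: "\<alpha> \<ge> 1" unfolding \<alpha>_def by simp
  have "4 * r\<^sup>2 * \<alpha> \<ge> 2 * N + 2 * \<kappa> * R + K + 1"
    using \<open>0 < r\<close> unfolding \<alpha>_def max_def by (auto simp: field_simps)
  then have "\<alpha> * (4 * r\<^sup>2 * \<alpha>) \<ge> \<alpha> * (2 * N + 2 * \<kappa> * R + K + 1)"
    using \<alpha> by (intro mult_left_mono) auto
  also have "\<alpha> * (2 * N + 2 * \<kappa> * R + K + 1) \<ge> 2 * \<alpha> * N + 2 * \<alpha> * \<kappa> * R + K + 1"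
  proof -
    have "(\<alpha> - 1) * (K + 1) \<ge> 0" using \<alpha> assms by simp
    then show ?thesis by (simp add: algebra_simps)
  qed
  ultimately have strict: "4 * \<alpha>\<^sup>2 * r\<^sup>2 > 2 * \<alpha> * N + 2 * \<alpha> * \<kappa> * R + K"
    by (simp add: power2_eq_square algebra_simps)
  define c where "c = exp (- \<alpha> * R0\<^sup>2) - exp (- \<alpha> * R\<^sup>2)"
  have "R0\<^sup>2 < R\<^sup>2" using assms by (intro power_strict_mono) auto
  then have c: "c > 0" using \<alpha> unfolding c_def by simp
  show ?thesis
  proof (intro exI[of _ c] conjI c allI impI ballI)
    fix a :: real and y :: 'a and \<zeta> P Q x0
    assume a: "0 < a" and cont: "continuous_on UNIV \<zeta>"
      and jets: "\<forall>x. \<forall>b\<in>Basis. jet \<zeta> x b (P x b) (Q x b)" and nonneg: "\<forall>x. 0 \<le> \<zeta> x"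
      and super: "\<forall>x. \<zeta> x < a \<longrightarrow> (\<Sum>b\<in>Basis. Q x b) - \<kappa> * P x e \<le> K * \<zeta> x"
      and inner: "\<forall>x\<in>cball y r. a \<le> \<zeta> x" and x0: "x0 \<in> cball y R0"
    define B where "B x = a * (exp (- \<alpha> * (norm (x - y))\<^sup>2) - exp (- \<alpha> * R\<^sup>2))" for x
    have contB: "continuous_on UNIV B" unfolding B_def by (intro continuous_intros)
    obtain m where m: "m \<in> cball y R" "\<And>x. x \<in> cball y R \<Longrightarrow> \<zeta> m - B m \<le> \<zeta> x - B x"
    proof -
      have "continuous_on (cball y R) (\<lambda>x. \<zeta> x - B x)"
        using cont contB by (intro continuous_on_diff) (auto intro: continuous_on_subset)
      then show ?thesis
        using continuous_attains_inf[of "cball y R" "\<lambda>x. \<zeta> x - B x"] assms that by auto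
    qed
    have "\<zeta> m - B m \<ge> 0"
    proof (rule ccontr)
      assume neg: "\<not> \<zeta> m - B m \<ge> 0"
      have B_less: "B m < a"
      proof -
        have "exp (- \<alpha> * (norm (m - y))\<^sup>2) \<le> 1" using \<alpha> by simp
        then have "exp (- \<alpha> * (norm (m - y))\<^sup>2) - exp (- \<alpha> * R\<^sup>2) < 1"
          by (smt (verit) exp_gt_zero)
        then show ?thesis using a unfolding B_def by (metis mult.right_neutral mult_less_cancel_left_pos)
      qed
      then have less: "\<zeta> m < a" using neg by simp
      define \<rho> where "\<rho> = norm (m - y)"
      have \<rho>1: "\<rho> > r"
      proof (rule ccontr)
        assume "\<not> \<rho> > r"
        then have "m \<in> cball y r" unfolding \<rho>_def by (simp add: dist_norm norm_minus_commute)
        then show False using less inner by force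
      qed
      have \<rho>2: "\<rho> < R"
      proof (rule ccontr)
        assume "\<not> \<rho> < R"
        then have "\<rho> = R" using m(1) unfolding \<rho>_def by (simp add: dist_norm norm_minus_commute)
        then have "B m = 0" unfolding B_def \<rho>_def by simp
        then show False using neg nonneg by (metis diff_zero)
      qed
      then have "m \<in> ball y R" unfolding \<rho>_def by (simp add: dist_norm norm_minus_commute)
      then have "\<forall>\<^sub>F x in nhds m. x \<in> ball y R" by (intro eventually_nhds_in_open open_ball)
      then have ev: "\<forall>\<^sub>F x in nhds m. \<zeta> m - B m \<le> \<zeta> x - B x"
        by eventually_elim (use m in auto)
      define E where "E = a * exp (- \<alpha> * \<rho>\<^sup>2)"
      have E: "E > 0" using a unfolding E_def by simp
      have touch: "P m b = - 2 * \<alpha> * ((m - y) \<bullet> b) * E \<and> Q m b \<ge> (4 * \<alpha>\<^sup>2 * ((m - y) \<bullet> b)\<^sup>2 - 2 * \<alpha>) * E"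
        if "b \<in> Basis" for b
        unfolding E_def \<rho>_def
        by (rule jet_touching[OF jets[rule_format, OF that] jet_gaussian[OF that] ev[unfolded B_def]])
      have "(\<Sum>b\<in>Basis. Q m b) \<ge> (\<Sum>b\<in>Basis. (4 * \<alpha>\<^sup>2 * ((m - y) \<bullet> b)\<^sup>2 - 2 * \<alpha>) * E)"
        using touch by (intro sum_mono) auto
      also have "(\<Sum>b\<in>Basis. (4 * \<alpha>\<^sup>2 * ((m - y) \<bullet> b)\<^sup>2 - 2 * \<alpha>) * E) = (4 * \<alpha>\<^sup>2 * \<rho>\<^sup>2 - 2 * \<alpha> * N) * E"
      proof -
        have "(\<Sum>b\<in>Basis. ((m - y) \<bullet> b)\<^sup>2) = \<rho>\<^sup>2"
          unfolding \<rho>_def power2_norm_eq_inner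
          by (subst euclidean_inner[of "m - y" "m - y"]) (simp add: power2_eq_square)
        then show ?thesis
          by (simp add: sum_distrib_right[symmetric] sum_subtractf sum_distrib_left[symmetric] N_def)
      qed
      finally have lap: "(\<Sum>b\<in>Basis. Q m b) \<ge> (4 * \<alpha>\<^sup>2 * \<rho>\<^sup>2 - 2 * \<alpha> * N) * E" .
      have "- P m e \<ge> - 2 * \<alpha> * R * E"
      proof -
        have "(m - y) \<bullet> e \<ge> - R"
          using Basis_le_norm[OF \<open>e \<in> Basis\<close>, of "m - y"] \<rho>2 unfolding \<rho>_def by linarith
        then have "(2 * \<alpha> * E) * ((m - y) \<bullet> e) \<ge> (2 * \<alpha> * E) * (- R)"
          using \<alpha> E by (intro mult_left_mono) auto
        then show ?thesis using touch[OF \<open>e \<in> Basis\<close>] by (simp add: algebra_simps)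
      qed
      then have "\<kappa> * - P m e \<ge> \<kappa> * (- 2 * \<alpha> * R * E)"
        using assms by (intro mult_left_mono) auto
      moreover have "(4 * \<alpha>\<^sup>2 * \<rho>\<^sup>2) * E \<ge> (4 * \<alpha>\<^sup>2 * r\<^sup>2) * E"
        using \<rho>1 E \<open>0 < r\<close> by (intro mult_right_mono mult_left_mono power_mono) auto
      ultimately have "(\<Sum>b\<in>Basis. Q m b) - \<kappa> * P m e
          \<ge> (4 * \<alpha>\<^sup>2 * r\<^sup>2 - 2 * \<alpha> * N - 2 * \<alpha> * \<kappa> * R) * E"
        using lap by (simp add: algebra_simps)
      moreover have "(4 * \<alpha>\<^sup>2 * r\<^sup>2 - 2 * \<alpha> * N - 2 * \<alpha> * \<kappa> * R) * E > K * E"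
        using strict E by (intro mult_strict_right_mono) auto
      moreover have "B m \<le> E" using a unfolding B_def E_def \<rho>_def by (simp add: algebra_simps)
      then have "K * E \<ge> K * \<zeta> m" using neg assms(6) by (intro mult_left_mono) auto
      ultimately show False using super less by (smt (verit))
    qed
    moreover have "x0 \<in> cball y R" using x0 assms by auto
    ultimately have "B x0 \<le> \<zeta> x0" using m(2)[of x0] by linarith
    moreover have "c * a \<le> B x0"
    proof -
      have "norm (x0 - y) \<le> R0" using x0 by (simp add: dist_norm norm_minus_commute)
      then have "(norm (x0 - y))\<^sup>2 \<le> R0\<^sup>2" by (intro power_mono) auto
      then have "exp (- \<alpha> * (norm (x0 - y))\<^sup>2) \<ge> exp (- \<alpha> * R0\<^sup>2)" using \<alpha> by simp
      then show ?thesis using a unfolding B_def c_def by simp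
    qed
    ultimately show "c * a \<le> \<zeta> x0" by linarith
  qed
qed

section \<open>Interior gradient bounds by reflection\<close>

lemma jet_reflect:
  assumes "b \<in> Basis" "b' \<in> Basis"
    and "jet u (x - (2 * ((x - x0) \<bullet> b)) *\<^sub>R b) b' p q"
  shows "jet (\<lambda>x. u (x - (2 * ((x - x0) \<bullet> b)) *\<^sub>R b)) x b' (if b' = b then - p else p) q"
proof -
  define y where "y = x - (2 * ((x - x0) \<bullet> b)) *\<^sub>R b"
  obtain u' where u': "\<And>s. ((\<lambda>s. u (y + s *\<^sub>R b')) has_real_derivative u' s) (at s)" "u' 0 = p"
    "(u' has_real_derivative q) (at 0)"
    using assms(3) unfolding jet_def y_def by blast
  show ?thesis
  proof (cases "b' = b")
    case True
    have eq: "x + s *\<^sub>R b' - (2 * ((x + s *\<^sub>R b' - x0) \<bullet> b)) *\<^sub>R b = y + (- s) *\<^sub>R b'" for s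
    proof -
      have "(x + s *\<^sub>R b' - x0) \<bullet> b = (x - x0) \<bullet> b + s"
        using assms(1) True by (simp add: inner_diff_left inner_add_left)
      then have "(2 * ((x + s *\<^sub>R b' - x0) \<bullet> b)) *\<^sub>R b = (2 * ((x - x0) \<bullet> b)) *\<^sub>R b + (s + s) *\<^sub>R b"
        by (simp add: scaleR_left_distrib)
      then show ?thesis
        unfolding y_def True scaleR_left_distrib[of s s] by simp
    qed
    have "((\<lambda>s. u (y + (- s) *\<^sub>R b')) has_real_derivative - u' (- s)) (at s)" for s
    proof -
      have "((\<lambda>s. - s) has_real_derivative - 1) (at s)" by (auto intro!: derivative_eq_intros)
      from DERIV_chain2[where f = "\<lambda>s. u (y + s *\<^sub>R b')" and g = "\<lambda>s. - s", OF u'(1) this]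
      show ?thesis by simp
    qed
    moreover have "((\<lambda>s. - u' (- s)) has_real_derivative q) (at 0)"
    proof -
      have "((\<lambda>s. - s) has_real_derivative - 1) (at (0::real))" by (auto intro!: derivative_eq_intros)
      from DERIV_minus[OF DERIV_chain2[where f = u' and g = "\<lambda>s. - s", OF _ this]] u'(3)
      show ?thesis by simp
    qed
    ultimately show ?thesis
      unfolding jet_def eq using u'(2) True by (intro exI[of _ "\<lambda>s. - u' (- s)"]) auto
  next
    case False
    then have "b' \<bullet> b = 0" using assms by (simp add: inner_Basis)
    then have eq: "x + s *\<^sub>R b' - (2 * ((x + s *\<^sub>R b' - x0) \<bullet> b)) *\<^sub>R b = y + s *\<^sub>R b'" for s
      unfolding y_def by (simp add: inner_diff_left inner_add_left)
    show ?thesis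
      unfolding jet_def eq using u' False by (intro exI[of _ u']) auto
  qed
qed

text \<open>
  With \<open>k = -\<kappa>/2\<close> the weight turns the drift \<open>-\<kappa> \<partial>\<^sub>e\<close> into a term of order zero, which is needed
  because the reflection in \<open>e\<close> does not commute with the drift.
\<close>

lemma jet_exp_weight:
  assumes "jet v x b p q"
  shows "jet (\<lambda>x. exp (k * ((x - x0) \<bullet> e)) * v x) x b
    (exp (k * ((x - x0) \<bullet> e)) * (p + k * (b \<bullet> e) * v x))
    (exp (k * ((x - x0) \<bullet> e)) * (q + 2 * (k * (b \<bullet> e)) * p + (k * (b \<bullet> e))\<^sup>2 * v x))"
proof -
  define m where "m = k * ((x - x0) \<bullet> e)"
  define kb where "kb = k * (b \<bullet> e)"
  obtain v' where v': "\<And>s. ((\<lambda>s. v (x + s *\<^sub>R b)) has_real_derivative v' s) (at s)" "v' 0 = p"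
    "(v' has_real_derivative q) (at 0)"
    using assms unfolding jet_def by blast
  have eq: "k * ((x + s *\<^sub>R b - x0) \<bullet> e) = m + s * kb" for s
    unfolding m_def kb_def by (simp add: inner_diff_left inner_add_left algebra_simps)
  have v'': "((\<lambda>s. v (x + s *\<^sub>R b)) has_real_derivative p) (at 0)" using v'(1)[of 0] v'(2) by simp
  show ?thesis
    unfolding jet_def eq m_def[symmetric] kb_def[symmetric]
    by (rule exI[of _ "\<lambda>s. exp (m + s * kb) * (v' s + kb * v (x + s *\<^sub>R b))"])
      (auto intro!: derivative_eq_intros v'(1,3) v'' simp: algebra_simps v'(2) power2_eq_square)
qed

text \<open>
  Compare \<open>u\<close> with its mirror image in the hyperplane through \<open>x0\<close> orthogonal to \<open>b\<close>. The difference
  \<open>\<phi>\<close> vanishes on the hyperplane and has bounded Laplacian, so on the half ball it is dominated by a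
  barrier \<open>\<psi>\<close> of sufficiently negative Laplacian, which at \<open>x0 + s b\<close> is of order \<open>s\<close>.
\<close>

lemma reflection_estimate:
  fixes u :: "'a::euclidean_space \<Rightarrow> real"
  assumes b: "b \<in> Basis" and cont: "continuous_on UNIV u"
    and jets: "\<And>x b. b \<in> Basis \<Longrightarrow> jet u x b (P x b) (Q x b)"
    and lap: "\<And>x. x \<in> cball x0 1 \<Longrightarrow> \<bar>\<Sum>b\<in>Basis. Q x b\<bar> \<le> F"
    and bound: "\<And>x. x \<in> cball x0 1 \<Longrightarrow> \<bar>u x\<bar> \<le> M"
    and s: "0 \<le> s" "s \<le> 1"
  shows "u (x0 + s *\<^sub>R b) - u (x0 - s *\<^sub>R b) \<le> (2 * M * DIM('a) + F + 1 + 2 * M) * s"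
proof -
  define N where "N = real DIM('a)"
  \<comment> \<open>\<open>A\<close> makes the Laplacian of the barrier \<open>\<psi>\<close> smaller than \<open>- 2 F\<close>.\<close>
  define A where "A = 2 * M * N + F + 1"
  have M: "M \<ge> 0" using bound[of x0] by simp
  have F: "F \<ge> 0" using lap[of x0] by simp
  have A: "A \<ge> 0" using M F unfolding A_def N_def by simp
  define \<sigma> where "\<sigma> x = (x - x0) \<bullet> b" for x
  define R where "R x = x - (2 * \<sigma> x) *\<^sub>R b" for x
  define \<phi> where "\<phi> x = u x - u (R x)" for x
  define \<psi> where "\<psi> x = A * \<sigma> x - A * (\<sigma> x)\<^sup>2 + 2 * M * (norm (x - x0))\<^sup>2" for x
  have normb: "norm b = 1" using b by simp
  have R_ball: "R x \<in> cball x0 1" if "x \<in> cball x0 1" for x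
  proof -
    have "(norm (R x - x0))\<^sup>2 = (norm (x - x0))\<^sup>2"
    proof -
      have "R x - x0 = (x - x0) - (2 * \<sigma> x) *\<^sub>R b" unfolding R_def by simp
      then have "(norm (R x - x0))\<^sup>2 = (norm (x - x0))\<^sup>2 - 2 * (2 * \<sigma> x) * ((x - x0) \<bullet> b) + (2 * \<sigma> x)\<^sup>2"
        using b by (simp only: power2_norm_eq_inner inner_diff_left[of "x - x0"] inner_diff_right[of _ "x - x0"])
          (simp add: inner_commute power2_eq_square)
      then show ?thesis unfolding \<sigma>_def[symmetric] by (simp add: power2_eq_square)
    qed
    then show ?thesis using that by (simp add: dist_norm norm_minus_commute)
  qed
  have jet\<psi>: "jet \<psi> x b' (if b' = b then A - 2 * A * \<sigma> x + 4 * M * ((x - x0) \<bullet> b') else 4 * M * ((x - x0) \<bullet> b'))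
      ((if b' = b then - 2 * A else 0) + 4 * M)" if "b' \<in> Basis" for x b'
  proof -
    define \<delta> :: real where "\<delta> = (if b' = b then 1 else 0)"
    define m where "m = (x - x0) \<bullet> b'"
    have nrm: "(norm (x + s *\<^sub>R b' - x0))\<^sup>2 = (norm (x - x0))\<^sup>2 + 2 * s * m + s\<^sup>2" for s
    proof -
      have "(norm ((x - x0) + s *\<^sub>R b'))\<^sup>2 = (norm (x - x0))\<^sup>2 + 2 * s * m + s\<^sup>2"
        using that unfolding power2_norm_eq_inner m_def
        by (simp add: inner_add_left inner_add_right inner_commute power2_eq_square)
      then show ?thesis by (simp add: algebra_simps)
    qed
    have sig: "\<sigma> (x + s *\<^sub>R b') = \<sigma> x + s * \<delta>" for s
      using that b unfolding \<sigma>_def \<delta>_def by (simp add: inner_diff_left inner_add_left inner_Basis)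
    have "\<delta> * \<delta> = \<delta>" unfolding \<delta>_def by simp
    then have "jet \<psi> x b' (A * \<delta> - 2 * A * \<sigma> x * \<delta> + 4 * M * m) (- 2 * A * \<delta> + 4 * M)"
      unfolding jet_def \<psi>_def nrm sig
      by (intro exI[of _ "\<lambda>s. A * \<delta> - 2 * A * (\<sigma> x + s * \<delta>) * \<delta> + 2 * M * (2 * m + 2 * s)"])
        (auto intro!: derivative_eq_intros simp: algebra_simps power2_eq_square)
    then show ?thesis unfolding \<delta>_def m_def by (cases "b' = b") auto
  qed
  have jet\<phi>: "jet \<phi> x b' (P x b' - (if b' = b then - P (R x) b' else P (R x) b')) (Q x b' - Q (R x) b')"
    if "b' \<in> Basis" for x b'
    unfolding \<phi>_def R_def \<sigma>_def
    by (intro jet_diff jets[OF that] jet_reflect[OF b that])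
  define S where "S = cball x0 1 \<inter> {x. 0 \<le> \<sigma> x}"
  have "compact S"
    unfolding S_def \<sigma>_def
    by (intro compact_Int_closed closed_Collect_le continuous_intros) auto
  have contR: "continuous_on UNIV R" unfolding R_def \<sigma>_def by (intro continuous_intros)
  have cont\<phi>: "continuous_on UNIV \<phi>"
    unfolding \<phi>_def using continuous_on_compose2[OF cont contR] cont
    by (intro continuous_on_diff) auto
  have cont\<psi>: "continuous_on UNIV \<psi>" unfolding \<psi>_def \<sigma>_def by (intro continuous_intros)
  have "continuous_on S (\<lambda>x. \<psi> x - \<phi> x)"
    using continuous_on_diff[OF cont\<psi> cont\<phi>] by (rule continuous_on_subset) simp
  moreover have "x0 + s *\<^sub>R b \<in> S"
    using s b unfolding S_def \<sigma>_def by (simp add: dist_norm)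
  ultimately obtain m where m: "m \<in> S" "\<And>x. x \<in> S \<Longrightarrow> \<psi> m - \<phi> m \<le> \<psi> x - \<phi> x"
    using continuous_attains_inf[OF \<open>compact S\<close>, of "\<lambda>x. \<psi> x - \<phi> x"] by blast
  have "\<psi> m - \<phi> m \<ge> 0"
  proof (rule ccontr)
    assume neg: "\<not> \<psi> m - \<phi> m \<ge> 0"
    have mball: "m \<in> cball x0 1" and m\<sigma>: "0 \<le> \<sigma> m" using m(1) unfolding S_def by auto
    have "\<sigma> m \<le> norm (m - x0)" unfolding \<sigma>_def using Basis_le_norm[OF b, of "m - x0"] by linarith
    then have m\<sigma>1: "\<sigma> m \<le> 1" using mball by (simp add: dist_norm norm_minus_commute)
    have low: "A * \<sigma> m - A * (\<sigma> m)\<^sup>2 \<ge> 0"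
    proof -
      have "A * (\<sigma> m * (1 - \<sigma> m)) \<ge> 0" using A m\<sigma> m\<sigma>1 by simp
      then show ?thesis by (simp add: algebra_simps power2_eq_square)
    qed
    have pos: "0 < \<sigma> m"
    proof (rule ccontr)
      assume "\<not> 0 < \<sigma> m"
      then have "\<sigma> m = 0" using m\<sigma> by simp
      then have "\<phi> m = 0" "\<psi> m \<ge> 0" unfolding \<phi>_def R_def \<psi>_def using M by simp_all
      then show False using neg by simp
    qed
    have inside: "norm (m - x0) < 1"
    proof (rule ccontr)
      assume "\<not> norm (m - x0) < 1"
      then have "norm (m - x0) = 1" using mball by (simp add: dist_norm norm_minus_commute)
      then have "\<psi> m \<ge> 2 * M" unfolding \<psi>_def using low by simp
      moreover have "\<phi> m \<le> 2 * M"
        unfolding \<phi>_def using bound[OF mball] bound[OF R_ball[OF mball]] by linarith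
      ultimately show False using neg by simp
    qed
    have "open (ball x0 1 \<inter> {x. 0 < \<sigma> x})"
      unfolding \<sigma>_def by (intro open_Int open_ball open_Collect_less continuous_intros)
    moreover have "m \<in> ball x0 1 \<inter> {x. 0 < \<sigma> x}"
      using inside pos by (simp add: dist_norm norm_minus_commute)
    ultimately have "\<forall>\<^sub>F x in nhds m. x \<in> ball x0 1 \<inter> {x. 0 < \<sigma> x}"
      by (rule eventually_nhds_in_open)
    then have ev: "\<forall>\<^sub>F x in nhds m. \<psi> m - \<phi> m \<le> \<psi> x - \<phi> x"
      by eventually_elim (rule m(2), auto simp: S_def)
    have "(\<Sum>b'\<in>Basis. Q m b' - Q (R m) b') \<le> (\<Sum>b'\<in>Basis. (if b' = b then - 2 * A else 0) + 4 * M)"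
      using jet_touching[OF jet\<psi> jet\<phi> ev] by (intro sum_mono) auto
    also have "\<dots> = - 2 * A + 4 * M * N"
      using b by (simp add: sum.distrib N_def)
    finally have "(\<Sum>b'\<in>Basis. Q m b') - (\<Sum>b'\<in>Basis. Q (R m) b') \<le> - 2 * A + 4 * M * N"
      by (simp add: sum_subtractf)
    then show False
      using lap[OF mball] lap[OF R_ball[OF mball]] unfolding A_def by (simp add: algebra_simps)
  qed
  then have "\<phi> (x0 + s *\<^sub>R b) \<le> \<psi> (x0 + s *\<^sub>R b)"
    using m(2)[OF \<open>x0 + s *\<^sub>R b \<in> S\<close>] by linarith
  moreover have "R (x0 + s *\<^sub>R b) = x0 - s *\<^sub>R b"
  proof -
    have "\<sigma> (x0 + s *\<^sub>R b) = s" using b unfolding \<sigma>_def by simp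
    then have "R (x0 + s *\<^sub>R b) = x0 + s *\<^sub>R b - (s + s) *\<^sub>R b" unfolding R_def by simp
    then show ?thesis unfolding scaleR_left_distrib by simp
  qed
  moreover have "\<psi> (x0 + s *\<^sub>R b) = A * s - A * s\<^sup>2 + 2 * M * s\<^sup>2"
    using b s unfolding \<psi>_def \<sigma>_def by simp
  moreover have "A * s - A * s\<^sup>2 + 2 * M * s\<^sup>2 \<le> (A + 2 * M) * s"
  proof -
    have "s\<^sup>2 \<le> s" using s by (simp add: power2_eq_square mult_left_le)
    then have "2 * M * s\<^sup>2 \<le> 2 * M * s" using M by (intro mult_left_mono) auto
    moreover have "A * s\<^sup>2 \<ge> 0" using A by simp
    ultimately show ?thesis by (simp add: algebra_simps)
  qed
  ultimately show ?thesis unfolding \<phi>_def A_def N_def by simp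
qed

lemma abs_one_minus_exp_le:
  fixes y :: real
  assumes "\<bar>y\<bar> \<le> c"
  shows "\<bar>1 - exp y\<bar> \<le> exp c * \<bar>y\<bar>"
proof (cases "y \<ge> 0")
  case True
  have "1 - y \<le> exp (- y)" using exp_ge_add_one_self[of "- y"] by simp
  then have "(1 - y) * exp y \<le> exp (- y) * exp y" by (intro mult_right_mono) auto
  then have "exp y - 1 \<le> exp y * y" by (simp add: exp_minus algebra_simps)
  also have "\<dots> \<le> exp c * y" using True assms by (intro mult_right_mono) auto
  finally show ?thesis using True by simp
next
  case False
  have "1 - exp y \<le> - y" using exp_ge_add_one_self[of y] by linarith
  also have "\<dots> \<le> exp c * (- y)"
  proof -
    have "1 \<le> exp c" using assms by simp
    then have "1 * (- y) \<le> exp c * (- y)" using False by (intro mult_right_mono) auto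
    then show ?thesis by simp
  qed
  finally show ?thesis using False by simp
qed

text \<open>
  The symmetric difference quotients of the weighted function are controlled by reflection, along
  each basis vector and uniformly in the base point; the general increment is a sum of such steps.
\<close>

lemma bounded_solution_lipschitz:
  fixes v :: "'a::euclidean_space \<Rightarrow> real"
  assumes e: "e \<in> Basis" and cont: "continuous_on UNIV v" and "0 \<le> \<kappa>"
    and jets: "\<And>x b. b \<in> Basis \<Longrightarrow> jet v x b (P x b) (Q x b)"
    and bound: "\<And>x. \<bar>v x\<bar> \<le> 1"
    and rhs: "\<And>x. \<bar>(\<Sum>b\<in>Basis. Q x b) - \<kappa> * P x e\<bar> \<le> F"
  shows "\<exists>C\<ge>0. \<forall>x y. \<bar>v x - v y\<bar> \<le> C * norm (x - y)"
proof -
  define M where "M = exp (\<kappa> / 2)"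
  define F' where "F' = M * (F + \<kappa>\<^sup>2 / 4)"
  have F: "F \<ge> 0" using rhs[of 0] by linarith
  \<comment> \<open>The last term of \<open>C\<close> accounts for removing the exponential weight.\<close>
  define C where "C = 2 * M * DIM('a) + F' + 1 + 2 * M + M * \<kappa>"
  have C: "C \<ge> 0" unfolding C_def F'_def M_def using F \<open>0 \<le> \<kappa>\<close> by simp
  have sym: "\<bar>v (x0 + s *\<^sub>R b) - v (x0 - s *\<^sub>R b)\<bar> \<le> C * s" if b: "b \<in> Basis" and s: "0 \<le> s" "s \<le> 1"
    for x0 b s
  proof -
    define k where "k = - \<kappa> / 2"
    define E where "E x = exp (k * ((x - x0) \<bullet> e))" for x
    define u where "u x = E x * v x" for x
    define P' where "P' x b = E x * (P x b + k * (b \<bullet> e) * v x)" for x b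
    define Q' where "Q' x b = E x * (Q x b + 2 * (k * (b \<bullet> e)) * P x b + (k * (b \<bullet> e))\<^sup>2 * v x)" for x b
    have jetu: "jet u x b (P' x b) (Q' x b)" if "b \<in> Basis" for x b
      unfolding u_def P'_def Q'_def E_def by (rule jet_exp_weight[OF jets[OF that]])
    have E: "0 < E x" "E x \<le> M" if "x \<in> cball x0 1" for x
    proof -
      have "\<bar>(x - x0) \<bullet> e\<bar> \<le> 1"
        using Basis_le_norm[OF e, of "x - x0"] that by (simp add: dist_norm norm_minus_commute)
      then have "(\<kappa> / 2) * (- ((x - x0) \<bullet> e)) \<le> (\<kappa> / 2) * 1"
        using \<open>0 \<le> \<kappa>\<close> by (intro mult_left_mono) auto
      then show "0 < E x" "E x \<le> M" unfolding E_def M_def k_def by auto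
    qed
    have contu: "continuous_on UNIV u"
      unfolding u_def E_def by (intro continuous_intros cont)
    have sumQ: "(\<Sum>b\<in>Basis. Q' x b) = E x * ((\<Sum>b\<in>Basis. Q x b) - \<kappa> * P x e + \<kappa>\<^sup>2 / 4 * v x)" for x
    proof -
      have "(\<Sum>b\<in>Basis. 2 * (k * (b \<bullet> e)) * P x b) = (\<Sum>b\<in>Basis. if b = e then 2 * k * P x b else 0)"
        using e by (intro sum.cong) (auto simp: inner_Basis)
      then have 1: "(\<Sum>b\<in>Basis. 2 * (k * (b \<bullet> e)) * P x b) = 2 * k * P x e" using e by simp
      have "(\<Sum>b\<in>Basis. (k * (b \<bullet> e))\<^sup>2 * v x) = (\<Sum>b\<in>Basis. if b = e then k\<^sup>2 * v x else 0)"
        using e by (intro sum.cong) (auto simp: inner_Basis)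
      then have 2: "(\<Sum>b\<in>Basis. (k * (b \<bullet> e))\<^sup>2 * v x) = k\<^sup>2 * v x" using e by simp
      show ?thesis
        unfolding Q'_def sum_distrib_left[symmetric] sum.distrib 1 2
        by (simp add: k_def power_divide)
    qed
    have lap: "\<bar>\<Sum>b\<in>Basis. Q' x b\<bar> \<le> F'" if "x \<in> cball x0 1" for x
    proof -
      have "\<bar>(\<Sum>b\<in>Basis. Q x b) - \<kappa> * P x e + \<kappa>\<^sup>2 / 4 * v x\<bar> \<le> F + \<kappa>\<^sup>2 / 4 * 1"
      proof -
        have "\<bar>\<kappa>\<^sup>2 / 4 * v x\<bar> \<le> \<kappa>\<^sup>2 / 4 * 1"
          unfolding abs_mult using bound[of x] by (intro mult_mono) auto
        then show ?thesis using rhs[of x] by linarith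
      qed
      then show ?thesis
        unfolding sumQ abs_mult F'_def using E[OF that] by (intro mult_mono) auto
    qed
    have bu: "\<bar>u x\<bar> \<le> M" if "x \<in> cball x0 1" for x
      unfolding u_def abs_mult using mult_mono[of "\<bar>E x\<bar>" M "\<bar>v x\<bar>" 1] E[OF that] bound[of x] by auto
    define D where "D = u (x0 + s *\<^sub>R b) - u (x0 - s *\<^sub>R b)"
    have D1: "D \<le> (2 * M * DIM('a) + F' + 1 + 2 * M) * s"
      unfolding D_def by (rule reflection_estimate[OF b contu jetu lap bu s])
    have D2: "- D \<le> (2 * M * DIM('a) + F' + 1 + 2 * M) * s"
    proof -
      have "(- u (x0 + s *\<^sub>R b)) - (- u (x0 - s *\<^sub>R b)) \<le> (2 * M * DIM('a) + F' + 1 + 2 * M) * s"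
        by (rule reflection_estimate[OF b continuous_on_minus[OF contu] jet_uminus[OF jetu] _ _ s])
          (use lap bu in \<open>simp_all add: sum_negf\<close>)
      then show ?thesis unfolding D_def by simp
    qed
    have close: "\<bar>v (x0 + r *\<^sub>R b) - u (x0 + r *\<^sub>R b)\<bar> \<le> M * \<kappa> / 2 * s" if r: "\<bar>r\<bar> = s" for r
    proof -
      have bb: "\<bar>b \<bullet> e\<bar> \<le> 1" using b e by (simp add: inner_Basis)
      have "\<bar>k * (r * (b \<bullet> e))\<bar> = (\<kappa> / 2) * (s * \<bar>b \<bullet> e\<bar>)"
        unfolding k_def abs_mult r using \<open>0 \<le> \<kappa>\<close> by simp
      also have "\<dots> \<le> (\<kappa> / 2) * (s * 1)" using bb \<open>0 \<le> \<kappa>\<close> s by (intro mult_left_mono) auto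
      finally have y: "\<bar>k * (r * (b \<bullet> e))\<bar> \<le> \<kappa> / 2 * s" by simp
      then have "\<bar>k * (r * (b \<bullet> e))\<bar> \<le> \<kappa> / 2"
        using s \<open>0 \<le> \<kappa>\<close> mult_left_mono[of s 1 "\<kappa> / 2"] by auto
      then have "\<bar>1 - exp (k * (r * (b \<bullet> e)))\<bar> \<le> M * \<bar>k * (r * (b \<bullet> e))\<bar>"
        unfolding M_def by (rule abs_one_minus_exp_le)
      also have "\<dots> \<le> M * (\<kappa> / 2 * s)" unfolding M_def by (intro mult_left_mono y) auto
      finally have "\<bar>1 - exp (k * (r * (b \<bullet> e)))\<bar> \<le> M * (\<kappa> / 2 * s)" .
      moreover have "v (x0 + r *\<^sub>R b) - u (x0 + r *\<^sub>R b) = (1 - exp (k * (r * (b \<bullet> e)))) * v (x0 + r *\<^sub>R b)"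
        unfolding u_def E_def by (simp add: algebra_simps)
      moreover have "\<bar>1 - exp (k * (r * (b \<bullet> e)))\<bar> * \<bar>v (x0 + r *\<^sub>R b)\<bar> \<le> \<bar>1 - exp (k * (r * (b \<bullet> e)))\<bar> * 1"
        using bound by (intro mult_left_mono) auto
      ultimately show ?thesis by (simp add: abs_mult)
    qed
    have "\<bar>v (x0 + s *\<^sub>R b) - u (x0 + s *\<^sub>R b)\<bar> \<le> M * \<kappa> / 2 * s"
      "\<bar>v (x0 - s *\<^sub>R b) - u (x0 - s *\<^sub>R b)\<bar> \<le> M * \<kappa> / 2 * s"
      using close[of s] close[of "- s"] s by auto
    moreover have "C * s = (2 * M * DIM('a) + F' + 1 + 2 * M) * s + M * \<kappa> / 2 * s + M * \<kappa> / 2 * s"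
      unfolding C_def by (simp add: algebra_simps)
    ultimately show ?thesis
      using D1 D2 unfolding D_def by linarith
  qed
  have step: "\<bar>v (x + t *\<^sub>R b) - v x\<bar> \<le> C * \<bar>t\<bar>" if b: "b \<in> Basis" and t: "\<bar>t\<bar> \<le> 1" for x b t
  proof -
    have halves: "(t / 2) *\<^sub>R b + (t / 2) *\<^sub>R b = t *\<^sub>R b" by (simp flip: scaleR_left_distrib)
    have "\<bar>v (x + t *\<^sub>R b) - v x\<bar> \<le> C * (\<bar>t\<bar> / 2)"
    proof (cases "t \<ge> 0")
      case True
      then show ?thesis
        using sym[OF b, of "t / 2" "x + (t / 2) *\<^sub>R b"] t halves by (simp add: add.assoc)
    next
      case False
      then show ?thesis
        using sym[OF b, of "- t / 2" "x + (t / 2) *\<^sub>R b"] t halves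
        by (simp add: add.assoc abs_minus_commute)
    qed
    then show ?thesis using mult_nonneg_nonneg[OF C, of "\<bar>t\<bar>"] by simp
  qed
  have near: "\<bar>v (x + y) - v x\<bar> \<le> C * DIM('a) * norm y" if y: "norm y \<le> 1" for x y
  proof -
    have "\<bar>v (x + (\<Sum>b\<in>S. (y \<bullet> b) *\<^sub>R b)) - v x\<bar> \<le> C * (card S * norm y)" if "finite S" "S \<subseteq> Basis" for S
      using that
    proof (induction S rule: finite_induct)
      case empty
      then show ?case by simp
    next
      case (insert b S)
      have yb: "\<bar>y \<bullet> b\<bar> \<le> norm y" using insert.prems by (intro Basis_le_norm) auto
      have "\<bar>v ((x + (\<Sum>b\<in>S. (y \<bullet> b) *\<^sub>R b)) + (y \<bullet> b) *\<^sub>R b) - v (x + (\<Sum>b\<in>S. (y \<bullet> b) *\<^sub>R b))\<bar> \<le> C * \<bar>y \<bullet> b\<bar>"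
        using insert.prems yb y by (intro step) auto
      also have "\<dots> \<le> C * norm y" using yb C by (intro mult_left_mono)
      finally have "\<bar>v (x + (\<Sum>b\<in>insert b S. (y \<bullet> b) *\<^sub>R b)) - v (x + (\<Sum>b\<in>S. (y \<bullet> b) *\<^sub>R b))\<bar> \<le> C * norm y"
        using insert.hyps by (simp add: algebra_simps)
      then show ?case using insert by (simp add: algebra_simps)
    qed
    from this[of Basis] show ?thesis by (simp add: euclidean_representation algebra_simps)
  qed
  define L where "L = max (C * DIM('a)) 2"
  have "\<bar>v x - v y\<bar> \<le> L * norm (x - y)" for x y
  proof (cases "norm (x - y) \<le> 1")
    case True
    then have "\<bar>v (y + (x - y)) - v y\<bar> \<le> C * DIM('a) * norm (x - y)" by (rule near)
    also have "\<dots> \<le> L * norm (x - y)" unfolding L_def by (intro mult_right_mono) auto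
    finally show ?thesis by simp
  next
    case False
    have "\<bar>v x - v y\<bar> \<le> 2 * 1" using bound[of x] bound[of y] by linarith
    also have "\<dots> \<le> L * norm (x - y)" using False unfolding L_def by (intro mult_mono) auto
    finally show ?thesis .
  qed
  moreover have "L \<ge> 0" unfolding L_def by simp
  ultimately show ?thesis by blast
qed

section \<open>The nonlinearity near its zeros\<close>

lemma F1_lipschitz_bound:
  assumes "F1 f"
  shows "\<exists>L\<ge>0. \<forall>u\<in>{0..1}. \<forall>w\<in>{0..1}. \<bar>f u - f w\<bar> \<le> L * \<bar>u - w\<bar>"
  using assms unfolding F1_def lipschitz_on_def by (auto simp: dist_real_def)

text \<open>
  The Hoelder continuity of \<open>f'\<close> carries the sign of the derivative at the end point over to a
  neighbourhood, and the mean value theorem gives the rate.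
\<close>

lemma strictly_decreasing_near_endpoint:
  assumes F1: "F1 f" and p: "p = 0 \<or> p = 1" and d: "d < 0"
    and der: "(f has_real_derivative d) (at p within {0..1})"
  shows "\<exists>\<eta>\<in>{0<..<1/2}. \<exists>\<mu>>0. \<forall>u\<in>{0..1}. \<forall>w\<in>{0..1}. \<bar>u - p\<bar> \<le> \<eta> \<longrightarrow> \<bar>w - p\<bar> \<le> \<eta> \<longrightarrow> w \<le> u \<longrightarrow>
    f u - f w \<le> - \<mu> * (u - w)"
proof -
  obtain \<alpha> \<gamma> where \<alpha>: "0 < \<alpha>" and \<gamma>: "0 < \<gamma>" "\<gamma> < 1"
    and hol: "C1_holder_on ({0..<\<gamma>} \<union> {1-\<gamma><..1}) \<alpha> f"
    using F1 unfolding F1_def by auto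
  define S where "S = {0..<\<gamma>} \<union> {1-\<gamma><..1::real}"
  obtain f' C where f': "\<And>u. u \<in> S \<Longrightarrow> (f has_real_derivative f' u) (at u within S)"
    and C: "\<And>u w. u \<in> S \<Longrightarrow> w \<in> S \<Longrightarrow> \<bar>f' u - f' w\<bar> \<le> C * \<bar>u - w\<bar> powr \<alpha>"
    using hol unfolding C1_holder_on_def S_def by blast
  have pS: "p \<in> S" using p \<gamma> unfolding S_def by auto
  define I where "I = (\<lambda>\<eta>. {u \<in> {0..1}. \<bar>u - p\<bar> \<le> \<eta>})"
  have I_eq: "I \<eta> = (if p = 0 then {0..\<eta>} else {1-\<eta>..1})" if "0 < \<eta>" "\<eta> < 1" for \<eta>
    using p that unfolding I_def by auto
  have I_S: "I \<eta> \<subseteq> S" if "0 < \<eta>" "\<eta> < \<gamma>" for \<eta>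
    using p that \<gamma> unfolding I_def S_def by auto
  have "f' p = d"
  proof -
    have \<gamma>2: "0 < \<gamma>/2" "\<gamma>/2 < \<gamma>" "\<gamma>/2 < 1" using \<gamma> by auto
    have "at p within I (\<gamma>/2) \<noteq> bot"
      unfolding I_eq[OF \<gamma>2(1,3)] using p \<gamma> by (auto simp: trivial_limit_within islimpt_Icc)
    moreover have "(f has_real_derivative f' p) (at p within I (\<gamma>/2))"
      using f'[OF pS] I_S[OF \<gamma>2(1,2)] by (rule has_field_derivative_subset)
    moreover have "(f has_real_derivative d) (at p within I (\<gamma>/2))"
      using der by (rule has_field_derivative_subset) (auto simp: I_def)
    ultimately show ?thesis
      unfolding has_real_derivative_iff_has_vector_derivative
      by (rule vector_derivative_unique_within)
  qed
  define K where "K = \<bar>C\<bar> + 1"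
  have K: "K > 0" unfolding K_def by simp
  define \<eta> where "\<eta> = min (min (\<gamma>/2) (1/4)) ((- d / 2 / K) powr (1 / \<alpha>))"
  have \<eta>: "0 < \<eta>" "\<eta> < \<gamma>" "\<eta> < 1/2" "\<eta> < 1"
    using \<gamma> d unfolding \<eta>_def K_def by (auto simp: min_def)
  have f'_le: "f' u \<le> d / 2" if "u \<in> I \<eta>" for u
  proof -
    have "\<bar>u - p\<bar> \<le> (- d / 2 / K) powr (1 / \<alpha>)" using that unfolding I_def \<eta>_def by auto
    then have "\<bar>u - p\<bar> powr \<alpha> \<le> ((- d / 2 / K) powr (1 / \<alpha>)) powr \<alpha>"
      using \<alpha> by (intro powr_mono2) auto
    also have "\<dots> = - d / 2 / K" using \<alpha> d K by (simp add: powr_powr divide_nonpos_pos)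
    finally have le: "\<bar>u - p\<bar> powr \<alpha> \<le> - d / 2 / K" .
    have "\<bar>f' u - f' p\<bar> \<le> C * \<bar>u - p\<bar> powr \<alpha>" using C[OF _ pS] I_S[OF \<eta>(1,2)] that by blast
    also have "\<dots> \<le> K * \<bar>u - p\<bar> powr \<alpha>" unfolding K_def by (intro mult_right_mono) auto
    also have "\<dots> \<le> K * (- d / 2 / K)" using le unfolding K_def by (intro mult_left_mono) auto
    also have "\<dots> = - d / 2" using K by simp
    finally show ?thesis using \<open>f' p = d\<close> by linarith
  qed
  have "f u - f w \<le> - (- d / 2) * (u - w)"
    if u: "u \<in> {0..1}" "\<bar>u - p\<bar> \<le> \<eta>" and w: "w \<in> {0..1}" "\<bar>w - p\<bar> \<le> \<eta>" and wu: "w \<le> u" for u w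
  proof -
    have uI: "u \<in> I \<eta>" "w \<in> I \<eta>" using u w unfolding I_def by auto
    then have sub: "{w..u} \<subseteq> I \<eta>" unfolding I_eq[OF \<eta>(1,4)] by (auto split: if_splits)
    have "\<exists>x\<in>{w..u}. f u - f w = (\<lambda>h. f' x * h) (u - w)"
    proof (rule mvt_very_simple[OF wu])
      fix x assume "w \<le> x" "x \<le> u"
      then have "x \<in> S" using sub I_S[OF \<eta>(1,2)] by auto
      have "(f has_real_derivative f' x) (at x within {w..u})"
        by (rule has_field_derivative_subset[OF f'[OF \<open>x \<in> S\<close>]]) (use sub I_S[OF \<eta>(1,2)] in auto)
      then show "(f has_derivative (\<lambda>h. f' x * h)) (at x within {w..u})"
        by (simp add: has_field_derivative_def)
    qed
    then obtain x where x: "x \<in> {w..u}" "f u - f w = f' x * (u - w)" by auto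
    have "f' x \<le> d / 2" using f'_le sub x(1) by blast
    then have "f' x * (u - w) \<le> d / 2 * (u - w)" using wu by (intro mult_right_mono) auto
    then show ?thesis using x(2) by simp
  qed
  then show ?thesis using \<eta> d by (intro bexI[of _ \<eta>] exI[of _ "- d / 2"]) auto
qed

text \<open>
  Near 0 only weak monotonicity is available, since \<open>f\<close> may vanish there (combustion).
\<close>

lemma monotone_near_endpoints:
  assumes "F1 f" "F2 f" "F4 f"
  shows "\<exists>\<eta>\<in>{0<..<1/2}. \<exists>\<mu>>0.
    (\<forall>u\<in>{0..\<eta>}. \<forall>w\<in>{0..\<eta>}. w \<le> u \<longrightarrow> f u \<le> f w) \<and>
    (\<forall>u\<in>{1-\<eta>..1}. \<forall>w\<in>{1-\<eta>..1}. w \<le> u \<longrightarrow> f u - f w \<le> - \<mu> * (u - w))"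
proof -
  obtain d where d: "d < 0" "(f has_real_derivative d) (at 1 within {0..1})"
    using assms(2) unfolding F2_def by auto
  obtain \<eta>1 \<mu> where 1: "\<eta>1 \<in> {0<..<1/2}" "\<mu> > 0"
    "\<forall>u\<in>{0..1}. \<forall>w\<in>{0..1}. \<bar>u - 1\<bar> \<le> \<eta>1 \<longrightarrow> \<bar>w - 1\<bar> \<le> \<eta>1 \<longrightarrow> w \<le> u \<longrightarrow> f u - f w \<le> - \<mu> * (u - w)"
    using strictly_decreasing_near_endpoint[OF assms(1) _ d] by blast
  have "\<exists>\<eta>\<in>{0<..<1/2}. \<forall>u\<in>{0..\<eta>}. \<forall>w\<in>{0..\<eta>}. w \<le> u \<longrightarrow> f u \<le> f w"
  proof -
    obtain \<theta> where \<theta>: "\<theta> \<in> {0<..<1}" "bistable \<theta> f \<or> combustion \<theta> f"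
      using assms(3) unfolding F4_def by auto
    then consider "bistable \<theta> f" | "combustion \<theta> f" by blast
    then show ?thesis
    proof cases
      case 1
      then obtain d0 where d0: "d0 < 0" "(f has_real_derivative d0) (at 0 within {0..1})"
        unfolding bistable_def by auto
      obtain \<eta> \<mu>0 where 0: "\<eta> \<in> {0<..<1/2}" "\<mu>0 > 0"
        "\<forall>u\<in>{0..1}. \<forall>w\<in>{0..1}. \<bar>u - 0\<bar> \<le> \<eta> \<longrightarrow> \<bar>w - 0\<bar> \<le> \<eta> \<longrightarrow> w \<le> u \<longrightarrow> f u - f w \<le> - \<mu>0 * (u - w)"
        using strictly_decreasing_near_endpoint[OF assms(1) _ d0] by blast
      have "f u \<le> f w" if "u \<in> {0..\<eta>}" "w \<in> {0..\<eta>}" "w \<le> u" for u w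
      proof -
        have "f u - f w \<le> - \<mu>0 * (u - w)" using 0 that by auto
        moreover have "\<mu>0 * (u - w) \<ge> 0" using 0(2) that by simp
        ultimately show ?thesis by simp
      qed
      then show ?thesis using 0(1) by blast
    next
      case 2
      have "f u = 0" if "u \<in> {0..\<theta>/2}" for u
        using 2 that \<theta> assms(1) unfolding combustion_def F1_def by (cases "u = 0") auto
      then show ?thesis using \<theta> by (intro bexI[of _ "\<theta>/2"]) auto
    qed
  qed
  then obtain \<eta>0 where 0: "\<eta>0 \<in> {0<..<1/2}" "\<forall>u\<in>{0..\<eta>0}. \<forall>w\<in>{0..\<eta>0}. w \<le> u \<longrightarrow> f u \<le> f w" by blast
  show ?thesis
  proof (intro bexI[of _ "min \<eta>0 \<eta>1"] exI[of _ \<mu>] conjI ballI impI)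
    fix u w assume "u \<in> {1 - min \<eta>0 \<eta>1..1}" "w \<in> {1 - min \<eta>0 \<eta>1..1}" "w \<le> u"
    then show "f u - f w \<le> - \<mu> * (u - w)"
      using 1 by (intro 1(3)[rule_format]) auto
  qed (use 0 1 in auto)
qed

section \<open>The planar wave\<close>

lemma travelling_wave_DERIV:
  assumes "travelling_wave f \<kappa> g"
  shows "(g has_real_derivative deriv g s) (at s)"
    and "(deriv g has_real_derivative \<kappa> * deriv g s - f (g s)) (at s)"
    and "g s \<in> {0..1}"
proof -
  show "(g has_real_derivative deriv g s) (at s)"
    using assms unfolding travelling_wave_def by (simp add: DERIV_deriv_iff_real_differentiable)
  have "(deriv g has_real_derivative deriv (deriv g) s) (at s)"
    using assms unfolding travelling_wave_def by (simp add: DERIV_deriv_iff_real_differentiable)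
  moreover have "deriv (deriv g) s = \<kappa> * deriv g s - f (g s)"
  proof -
    have "- deriv (deriv g) s + \<kappa> * deriv g s = f (g s)" using assms unfolding travelling_wave_def by blast
    then show ?thesis by linarith
  qed
  ultimately show "(deriv g has_real_derivative \<kappa> * deriv g s - f (g s)) (at s)" by simp
  show "g s \<in> {0..1}" using assms unfolding travelling_wave_def by blast
qed

text \<open>
  Uniqueness for the Cauchy problem at a rest point: \<open>(g - c)\<^sup>2 + g'\<^sup>2\<close> satisfies a Gronwall
  inequality in both time directions.
\<close>

lemma wave_constant_if_equilibrium:
  assumes F1: "F1 f" and wave: "travelling_wave f \<kappa> g" and "0 \<le> \<kappa>"
    and c: "c = 0 \<or> c = 1" and eq: "g s0 = c" "deriv g s0 = 0"
  shows "g s = c"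
proof -
  note W = travelling_wave_DERIV[OF wave]
  obtain L where L: "L \<ge> 0" "\<forall>u\<in>{0..1}. \<forall>w\<in>{0..1}. \<bar>f u - f w\<bar> \<le> L * \<bar>u - w\<bar>"
    using F1_lipschitz_bound[OF F1] by blast
  have fc: "f c = 0" using F1 c unfolding F1_def by auto
  define y where "y s = (g s - c)\<^sup>2 + (deriv g s)\<^sup>2" for s
  define y' where "y' s = 2 * (g s - c) * deriv g s + 2 * deriv g s * (\<kappa> * deriv g s - f (g s))" for s
  define K where "K = 1 + L + 2 * \<kappa>"
  have y: "(y has_real_derivative y' s) (at s)" for s
    unfolding y_def y'_def by (auto intro!: derivative_eq_intros W)
  have y'_le: "\<bar>y' s\<bar> \<le> K * y s" for s
  proof -
    have "c \<in> {0..1}" using c by auto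
    then have "\<bar>f (g s) - f c\<bar> \<le> L * \<bar>g s - c\<bar>" using L(2) W(3) by blast
    then have fg: "\<bar>f (g s)\<bar> \<le> L * \<bar>g s - c\<bar>" using fc by simp
    have ab: "2 * (\<bar>g s - c\<bar> * \<bar>deriv g s\<bar>) \<le> y s"
      using sum_squares_bound[of "\<bar>g s - c\<bar>" "\<bar>deriv g s\<bar>"] unfolding y_def by simp
    have "\<bar>2 * (g s - c) * deriv g s\<bar> \<le> y s" using ab by (simp only: abs_mult abs_numeral mult.assoc)
    moreover have "\<bar>2 * deriv g s * f (g s)\<bar> \<le> L * y s"
    proof -
      have "\<bar>2 * deriv g s * f (g s)\<bar> = 2 * \<bar>deriv g s\<bar> * \<bar>f (g s)\<bar>" by (simp add: abs_mult)
      also have "\<dots> \<le> 2 * \<bar>deriv g s\<bar> * (L * \<bar>g s - c\<bar>)" using fg by (intro mult_left_mono) auto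
      also have "\<dots> = L * (2 * (\<bar>g s - c\<bar> * \<bar>deriv g s\<bar>))" by simp
      also have "\<dots> \<le> L * y s" using ab L(1) by (intro mult_left_mono)
      finally show ?thesis .
    qed
    moreover have "\<bar>2 * \<kappa> * (deriv g s)\<^sup>2\<bar> \<le> 2 * \<kappa> * y s"
    proof -
      have "(deriv g s)\<^sup>2 \<le> y s" unfolding y_def by simp
      then have "2 * \<kappa> * (deriv g s)\<^sup>2 \<le> 2 * \<kappa> * y s" using \<open>0 \<le> \<kappa>\<close> by (intro mult_left_mono) auto
      then show ?thesis using \<open>0 \<le> \<kappa>\<close> by simp
    qed
    moreover have "y' s = 2 * (g s - c) * deriv g s + 2 * \<kappa> * (deriv g s)\<^sup>2 - 2 * deriv g s * f (g s)"
      unfolding y'_def by (simp add: algebra_simps power2_eq_square)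
    ultimately show ?thesis unfolding K_def by (simp add: algebra_simps)
  qed
  have y0: "y s0 = 0" unfolding y_def using eq by simp
  have "y s \<le> 0"
  proof (cases "s0 \<le> s")
    case True
    have "y s * exp (- K * s) \<le> y s0 * exp (- K * s0)"
    proof (rule DERIV_nonpos_imp_nonincreasing[OF True])
      fix x
      have "((\<lambda>s. y s * exp (- K * s)) has_real_derivative (y' x - K * y x) * exp (- K * x)) (at x)"
        by (auto intro!: derivative_eq_intros y simp: algebra_simps)
      moreover have "(y' x - K * y x) * exp (- K * x) \<le> 0"
        using y'_le[of x] by (intro mult_nonpos_nonneg) auto
      ultimately show "\<exists>d. ((\<lambda>s. y s * exp (- K * s)) has_real_derivative d) (at x) \<and> d \<le> 0" by blast
    qed
    then show ?thesis using y0 by (simp add: mult_le_0_iff)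
  next
    case False
    then have "s \<le> s0" by simp
    have "y s * exp (K * s) \<le> y s0 * exp (K * s0)"
    proof (rule DERIV_nonneg_imp_nondecreasing[OF \<open>s \<le> s0\<close>])
      fix x
      have "((\<lambda>s. y s * exp (K * s)) has_real_derivative (y' x + K * y x) * exp (K * x)) (at x)"
        by (auto intro!: derivative_eq_intros y simp: algebra_simps)
      moreover have "(y' x + K * y x) * exp (K * x) \<ge> 0"
        using y'_le[of x] by (intro mult_nonneg_nonneg) auto
      ultimately show "\<exists>d. ((\<lambda>s. y s * exp (K * s)) has_real_derivative d) (at x) \<and> d \<ge> 0" by blast
    qed
    then show ?thesis using y0 by (simp add: mult_le_0_iff)
  qed
  then have "(g s - c)\<^sup>2 \<le> 0" unfolding y_def using zero_le_power2[of "deriv g s"] by linarith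
  then show ?thesis by simp
qed

lemma primitive_properties:
  assumes F1: "F1 f"
  defines "F \<equiv> \<lambda>u. integral {0..u} f"
  shows "\<And>u. u \<in> {0..1} \<Longrightarrow> (F has_real_derivative f u) (at u within {0..1})"
    and "F 0 = 0"
    and "\<exists>B\<ge>0. \<forall>u\<in>{0..1}. \<forall>w\<in>{0..1}. \<bar>F u - F w\<bar> \<le> B * \<bar>u - w\<bar>"
proof -
  obtain L where L: "L-lipschitz_on {0..1} f" using F1 unfolding F1_def by blast
  then have cont: "continuous_on {0..1} f" by (rule lipschitz_on_continuous_on)
  show der: "(F has_real_derivative f u) (at u within {0..1})" if "u \<in> {0..1}" for u
    unfolding F_def using integral_has_real_derivative[OF cont that] .
  show "F 0 = 0" unfolding F_def by simp
  have "\<bar>f u\<bar> \<le> L" if "u \<in> {0..1}" for u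
  proof -
    have "\<bar>f u - f 0\<bar> \<le> L * \<bar>u - 0\<bar>" using lipschitz_onD[OF L that, of 0] by (simp add: dist_real_def)
    also have "\<dots> \<le> L * 1" using that lipschitz_on_nonneg[OF L] by (intro mult_left_mono) auto
    finally show ?thesis using F1 unfolding F1_def by simp
  qed
  then have "norm (F u - F w) \<le> L * norm (u - w)" if "u \<in> {0..1}" "w \<in> {0..1}" for u w
    using that by (intro field_differentiable_bound[OF _ der]) auto
  then show "\<exists>B\<ge>0. \<forall>u\<in>{0..1}. \<forall>w\<in>{0..1}. \<bar>F u - F w\<bar> \<le> B * \<bar>u - w\<bar>"
    using lipschitz_on_nonneg[OF L] by auto
qed

text \<open>
  Multiplying the equation by \<open>g'\<close> shows that the drift makes the mechanical energy nondecreasing.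
\<close>

lemma wave_energy:
  assumes F1: "F1 f" and wave: "travelling_wave f \<kappa> g" and "0 \<le> \<kappa>"
  defines "E \<equiv> \<lambda>s. (deriv g s)\<^sup>2 / 2 + integral {0..g s} f"
  shows "\<And>s. (E has_real_derivative \<kappa> * (deriv g s)\<^sup>2) (at s)"
    and "\<And>s t. s \<le> t \<Longrightarrow> E s \<le> E t"
proof -
  note W = travelling_wave_DERIV[OF wave]
  show der: "(E has_real_derivative \<kappa> * (deriv g s)\<^sup>2) (at s)" for s
  proof -
    have "((\<lambda>u. integral {0..u} f) has_real_derivative f (g s)) (at (g s) within g ` UNIV)"
      using primitive_properties(1)[OF F1 W(3)] by (rule has_field_derivative_subset) (use W(3) in auto)
    from DERIV_image_chain[OF this W(1)]
    have "((\<lambda>s. integral {0..g s} f) has_real_derivative f (g s) * deriv g s) (at s)"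
      by (simp add: o_def)
    moreover have "((\<lambda>s. (deriv g s)\<^sup>2 / 2) has_real_derivative deriv g s * (\<kappa> * deriv g s - f (g s))) (at s)"
      by (auto intro!: derivative_eq_intros W)
    ultimately have "(E has_real_derivative deriv g s * (\<kappa> * deriv g s - f (g s)) + f (g s) * deriv g s) (at s)"
      unfolding E_def by (intro DERIV_add)
    then show ?thesis by (simp add: algebra_simps power2_eq_square)
  qed
  show "E s \<le> E t" if "s \<le> t" for s t
    using that
  proof (rule DERIV_nonneg_imp_nondecreasing)
    fix x
    have "\<kappa> * (deriv g x)\<^sup>2 \<ge> 0" using \<open>0 \<le> \<kappa>\<close> by simp
    then show "\<exists>d. (E has_real_derivative d) (at x) \<and> d \<ge> 0" using der by blast
  qed
qed

text \<open>
  If \<open>g\<close> is nearly constant on \<open>[t, t + 1]\<close>, its slope is small somewhere in that interval, so the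
  energy there is almost the potential; by monotonicity this bounds the energy at \<open>t\<close>.
\<close>

lemma wave_deriv_square_le:
  assumes F1: "F1 f" and wave: "travelling_wave f \<kappa> g" and "0 \<le> \<kappa>"
  shows "\<exists>B\<ge>0. \<forall>t L \<epsilon>. (\<forall>s\<in>{t..t+1}. \<bar>g s - L\<bar> \<le> \<epsilon>) \<longrightarrow> (deriv g t)\<^sup>2 \<le> 4 * \<epsilon>\<^sup>2 + B * \<epsilon>"
proof -
  note W = travelling_wave_DERIV[OF wave]
  obtain B where B: "B \<ge> 0" "\<forall>u\<in>{0..1}. \<forall>w\<in>{0..1}.
      \<bar>integral {0..u} f - integral {0..w} f\<bar> \<le> B * \<bar>u - w\<bar>"
    using primitive_properties(3)[OF F1] by blast
  have "(deriv g t)\<^sup>2 \<le> 4 * \<epsilon>\<^sup>2 + (4 * B) * \<epsilon>" if "\<forall>s\<in>{t..t+1}. \<bar>g s - L\<bar> \<le> \<epsilon>" for t L \<epsilon>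
  proof -
    have "\<exists>z. t < z \<and> z < t + 1 \<and> g (t + 1) - g t = (t + 1 - t) * deriv g z"
      by (rule MVT2) (use W(1) in auto)
    then obtain z where z: "t < z" "z < t + 1" "g (t + 1) - g t = deriv g z" by auto
    have \<epsilon>: "\<bar>g t - L\<bar> \<le> \<epsilon>" "\<bar>g z - L\<bar> \<le> \<epsilon>" "\<bar>g (t + 1) - L\<bar> \<le> \<epsilon>" using that z by auto
    have "\<bar>deriv g z\<bar> \<le> 2 * \<epsilon>" using \<epsilon> z(3) by linarith
    then have "\<bar>deriv g z\<bar>\<^sup>2 \<le> (2 * \<epsilon>)\<^sup>2" by (intro power_mono) auto
    then have 1: "(deriv g z)\<^sup>2 \<le> 4 * \<epsilon>\<^sup>2" by (simp add: power_mult_distrib)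
    have "\<bar>integral {0..g z} f - integral {0..g t} f\<bar> \<le> B * \<bar>g z - g t\<bar>" using B(2) W(3) by blast
    also have "\<dots> \<le> B * (2 * \<epsilon>)" using \<epsilon> B(1) by (intro mult_left_mono) auto
    finally have 2: "integral {0..g z} f - integral {0..g t} f \<le> 2 * B * \<epsilon>" by linarith
    have "(deriv g t)\<^sup>2 / 2 + integral {0..g t} f \<le> (deriv g z)\<^sup>2 / 2 + integral {0..g z} f"
      using wave_energy(2)[OF F1 wave \<open>0 \<le> \<kappa>\<close>] z(1) by simp
    then show ?thesis using 1 2 by linarith
  qed
  then show ?thesis using B(1) by (intro exI[of _ "4 * B"]) auto
qed

lemma tendsto_zero_from_quadratic_bound:
  fixes y :: "'b \<Rightarrow> real"
  assumes "\<And>\<epsilon>. \<epsilon> > 0 \<Longrightarrow> \<forall>\<^sub>F t in A. (y t)\<^sup>2 \<le> 4 * \<epsilon>\<^sup>2 + B * \<epsilon>" "B \<ge> 0"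
  shows "(y \<longlongrightarrow> 0) A"
proof (rule tendstoI)
  fix r :: real assume r: "r > 0"
  have "0 < r / 4" "0 < r\<^sup>2 / (4 * (B + 1))" using r assms(2) by auto
  then obtain \<epsilon> where "0 < \<epsilon>" "\<epsilon> < r / 4" "\<epsilon> < r\<^sup>2 / (4 * (B + 1))"
    using field_lbound_gt_zero by blast
  then have \<epsilon>: "\<epsilon> > 0" "\<epsilon> \<le> r / 4" "\<epsilon> \<le> r\<^sup>2 / (4 * (B + 1))" by simp_all
  have "4 * \<epsilon>\<^sup>2 \<le> 4 * (r / 4)\<^sup>2" using \<epsilon> by (intro mult_left_mono power_mono) auto
  moreover have "B * \<epsilon> \<le> r\<^sup>2 / 4"
  proof -
    have "B * \<epsilon> \<le> (B + 1) * \<epsilon>" using \<epsilon> by (intro mult_right_mono) auto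
    also have "\<dots> \<le> (B + 1) * (r\<^sup>2 / (4 * (B + 1)))" using \<epsilon> assms(2) by (intro mult_left_mono) auto
    also have "\<dots> = r\<^sup>2 / 4" using assms(2) by (simp add: field_simps)
    finally show ?thesis .
  qed
  ultimately have "4 * \<epsilon>\<^sup>2 + B * \<epsilon> \<le> r\<^sup>2 / 2" by (simp add: power_divide)
  also have "\<dots> < r\<^sup>2" using r by simp
  finally have less: "4 * \<epsilon>\<^sup>2 + B * \<epsilon> < r\<^sup>2" .
  show "\<forall>\<^sub>F t in A. dist (y t) 0 < r"
    using assms(1)[OF \<epsilon>(1)]
  proof eventually_elim
    case (elim t)
    then have "(y t)\<^sup>2 < r\<^sup>2" using less by linarith
    then have "\<bar>y t\<bar>\<^sup>2 < r\<^sup>2" by simp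
    then have "\<bar>y t\<bar> < r" by (rule power2_less_imp_less) (use r in simp)
    then show ?case by (simp add: dist_real_def)
  qed
qed

lemma wave_deriv_tendsto_0:
  assumes F1: "F1 f" and wave: "travelling_wave f \<kappa> g" and "0 \<le> \<kappa>"
  shows "(deriv g \<longlongrightarrow> 0) at_top" "(deriv g \<longlongrightarrow> 0) at_bot"
proof -
  obtain B where B: "B \<ge> 0"
    "\<And>t L \<epsilon>. (\<forall>s\<in>{t..t+1}. \<bar>g s - L\<bar> \<le> \<epsilon>) \<Longrightarrow> (deriv g t)\<^sup>2 \<le> 4 * \<epsilon>\<^sup>2 + B * \<epsilon>"
    using wave_deriv_square_le[OF assms] by blast
  show "(deriv g \<longlongrightarrow> 0) at_top"
  proof (rule tendsto_zero_from_quadratic_bound[OF _ B(1)])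
    fix \<epsilon> :: real assume "\<epsilon> > 0"
    then have "\<forall>\<^sub>F s in at_top. dist (g s) 1 < \<epsilon>"
      using wave unfolding travelling_wave_def by (auto dest: tendstoD)
    then obtain T where T: "\<And>s. s \<ge> T \<Longrightarrow> dist (g s) 1 < \<epsilon>" unfolding eventually_at_top_linorder by blast
    have "(deriv g t)\<^sup>2 \<le> 4 * \<epsilon>\<^sup>2 + B * \<epsilon>" if "t \<ge> T" for t
    proof (rule B(2)[of t 1], rule ballI)
      fix s assume "s \<in> {t..t+1}"
      then have "dist (g s) 1 < \<epsilon>" using that by (intro T) auto
      then show "\<bar>g s - 1\<bar> \<le> \<epsilon>" unfolding dist_real_def by (rule less_imp_le)
    qed
    then show "\<forall>\<^sub>F t in at_top. (deriv g t)\<^sup>2 \<le> 4 * \<epsilon>\<^sup>2 + B * \<epsilon>"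
      unfolding eventually_at_top_linorder by blast
  qed
  show "(deriv g \<longlongrightarrow> 0) at_bot"
  proof (rule tendsto_zero_from_quadratic_bound[OF _ B(1)])
    fix \<epsilon> :: real assume "\<epsilon> > 0"
    then have "\<forall>\<^sub>F s in at_bot. dist (g s) 0 < \<epsilon>"
      using wave unfolding travelling_wave_def by (auto dest: tendstoD)
    then obtain T where T: "\<And>s. s \<le> T \<Longrightarrow> dist (g s) 0 < \<epsilon>" unfolding eventually_at_bot_linorder by blast
    have "(deriv g t)\<^sup>2 \<le> 4 * \<epsilon>\<^sup>2 + B * \<epsilon>" if "t \<le> T - 1" for t
    proof (rule B(2)[of t 0], rule ballI)
      fix s assume "s \<in> {t..t+1}"
      then have "dist (g s) 0 < \<epsilon>" using that by (intro T) auto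
      then show "\<bar>g s - 0\<bar> \<le> \<epsilon>" unfolding dist_real_def by (rule less_imp_le)
    qed
    then show "\<forall>\<^sub>F t in at_bot. (deriv g t)\<^sup>2 \<le> 4 * \<epsilon>\<^sup>2 + B * \<epsilon>"
      unfolding eventually_at_bot_linorder by blast
  qed
qed

text \<open>
  At the first zero after \<open>s0\<close> the function would have to cross 0 upwards.
\<close>

lemma negative_after_zero:
  fixes y :: "real \<Rightarrow> real"
  assumes der: "\<And>s. (y has_real_derivative y' s) (at s)"
    and zero: "\<And>s. y s = 0 \<Longrightarrow> y' s < 0" and "y s0 = 0" "s0 < s"
  shows "y s < 0"
proof (rule ccontr)
  assume ge: "\<not> y s < 0"
  obtain d where d: "d > 0" "\<And>h. h > 0 \<Longrightarrow> h < d \<Longrightarrow> y (s0 + h) < y s0"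
    using DERIV_neg_dec_right[OF der zero[OF \<open>y s0 = 0\<close>]] by blast
  obtain h where "0 < h" "h < d" "h < s - s0"
    using field_lbound_gt_zero[of d "s - s0"] d(1) \<open>s0 < s\<close> by auto
  moreover define r where "r = s0 + h"
  ultimately have "s0 < r" "r < s" "0 < r - s0" "r - s0 < d" unfolding r_def by simp_all
  then have r: "s0 < r" "r < s" "y r < 0"
    using d(2)[of "r - s0"] \<open>y s0 = 0\<close> by simp_all
  define Z where "Z = {x \<in> {r..s}. y x = 0}"
  have cont: "continuous_on A y" for A
    using der by (auto intro!: continuous_at_imp_continuous_on DERIV_isCont)
  have "Z \<noteq> {}"
  proof -
    obtain x where "r \<le> x" "x \<le> s" "y x = 0"
      using IVT'[of y r 0 s, OF _ _ _ cont] r ge by (auto simp: less_imp_le)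
    then show ?thesis unfolding Z_def by auto
  qed
  moreover have "compact Z"
  proof -
    have "Z = {r..s} \<inter> y -` {0}" unfolding Z_def by auto
    moreover have "closed (y -` {0})" by (intro continuous_closed_vimage closed_singleton DERIV_isCont[OF der])
    ultimately show ?thesis by (simp add: compact_Int_closed)
  qed
  ultimately obtain z where z: "z \<in> Z" "\<And>x. x \<in> Z \<Longrightarrow> z \<le> x" using compact_attains_inf by metis
  have yz: "y z = 0" and "r \<le> z" "z \<le> s" using z(1) unfolding Z_def by auto
  then have rz: "r < z" using r(3) by (cases "r = z") auto
  obtain d2 where d2: "d2 > 0" "\<And>h. h > 0 \<Longrightarrow> h < d2 \<Longrightarrow> y z < y (z - h)"
    using DERIV_neg_dec_left[OF der zero[OF yz]] by blast
  obtain k where "0 < k" "k < d2" "k < z - r"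
    using field_lbound_gt_zero[of d2 "z - r"] d2(1) rz by auto
  moreover define w where "w = z - k"
  ultimately have "r < w" "w < z" "0 < z - w" "z - w < d2" unfolding w_def by simp_all
  then have w: "r < w" "w < z" "y w > 0" using d2(2)[of "z - w"] yz by simp_all
  obtain x where "r \<le> x" "x \<le> w" "y x = 0"
    using IVT'[of y r 0 w, OF _ _ _ cont] r(3) w by (auto simp: less_imp_le)
  then have "x \<in> Z" "x < z" using w \<open>z \<le> s\<close> unfolding Z_def by auto
  then show False using z(2) by force
qed

text \<open>
  The energy tends to 0 at \<open>-\<infinity>\<close> and does not decrease; it is positive everywhere, as otherwise
  \<open>g\<close> would be at rest on a half line and hence identically 0. At a critical point the energy is the
  potential \<open>F(g)\<close>, which is nonpositive on \<open>[0, \<theta>]\<close>. So \<open>g > \<theta>\<close> there, and \<open>g < 1\<close> because \<open>g\<close> is not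
  at rest at 1; hence \<open>g'' = -f(g) < 0\<close>, and after the critical point \<open>g\<close> would decrease for ever and could not converge to 1.
\<close>

lemma wave_deriv_pos:
  assumes F1: "F1 f" and F4: "F4 f" and wave: "travelling_wave f \<kappa> g" and \<kappa>: "0 < \<kappa>"
  shows "deriv g s > 0"
proof -
  note W = travelling_wave_DERIV[OF wave]
  have lims: "(g \<longlongrightarrow> 0) at_bot" "(g \<longlongrightarrow> 1) at_top" using wave unfolding travelling_wave_def by auto
  define F where "F u = integral {0..u} f" for u
  define E where "E s = (deriv g s)\<^sup>2 / 2 + F (g s)" for s
  have E_der: "(E has_real_derivative \<kappa> * (deriv g s)\<^sup>2) (at s)" for s
    using wave_energy(1)[OF F1 wave] \<kappa> unfolding E_def F_def by simp
  have E_mono: "E s \<le> E t" if "s \<le> t" for s t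
    using wave_energy(2)[OF F1 wave _ that] \<kappa> unfolding E_def F_def by simp
  have F_der: "(F has_real_derivative f u) (at u within {0..1})" if "u \<in> {0..1}" for u
    using primitive_properties(1)[OF F1 that] unfolding F_def .
  have F0: "F 0 = 0" unfolding F_def by simp
  obtain \<theta> where \<theta>: "0 < \<theta>" "\<theta> < 1" "\<And>u. \<theta> < u \<Longrightarrow> u < 1 \<Longrightarrow> f u > 0"
    "\<And>u. 0 < u \<Longrightarrow> u < \<theta> \<Longrightarrow> f u \<le> 0"
  proof -
    obtain \<theta> where "\<theta>\<in>{0<..<1}" "\<forall>u\<in>{\<theta><..<1}. f u > 0" "bistable \<theta> f \<or> combustion \<theta> f"
      using F4 unfolding F4_def by blast
    then show ?thesis
      using that[of \<theta>] unfolding bistable_def combustion_def by (auto simp: less_imp_le)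
  qed
  have F_nonpos: "F u \<le> 0" if "0 \<le> u" "u \<le> \<theta>" for u
  proof (cases "u = 0")
    case False
    then have "0 < u" using that by simp
    then have "\<exists>x\<in>{0<..<u}. F u - F 0 = (\<lambda>h. f x * h) (u - 0)"
    proof (rule mvt_simple)
      fix x assume "0 \<le> x" "x \<le> u"
      then have "(F has_real_derivative f x) (at x within {0..u})"
        using that \<theta> by (intro has_field_derivative_subset[OF F_der]) auto
      then show "(F has_derivative (\<lambda>h. f x * h)) (at x within {0..u})" by (simp add: has_field_derivative_def)
    qed
    then obtain x where "0 < x" "x < u" "F u = f x * u" using F0 by auto
    then show ?thesis using \<theta>(4)[of x] that by (auto intro!: mult_nonpos_nonneg)
  qed (simp add: F0)
  have E_bot: "(E \<longlongrightarrow> 0) at_bot"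
  proof -
    have "((\<lambda>s. F (g s)) \<longlongrightarrow> 0) at_bot"
    proof -
      obtain B where B: "\<And>u w. u \<in> {0..1} \<Longrightarrow> w \<in> {0..1} \<Longrightarrow> \<bar>F u - F w\<bar> \<le> B * \<bar>u - w\<bar>"
        using primitive_properties(3)[OF F1] unfolding F_def by blast
      have "\<bar>F (g s)\<bar> \<le> B * \<bar>g s\<bar>" for s using B[OF W(3), of 0 s] F0 by simp
      moreover have "((\<lambda>s. B * \<bar>g s\<bar>) \<longlongrightarrow> B * \<bar>0\<bar>) at_bot" by (intro tendsto_intros lims)
      ultimately show ?thesis
        by (intro Lim_null_comparison[of "\<lambda>s. F (g s)" "\<lambda>s. B * \<bar>g s\<bar>"]) simp_all
    qed
    moreover have "((\<lambda>s. (deriv g s)\<^sup>2 / 2) \<longlongrightarrow> 0\<^sup>2 / 2) at_bot"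
      using \<kappa> by (intro tendsto_intros wave_deriv_tendsto_0(2)[OF F1 wave]) auto
    ultimately show ?thesis unfolding E_def using tendsto_add by fastforce
  qed
  have E_ge: "E s \<ge> 0" for s
  proof (rule tendsto_upperbound[OF E_bot])
    show "\<forall>\<^sub>F t in at_bot. E t \<le> E s"
      using eventually_le_at_bot[of s] by eventually_elim (rule E_mono)
  qed simp
  have E_pos: "E s > 0" for s
  proof (rule ccontr)
    assume "\<not> E s > 0"
    then have E0: "E t = 0" if "t \<le> s" for t using E_mono[OF that] E_ge[of t] by linarith
    have g'0: "deriv g t = 0" if "t < s" for t
    proof -
      have "\<forall>\<^sub>F r in nhds t. r < s" using that eventually_nhds_in_open[of "{..<s}" t] by auto
      then have "\<forall>\<^sub>F r in nhds t. E r = 0" by eventually_elim (simp add: E0)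
      then have "(E has_real_derivative 0) (at t)"
        by (subst DERIV_cong_ev[OF refl _ refl, of E "\<lambda>_. 0"]) auto
      then have "\<kappa> * (deriv g t)\<^sup>2 = 0" using E_der DERIV_unique by blast
      then show ?thesis using \<kappa> by simp
    qed
    have const: "g t = g (s - 1)" if "t \<le> s - 1" for t
    proof (cases "t = s - 1")
      case False
      then have lt: "t < s - 1" using that by simp
      then have "\<exists>z. t < z \<and> z < s - 1 \<and> g (s - 1) - g t = (s - 1 - t) * deriv g z"
        by (rule MVT2) (use W(1) in auto)
      then show ?thesis using g'0 by auto
    qed simp
    have "((\<lambda>_::real. g (s - 1)) \<longlongrightarrow> 0) at_bot"
    proof (rule Lim_transform_eventually)
      show "(g \<longlongrightarrow> 0) at_bot" by (fact lims(1))
      show "\<forall>\<^sub>F t in at_bot. g t = g (s - 1)"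
        using eventually_le_at_bot[of "s - 1"] by eventually_elim (rule const)
    qed
    then have "g (s - 1) = 0" by (simp add: tendsto_const_iff)
    then have "g t = 0" for t
      using wave_constant_if_equilibrium[OF F1 wave _ _ _ g'0[of "s - 1"], of 0] \<kappa> by simp
    then have "g = (\<lambda>_. 0)" by (rule ext)
    then show False using lims(2) by (simp add: tendsto_const_iff)
  qed
  have crit: "\<theta> < g s \<and> g s < 1" if "deriv g s = 0" for s
  proof -
    have "F (g s) > 0" using E_pos[of s] that unfolding E_def by simp
    then have 1: "\<theta> < g s" using F_nonpos[of "g s"] W(3)[of s] by force
    have "g s \<noteq> 1"
    proof
      assume "g s = 1"
      then have "g t = 1" for t using wave_constant_if_equilibrium[OF F1 wave _ _ _ that, of 1] \<kappa> by simp
      then have "g = (\<lambda>_. 1)" by (rule ext)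
      then show False using lims(1) by (simp add: tendsto_const_iff)
    qed
    then show ?thesis using 1 W(3)[of s] by auto
  qed
  have crit_neg: "\<kappa> * deriv g s - f (g s) < 0" if "deriv g s = 0" for s
    using crit[OF that] \<theta>(3) that by simp
  have nonzero: "deriv g s \<noteq> 0" for s
  proof
    assume s: "deriv g s = 0"
    have neg: "deriv g t < 0" if "s < t" for t
      by (rule negative_after_zero[OF W(2) crit_neg s that])
    have "g t \<le> g s" if "s \<le> t" for t
      using that
    proof (rule DERIV_nonpos_imp_nonincreasing)
      fix x assume "s \<le> x"
      then have "deriv g x \<le> 0" using neg[of x] s by (cases "x = s") auto
      then show "\<exists>d. (g has_real_derivative d) (at x) \<and> d \<le> 0" using W(1) by blast
    qed
    note le = this
    have "1 \<le> g s"
    proof (rule tendsto_upperbound[OF lims(2)])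
      show "\<forall>\<^sub>F t in at_top. g t \<le> g s"
        using eventually_ge_at_top[of s] by eventually_elim (rule le)
    qed simp
    then show False using crit[OF s] by simp
  qed
  show ?thesis
  proof (rule ccontr)
    assume "\<not> deriv g s > 0"
    then have s: "deriv g s < 0" using nonzero[of s] by simp
    have cont: "continuous_on A (deriv g)" for A
      using W(2) by (auto intro!: continuous_at_imp_continuous_on DERIV_isCont)
    have neg: "deriv g t < 0" if st: "s \<le> t" for t
    proof (rule ccontr)
      assume "\<not> deriv g t < 0"
      then obtain x where "deriv g x = 0"
        using IVT'[of "deriv g" s 0 t, OF _ _ st cont] s by (auto simp: less_imp_le)
      then show False using nonzero by blast
    qed
    have "g t \<le> g (s + 1)" if "s + 1 \<le> t" for t
      using that
    proof (rule DERIV_nonpos_imp_nonincreasing)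
      fix x assume "s + 1 \<le> x"
      then have "deriv g x \<le> 0" using neg[of x] by simp
      then show "\<exists>d. (g has_real_derivative d) (at x) \<and> d \<le> 0" using W(1) by blast
    qed
    note le = this
    have "1 \<le> g (s + 1)"
    proof (rule tendsto_upperbound[OF lims(2)])
      show "\<forall>\<^sub>F t in at_top. g t \<le> g (s + 1)"
        using eventually_ge_at_top[of "s + 1"] by eventually_elim (rule le)
    qed simp
    moreover have "g (s + 1) < g s"
    proof (rule DERIV_neg_imp_decreasing[where f = g and a = s and b = "s + 1"])
      fix x assume "s \<le> x"
      then show "\<exists>d. (g has_real_derivative d) (at x) \<and> d < 0" using W(1) neg by blast
    qed simp
    ultimately show False using W(3)[of s] by simp
  qed
qed

lemma wave_strict_mono:
  assumes "F1 f" "F4 f" "travelling_wave f \<kappa> g" "0 < \<kappa>" "s < t"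
  shows "g s < g t"
  using \<open>s < t\<close>
proof (rule DERIV_pos_imp_increasing)
  fix x
  show "\<exists>d. (g has_real_derivative d) (at x) \<and> d > 0"
    using travelling_wave_DERIV(1)[OF assms(3)] wave_deriv_pos[OF assms(1-4)] by blast
qed

lemma wave_range:
  assumes "F1 f" "F4 f" "travelling_wave f \<kappa> g" "0 < \<kappa>"
  shows "0 < g s" "g s < 1"
  using wave_strict_mono[OF assms, of "s - 1" s] wave_strict_mono[OF assms, of s "s + 1"]
    travelling_wave_DERIV(3)[OF assms(3), of "s - 1"] travelling_wave_DERIV(3)[OF assms(3), of "s + 1"]
  by auto

lemma wave_surj:
  assumes "F1 f" "F4 f" "travelling_wave f \<kappa> g" "0 < \<kappa>" "0 < y" "y < 1"
  obtains s where "g s = y"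
proof -
  have lims: "(g \<longlongrightarrow> 0) at_bot" "(g \<longlongrightarrow> 1) at_top" using assms(3) unfolding travelling_wave_def by auto
  obtain a where a: "g a < y"
    using order_tendstoD(2)[OF lims(1) \<open>0 < y\<close>] unfolding eventually_at_bot_linorder by blast
  obtain b where b: "g b > y"
    using order_tendstoD(1)[OF lims(2) \<open>y < 1\<close>] unfolding eventually_at_top_linorder by blast
  have "a < b"
  proof (rule ccontr)
    assume "\<not> a < b"
    then have "g b \<le> g a" using wave_strict_mono[OF assms(1-4), of b a] by (cases "a = b") auto
    then show False using a b by linarith
  qed
  moreover have "continuous_on {a..b} g"
    using travelling_wave_DERIV(1)[OF assms(3)] by (auto intro!: continuous_at_imp_continuous_on DERIV_isCont)
  ultimately show ?thesis using IVT'[of g a y b] a b that by (auto simp: less_imp_le)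
qed

text \<open>
  In the phase plane both waves are graphs \<open>g' = p(g)\<close> over \<open>(0,1)\<close>. Reparametrising one wave by the
  values of the other with \<open>\<phi> = g\<^sup>-\<^sup>1 \<circ> V\<close>, the difference \<open>D\<close> of the kinetic energies at equal height
  satisfies \<open>D' = \<kappa> V' (V' - g' \<circ> \<phi>)\<close>, which has the sign of \<open>D\<close>. So \<open>D\<^sup>2\<close> is nondecreasing, and it
  tends to 0 at \<open>+\<infinity>\<close>; hence \<open>D = 0\<close> and \<open>\<phi>\<close> is a translation.
\<close>

lemma travelling_wave_unique:
  assumes F1: "F1 f" and F4: "F4 f" and \<kappa>: "0 < \<kappa>"
    and g: "travelling_wave f \<kappa> g" and V: "travelling_wave f \<kappa> V"
  shows "\<exists>t. \<forall>s. V s = g (s + t)"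
proof -
  note Wg = travelling_wave_DERIV[OF g] and WV = travelling_wave_DERIV[OF V]
  note posg = wave_deriv_pos[OF F1 F4 g \<kappa>] and posV = wave_deriv_pos[OF F1 F4 V \<kappa>]
  note mono = wave_strict_mono[OF F1 F4 g \<kappa>]
  have inj: "inj g"
    using mono by (intro injI) (metis linorder_less_linear less_irrefl)
  have g_inv: "g (inv g y) = y" if "0 < y" "y < 1" for y
    by (rule wave_surj[OF F1 F4 g \<kappa> that]) (metis f_inv_into_f rangeI)
  define \<phi> where "\<phi> s = inv g (V s)" for s
  have g\<phi>: "g (\<phi> s) = V s" for s
    unfolding \<phi>_def using wave_range[OF F1 F4 V \<kappa>] by (intro g_inv) auto
  have inv_der: "(inv g has_real_derivative inverse (deriv g (inv g y))) (at y)" if y: "0 < y" "y < 1" for y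
  proof (rule DERIV_inverse_function[OF Wg(1) _ y])
    show "deriv g (inv g y) \<noteq> 0" using posg[of "inv g y"] by simp
    show "g (inv g z) = z" if "0 < z" "z < 1" for z using g_inv that .
    have "isCont (inv g) (g (inv g y))"
    proof (rule isCont_inverse_function[where d = 1 and f = g and x = "inv g y"])
      show "inv g (g z) = z" for z using inj by simp
      show "isCont g z" for z using Wg(1) by (rule DERIV_isCont)
    qed simp
    then show "isCont (inv g) y" using g_inv[OF y] by simp
  qed
  have \<phi>_der: "(\<phi> has_real_derivative inverse (deriv g (\<phi> s)) * deriv V s) (at s)" for s
    unfolding \<phi>_def using wave_range[OF F1 F4 V \<kappa>]
    by (intro DERIV_chain2[OF inv_der WV(1)]) auto
  define D where "D s = (deriv V s)\<^sup>2 / 2 - (deriv g (\<phi> s))\<^sup>2 / 2" for s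
  have D_der: "(D has_real_derivative \<kappa> * deriv V s * (deriv V s - deriv g (\<phi> s))) (at s)" for s
  proof -
    have 1: "((\<lambda>s. (deriv V s)\<^sup>2 / 2) has_real_derivative deriv V s * (\<kappa> * deriv V s - f (V s))) (at s)"
      by (auto intro!: derivative_eq_intros WV)
    have "((\<lambda>s. deriv g (\<phi> s)) has_real_derivative
        (\<kappa> * deriv g (\<phi> s) - f (g (\<phi> s))) * (inverse (deriv g (\<phi> s)) * deriv V s)) (at s)"
      by (rule DERIV_chain2[OF Wg(2) \<phi>_der])
    then have "((\<lambda>s. (deriv g (\<phi> s))\<^sup>2 / 2) has_real_derivative
        deriv g (\<phi> s) * ((\<kappa> * deriv g (\<phi> s) - f (g (\<phi> s))) * (inverse (deriv g (\<phi> s)) * deriv V s))) (at s)"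
      by (auto intro!: derivative_eq_intros)
    also have "deriv g (\<phi> s) * ((\<kappa> * deriv g (\<phi> s) - f (g (\<phi> s))) * (inverse (deriv g (\<phi> s)) * deriv V s))
        = (\<kappa> * deriv g (\<phi> s) - f (V s)) * deriv V s"
      using posg[of "\<phi> s"] g\<phi>[of s] by simp
    finally have "(D has_real_derivative deriv V s * (\<kappa> * deriv V s - f (V s))
        - (\<kappa> * deriv g (\<phi> s) - f (V s)) * deriv V s) (at s)"
      unfolding D_def by (intro DERIV_diff 1)
    then show ?thesis by (simp add: algebra_simps)
  qed
  have D_sign: "D s > 0 \<longleftrightarrow> deriv V s > deriv g (\<phi> s)" "D s < 0 \<longleftrightarrow> deriv V s < deriv g (\<phi> s)" for s
  proof -
    define p where "p = (deriv V s + deriv g (\<phi> s)) / 2"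
    have "D s = (deriv V s - deriv g (\<phi> s)) * p"
      unfolding D_def p_def by (simp add: power2_eq_square algebra_simps)
    moreover have "p > 0" using posg[of "\<phi> s"] posV[of s] unfolding p_def by simp
    ultimately show "D s > 0 \<longleftrightarrow> deriv V s > deriv g (\<phi> s)" "D s < 0 \<longleftrightarrow> deriv V s < deriv g (\<phi> s)"
      by (simp_all add: zero_less_mult_iff mult_less_0_iff)
  qed
  have \<phi>_top: "filterlim \<phi> at_top at_top"
    unfolding filterlim_at_top
  proof
    fix Z
    have "(V \<longlongrightarrow> 1) at_top" using V unfolding travelling_wave_def by auto
    then have "\<forall>\<^sub>F s in at_top. g Z < V s" using wave_range(2)[OF F1 F4 g \<kappa>] by (rule order_tendstoD(1))
    then show "\<forall>\<^sub>F s in at_top. Z \<le> \<phi> s"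
    proof eventually_elim
      case (elim s)
      show ?case
      proof (rule ccontr)
        assume "\<not> Z \<le> \<phi> s"
        then have "g (\<phi> s) < g Z" by (intro mono) simp
        then show False using elim g\<phi>[of s] by simp
      qed
    qed
  qed
  have D_lim: "(D \<longlongrightarrow> 0) at_top"
  proof -
    have "(deriv V \<longlongrightarrow> 0) at_top" using wave_deriv_tendsto_0(1)[OF F1 V] \<kappa> by simp
    moreover have "((\<lambda>s. deriv g (\<phi> s)) \<longlongrightarrow> 0) at_top"
      using filterlim_compose[OF wave_deriv_tendsto_0(1)[OF F1 g] \<phi>_top] \<kappa> by simp
    ultimately have "(D \<longlongrightarrow> 0\<^sup>2 / 2 - 0\<^sup>2 / 2) at_top" unfolding D_def by (intro tendsto_intros) simp_all
    then show ?thesis by simp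
  qed
  have sq_mono: "(D s)\<^sup>2 \<le> (D t)\<^sup>2" if "s \<le> t" for s t
    using that
  proof (rule DERIV_nonneg_imp_nondecreasing)
    fix x
    have "((\<lambda>s. (D s)\<^sup>2) has_real_derivative 2 * D x * (\<kappa> * deriv V x * (deriv V x - deriv g (\<phi> x)))) (at x)"
      by (auto intro!: derivative_eq_intros D_der)
    moreover have "D x * (deriv V x - deriv g (\<phi> x)) \<ge> 0"
      using D_sign[of x] by (cases "D x" "0::real" rule: linorder_cases) (auto simp: mult_nonpos_nonpos)
    then have "(2 * \<kappa> * deriv V x) * (D x * (deriv V x - deriv g (\<phi> x))) \<ge> 0"
      using \<kappa> posV[of x] by simp
    then have "2 * D x * (\<kappa> * deriv V x * (deriv V x - deriv g (\<phi> x))) \<ge> 0" by (simp add: mult_ac)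
    ultimately show "\<exists>d. ((\<lambda>s. (D s)\<^sup>2) has_real_derivative d) (at x) \<and> d \<ge> 0" by blast
  qed
  have D0: "D s = 0" for s
  proof -
    have "((\<lambda>s. (D s)\<^sup>2) \<longlongrightarrow> 0\<^sup>2) at_top" by (intro tendsto_intros D_lim)
    then have "(D s)\<^sup>2 \<le> 0\<^sup>2"
    proof (rule tendsto_lowerbound)
      show "\<forall>\<^sub>F t in at_top. (D s)\<^sup>2 \<le> (D t)\<^sup>2"
        using eventually_ge_at_top[of s] by eventually_elim (rule sq_mono)
    qed simp
    then show ?thesis by simp
  qed
  have "((\<lambda>s. \<phi> s - s) has_real_derivative 0) (at s)" for s
  proof -
    have "deriv V s = deriv g (\<phi> s)" using D_sign[of s] D0[of s] by auto
    then have "(\<phi> has_real_derivative 1) (at s)" using \<phi>_der[of s] posg[of "\<phi> s"] by simp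
    then show ?thesis by (auto intro!: derivative_eq_intros)
  qed
  then have "\<forall>s. ((\<lambda>s. \<phi> s - s) has_real_derivative 0) (at s)" by blast
  then have const: "\<phi> s - s = \<phi> 0 - 0" for s by (rule DERIV_isconst_all)
  have "V s = g (s + \<phi> 0)" for s
  proof -
    have "\<phi> s = s + \<phi> 0" using const[of s] by simp
    then show ?thesis using g\<phi>[of s] by simp
  qed
  then show ?thesis by blast
qed

lemma wave_deriv_lower_bound:
  assumes "F1 f" "F4 f" "travelling_wave f \<kappa> g" "0 < \<kappa>" "0 < a" "b < 1"
  shows "\<exists>c>0. \<forall>s. a \<le> g s \<longrightarrow> g s \<le> b \<longrightarrow> c \<le> deriv g s"
proof (cases "a \<le> b")
  case True
  note mono = wave_strict_mono[OF assms(1-4)]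
  obtain s1 where s1: "g s1 = a" using wave_surj[OF assms(1-5)] True assms(6) by auto
  obtain s2 where s2: "g s2 = b" using wave_surj[OF assms(1-4), of b] True assms(5,6) by auto
  have le: "s \<le> t" if "g s \<le> g t" for s t using mono[of t s] that by (cases "s \<le> t") auto
  have "{s1..s2} \<noteq> {}" using le[of s1 s2] s1 s2 True by simp
  moreover have "continuous_on {s1..s2} (deriv g)"
    using travelling_wave_DERIV(2)[OF assms(3)] by (auto intro!: continuous_at_imp_continuous_on DERIV_isCont)
  ultimately obtain z where z: "\<And>s. s \<in> {s1..s2} \<Longrightarrow> deriv g z \<le> deriv g s"
    using continuous_attains_inf[OF compact_Icc] by blast
  show ?thesis
  proof (intro exI[of _ "deriv g z"] conjI allI impI)
    show "0 < deriv g z" by (rule wave_deriv_pos[OF assms(1-4)])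
    fix s assume "a \<le> g s" "g s \<le> b"
    then have "s1 \<le> s" "s \<le> s2" using s1 s2 by (auto intro: le)
    then show "deriv g z \<le> deriv g s" using z by simp
  qed
next
  case False
  then show ?thesis by (intro exI[of _ 1]) auto
qed

text \<open>
  Lowering the wave by \<open>q\<close> and slowing it down by \<open>\<delta>\<close> leaves a surplus that is bounded away from 0
  wherever the lowered wave is positive. Near 1 it comes from the strict decrease of \<open>f\<close>; in the
  middle \<open>\<delta> g'\<close> beats the error \<open>L q\<close> if \<open>q\<close> is small; near 0 the change of \<open>f\<close> has the right sign and
  \<open>\<delta> g'\<close> is bounded below because \<open>g > q\<close>.
\<close>

lemma wave_lowered_is_strict_subsolution:
  assumes F1: "F1 f" and F2: "F2 f" and F4: "F4 f" and wave: "travelling_wave f \<kappa> g" and \<kappa>: "0 < \<kappa>"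
    and \<delta>: "0 < \<delta>"
  shows "\<exists>q\<in>{0<..1/4}. \<exists>\<sigma>>0. \<forall>s. q < g s \<longrightarrow> \<sigma> \<le> \<delta> * deriv g s + f (g s - q) - f (g s)"
proof -
  obtain \<eta> \<mu> where \<eta>: "0 < \<eta>" "\<eta> < 1/2" and \<mu>: "0 < \<mu>"
    and low: "\<And>u w. u \<in> {0..\<eta>} \<Longrightarrow> w \<in> {0..\<eta>} \<Longrightarrow> w \<le> u \<Longrightarrow> f u \<le> f w"
    and high: "\<And>u w. u \<in> {1-\<eta>..1} \<Longrightarrow> w \<in> {1-\<eta>..1} \<Longrightarrow> w \<le> u \<Longrightarrow> f u - f w \<le> - \<mu> * (u - w)"
    using monotone_near_endpoints[OF F1 F2 F4] by auto
  obtain L where L: "L \<ge> 0" "\<And>u w. u \<in> {0..1} \<Longrightarrow> w \<in> {0..1} \<Longrightarrow> \<bar>f u - f w\<bar> \<le> L * \<bar>u - w\<bar>"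
    using F1_lipschitz_bound[OF F1] by blast
  obtain c0 where c0: "c0 > 0" "\<And>s. \<eta> \<le> g s \<Longrightarrow> g s \<le> 1 - \<eta> / 2 \<Longrightarrow> c0 \<le> deriv g s"
    using wave_deriv_lower_bound[OF F1 F4 wave \<kappa> \<eta>(1), of "1 - \<eta> / 2"] \<eta> by auto
  have "0 < \<eta> / 2" "0 < \<delta> * c0 / (2 * (L + 1))" using \<eta> \<delta> c0 L by auto
  then obtain q where q0: "0 < q" "q < \<eta> / 2" "q < \<delta> * c0 / (2 * (L + 1))"
    using field_lbound_gt_zero by blast
  have qL: "L * q \<le> \<delta> * c0 / 2"
  proof -
    have "L * q \<le> (L + 1) * q" using q0 by (intro mult_right_mono) auto
    also have "\<dots> \<le> (L + 1) * (\<delta> * c0 / (2 * (L + 1)))" using q0 L by (intro mult_left_mono) auto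
    also have "\<dots> = \<delta> * c0 / 2" using L by (simp add: field_simps)
    finally show ?thesis .
  qed
  obtain c1 where c1: "c1 > 0" "\<And>s. q \<le> g s \<Longrightarrow> g s \<le> \<eta> \<Longrightarrow> c1 \<le> deriv g s"
    using wave_deriv_lower_bound[OF F1 F4 wave \<kappa> q0(1), of \<eta>] \<eta> by auto
  have "0 < min (\<delta> * c0 / 2) (\<delta> * c1)" using \<delta> c0 c1 by simp
  then obtain \<sigma> where \<sigma>: "0 < \<sigma>" "\<sigma> < min (\<delta> * c0 / 2) (\<delta> * c1)" "\<sigma> < \<mu> * q"
    using field_lbound_gt_zero[of "min (\<delta> * c0 / 2) (\<delta> * c1)" "\<mu> * q"] \<mu> q0 by auto
  have \<sigma>': "\<sigma> < \<delta> * c0 / 2" "\<sigma> < \<delta> * c1" using \<sigma>(2) by auto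
  have "\<sigma> \<le> \<delta> * deriv g s + f (g s - q) - f (g s)" if qs: "q < g s" for s
  proof -
    have g1: "g s < 1" and g'_pos: "0 < deriv g s"
      using wave_range(2)[OF F1 F4 wave \<kappa>] wave_deriv_pos[OF F1 F4 wave \<kappa>] by auto
    consider "g s \<le> \<eta>" | "\<eta> \<le> g s" "g s \<le> 1 - \<eta> / 2" | "1 - \<eta> / 2 \<le> g s" by linarith
    then show ?thesis
    proof cases
      case 1
      have "f (g s) \<le> f (g s - q)" using 1 qs q0 by (intro low) auto
      moreover have "\<delta> * c1 \<le> \<delta> * deriv g s" using c1(2)[of s] 1 qs \<delta> by (intro mult_left_mono) auto
      ultimately show ?thesis using \<sigma>' \<sigma>(3) by linarith
    next
      case 2
      have "\<bar>f (g s) - f (g s - q)\<bar> \<le> L * \<bar>g s - (g s - q)\<bar>" using qs q0 g1 by (intro L) auto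
      then have "\<bar>f (g s) - f (g s - q)\<bar> \<le> \<delta> * c0 / 2" using qL q0 by simp
      moreover have "\<delta> * c0 \<le> \<delta> * deriv g s" using c0(2)[of s] 2 \<delta> by (intro mult_left_mono) auto
      ultimately show ?thesis using \<sigma>' \<sigma>(3) by linarith
    next
      case 3
      have "f (g s) - f (g s - q) \<le> - \<mu> * (g s - (g s - q))" using 3 q0 g1 by (intro high) auto
      then have "f (g s) - f (g s - q) \<le> - (\<mu> * q)" by simp
      moreover have "0 \<le> \<delta> * deriv g s" using \<delta> g'_pos by simp
      ultimately show ?thesis using \<sigma>' \<sigma>(3) by linarith
    qed
  qed
  then show ?thesis using \<sigma>(1) q0 \<eta> by (intro bexI[of _ q] exI[of _ \<sigma>]) auto
qed

lemma wave_deriv_bounds: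
  assumes F1: "F1 f" and wave: "travelling_wave f \<kappa> g" and "0 \<le> \<kappa>"
  shows "\<exists>M>0. \<forall>s. \<bar>deriv g s\<bar> \<le> M \<and> \<bar>\<kappa> * deriv g s - f (g s)\<bar> \<le> M"
    and "0 < \<epsilon> \<Longrightarrow> \<exists>T. \<forall>s\<ge>T. \<bar>deriv g s\<bar> \<le> \<epsilon> \<and> \<bar>\<kappa> * deriv g s - f (g s)\<bar> \<le> \<epsilon>"
proof -
  note W = travelling_wave_DERIV[OF wave]
  obtain L where L: "L \<ge> 0" "\<And>u w. u \<in> {0..1} \<Longrightarrow> w \<in> {0..1} \<Longrightarrow> \<bar>f u - f w\<bar> \<le> L * \<bar>u - w\<bar>"
    using F1_lipschitz_bound[OF F1] by blast
  have f1: "\<bar>f (g s)\<bar> \<le> L * \<bar>g s - 1\<bar>" for s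
    using L(2)[OF W(3), of 1 s] F1 unfolding F1_def by simp
  obtain B where B: "B \<ge> 0"
    "\<And>t L \<epsilon>. (\<forall>s\<in>{t..t+1}. \<bar>g s - L\<bar> \<le> \<epsilon>) \<Longrightarrow> (deriv g t)\<^sup>2 \<le> 4 * \<epsilon>\<^sup>2 + B * \<epsilon>"
    using wave_deriv_square_le[OF assms] by blast
  define M0 where "M0 = sqrt (4 + B)"
  have M0: "\<bar>deriv g s\<bar> \<le> M0" for s
  proof -
    have "(deriv g s)\<^sup>2 \<le> 4 * 1\<^sup>2 + B * 1" using W(3) by (intro B(2)[of s 0 1]) auto
    then show ?thesis unfolding M0_def by (intro real_le_rsqrt) simp
  qed
  have fL: "\<bar>f (g s)\<bar> \<le> L" for s
  proof -
    have "\<bar>g s - 1\<bar> \<le> 1" using W(3)[of s] by auto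
    then show ?thesis using f1[of s] mult_left_mono[of "\<bar>g s - 1\<bar>" 1 L] L(1) by linarith
  qed
  show "\<exists>M>0. \<forall>s. \<bar>deriv g s\<bar> \<le> M \<and> \<bar>\<kappa> * deriv g s - f (g s)\<bar> \<le> M"
  proof (intro exI[of _ "M0 + \<kappa> * M0 + L + 1"] conjI allI)
    have "M0 \<ge> 0" unfolding M0_def using B(1) by simp
    then have nn: "M0 \<ge> 0" "\<kappa> * M0 \<ge> 0" using \<open>0 \<le> \<kappa>\<close> by auto
    show "0 < M0 + \<kappa> * M0 + L + 1" using nn L(1) by simp
    fix s
    show "\<bar>deriv g s\<bar> \<le> M0 + \<kappa> * M0 + L + 1" using M0[of s] nn L(1) by linarith
    have "\<bar>\<kappa> * deriv g s\<bar> \<le> \<kappa> * M0"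
      using M0[of s] \<open>0 \<le> \<kappa>\<close> by (simp add: abs_mult mult_left_mono)
    then show "\<bar>\<kappa> * deriv g s - f (g s)\<bar> \<le> M0 + \<kappa> * M0 + L + 1"
      using fL[of s] nn by linarith
  qed
  show "\<exists>T. \<forall>s\<ge>T. \<bar>deriv g s\<bar> \<le> \<epsilon> \<and> \<bar>\<kappa> * deriv g s - f (g s)\<bar> \<le> \<epsilon>" if "0 < \<epsilon>"
  proof -
    have "(deriv g \<longlongrightarrow> 0) at_top" by (rule wave_deriv_tendsto_0(1)[OF assms])
    moreover have "((\<lambda>s. f (g s)) \<longlongrightarrow> 0) at_top"
    proof (rule Lim_null_comparison)
      show "\<forall>\<^sub>F s in at_top. norm (f (g s)) \<le> L * \<bar>g s - 1\<bar>" using f1 by simp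
      have "((\<lambda>s. L * \<bar>g s - 1\<bar>) \<longlongrightarrow> L * \<bar>1 - 1\<bar>) at_top"
        using wave unfolding travelling_wave_def by (intro tendsto_intros) auto
      then show "((\<lambda>s. L * \<bar>g s - 1\<bar>) \<longlongrightarrow> 0) at_top" by simp
    qed
    ultimately have "((\<lambda>s. \<kappa> * deriv g s - f (g s)) \<longlongrightarrow> \<kappa> * 0 - 0) at_top" by (intro tendsto_intros)
    then have "\<forall>\<^sub>F s in at_top. \<bar>\<kappa> * deriv g s - f (g s)\<bar> < \<epsilon>"
      using tendstoD[of _ _ at_top \<epsilon>] that by (fastforce simp: dist_real_def)
    moreover have "\<forall>\<^sub>F s in at_top. \<bar>deriv g s\<bar> < \<epsilon>"
      using tendstoD[OF \<open>(deriv g \<longlongrightarrow> 0) at_top\<close> that] by (simp add: dist_real_def)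
    ultimately have "\<forall>\<^sub>F s in at_top. \<bar>deriv g s\<bar> \<le> \<epsilon> \<and> \<bar>\<kappa> * deriv g s - f (g s)\<bar> \<le> \<epsilon>"
      by eventually_elim auto
    then show ?thesis unfolding eventually_at_top_linorder .
  qed
qed

section \<open>Balls of the invading state spread at the planar speed\<close>

lemma sum_Basis_inner_square:
  "(\<Sum>b\<in>Basis. ((x::'a::euclidean_space) \<bullet> b)\<^sup>2) = (norm x)\<^sup>2"
  unfolding power2_norm_eq_inner by (subst euclidean_inner[of x x]) (simp add: power2_eq_square)

text \<open>
  The regularised distance \<open>sqrt (1 + |x - c|\<^sup>2)\<close> makes the radial profile smooth at the centre.
\<close>

lemma jet_radial_wave:
  fixes x c b :: "'a::euclidean_space"
  assumes b: "b \<in> Basis" and wave: "travelling_wave f \<kappa> g"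
  defines "S \<equiv> sqrt (1 + (norm (x - c))\<^sup>2)" and "m \<equiv> (x - c) \<bullet> b"
  shows "jet (\<lambda>x. g (\<rho> - sqrt (1 + (norm (x - c))\<^sup>2)) - q) x b
    (- deriv g (\<rho> - S) * (m / S))
    ((\<kappa> * deriv g (\<rho> - S) - f (g (\<rho> - S))) * (m\<^sup>2 / S\<^sup>2) - deriv g (\<rho> - S) * (1 / S - m\<^sup>2 / S ^ 3))"
proof -
  note W = travelling_wave_DERIV[OF wave]
  define S' where "S' s = sqrt (1 + ((norm (x - c))\<^sup>2 + 2 * s * m + s\<^sup>2))" for s
  have nrm: "(norm (x + s *\<^sub>R b - c))\<^sup>2 = (norm (x - c))\<^sup>2 + 2 * s * m + s\<^sup>2" for s
  proof -
    have "(norm ((x - c) + s *\<^sub>R b))\<^sup>2 = (norm (x - c))\<^sup>2 + 2 * s * m + s\<^sup>2"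
      using b unfolding power2_norm_eq_inner m_def
      by (simp add: inner_add_left inner_add_right inner_commute power2_eq_square)
    then show ?thesis by (simp add: algebra_simps)
  qed
  have arg_pos: "0 < 1 + ((norm (x - c))\<^sup>2 + 2 * s * m + s\<^sup>2)" for s
    using zero_le_power2[of "norm (x + s *\<^sub>R b - c)"] unfolding nrm by linarith
  have S'pos: "S' s > 0" for s unfolding S'_def using arg_pos by simp
  have S'der: "(S' has_real_derivative (m + s) / S' s) (at s)" for s
  proof -
    have "((\<lambda>s. 1 + ((norm (x - c))\<^sup>2 + 2 * s * m + s\<^sup>2)) has_real_derivative 2 * (m + s)) (at s)"
      by (auto intro!: derivative_eq_intros)
    from DERIV_chain2[OF DERIV_real_sqrt[OF arg_pos] this]
    have "((\<lambda>s. S' s) has_real_derivative inverse (S' s) / 2 * (2 * (m + s))) (at s)" unfolding S'_def .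
    moreover have "inverse (S' s) / 2 * (2 * (m + s)) = (m + s) / S' s"
      using S'pos[of s] by (simp add: field_simps)
    ultimately show ?thesis by (simp only:)
  qed
  have g_der: "((\<lambda>s. g (\<rho> - S' s)) has_real_derivative - deriv g (\<rho> - S' s) * ((m + s) / S' s)) (at s)" for s
  proof -
    have "((\<lambda>s. \<rho> - S' s) has_real_derivative - ((m + s) / S' s)) (at s)"
      by (auto intro!: derivative_eq_intros S'der)
    from DERIV_chain2[OF W(1) this] show ?thesis by simp
  qed
  have g'_der: "((\<lambda>s. deriv g (\<rho> - S' s)) has_real_derivative
      (\<kappa> * deriv g (\<rho> - S' s) - f (g (\<rho> - S' s))) * - ((m + s) / S' s)) (at s)" for s
  proof -
    have "((\<lambda>s. \<rho> - S' s) has_real_derivative - ((m + s) / S' s)) (at s)"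
      by (auto intro!: derivative_eq_intros S'der)
    from DERIV_chain2[OF W(2) this] show ?thesis .
  qed
  have S0: "S' 0 = S" unfolding S'_def S_def by simp
  have Spos: "S > 0" using S'pos[of 0] S0 by simp
  have frac_der: "((\<lambda>s. (m + s) / S' s) has_real_derivative (1 / S - m\<^sup>2 / S ^ 3)) (at 0)"
  proof -
    have "((\<lambda>s. (m + s) / S' s) has_real_derivative (1 * S' 0 - (m + 0) * ((m + 0) / S' 0)) / (S' 0 * S' 0)) (at 0)"
      by (rule DERIV_divide) (use S'der[of 0] S'pos[of 0] in \<open>auto intro!: derivative_eq_intros\<close>)
    moreover have "(1 * S' 0 - (m + 0) * ((m + 0) / S' 0)) / (S' 0 * S' 0) = 1 / S - m\<^sup>2 / S ^ 3"
      unfolding S0 using Spos by (simp add: field_simps power2_eq_square power3_eq_cube)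
    ultimately show ?thesis by simp
  qed
  show ?thesis
    unfolding jet_def nrm S'_def[symmetric]
  proof (intro exI[of _ "\<lambda>s. - deriv g (\<rho> - S' s) * ((m + s) / S' s)"] conjI allI)
    show "((\<lambda>s. g (\<rho> - S' s) - q) has_real_derivative - deriv g (\<rho> - S' s) * ((m + s) / S' s)) (at s)" for s
      using DERIV_diff[OF g_der DERIV_const[of q]] by simp
    show "- deriv g (\<rho> - S' 0) * ((m + 0) / S' 0) = - deriv g (\<rho> - S) * (m / S)" by (simp add: S0)
    have "((\<lambda>s. - (deriv g (\<rho> - S' s) * ((m + s) / S' s))) has_real_derivative
       - ((\<kappa> * deriv g (\<rho> - S' 0) - f (g (\<rho> - S' 0))) * - ((m + 0) / S' 0) * ((m + 0) / S' 0)
        + (1 / S - m\<^sup>2 / S ^ 3) * deriv g (\<rho> - S' 0))) (at 0)"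
      by (intro DERIV_minus DERIV_mult g'_der frac_der)
    then show "((\<lambda>s. - deriv g (\<rho> - S' s) * ((m + s) / S' s)) has_real_derivative
       (\<kappa> * deriv g (\<rho> - S) - f (g (\<rho> - S))) * (m\<^sup>2 / S\<^sup>2) - deriv g (\<rho> - S) * (1 / S - m\<^sup>2 / S ^ 3)) (at 0)"
      unfolding S0 by (simp add: power2_eq_square algebra_simps)
  qed
qed

text \<open>
  A ball whose centre \<open>c + \<kappa> t e\<close> is carried by the moving frame and whose radius grows at speed
  \<open>\<kappa>1 < \<kappa>s\<close>. Let \<open>U\<close> be the wave profile of the signed distance to its boundary, lowered by \<open>q\<close>; it is
  positive on a bounded set only, so a first contact time with \<open>v\<close> exists if there is any contact.
  At this contact \<open>v\<close> touches \<open>U\<close> from above in space and \<open>\<partial>\<^sub>t U \<ge> 0\<close>. Inserting the first and second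
  derivatives of \<open>U\<close> into the equation for \<open>v\<close>, the drift cancels against \<open>\<partial>\<^sub>t U\<close>, and the strict surplus
  of the lowered wave contradicts the error terms: these come from the curvature of the ball and from
  the regularised distance, and they are small because either the distance to the centre or the
  distance to the boundary is large.
\<close>

lemma front_spreading:
  fixes e :: "'a::euclidean_space"
  assumes F1: "F1 f" and F2: "F2 f" and F4: "F4 f" and wave: "travelling_wave f \<kappa>s g"
    and \<kappa>s: "0 < \<kappa>s" and \<kappa>1: "0 < \<kappa>1" "\<kappa>1 < \<kappa>s" and e: "e \<in> Basis"
  shows "\<exists>R q. 0 < q \<and> q < 1 \<and> (\<forall>\<kappa> v c t x. C_class 2 v \<longrightarrow> (\<forall>x. 0 < v x \<and> v x < 1) \<longrightarrow>
      (\<forall>x. - laplacian v x + \<kappa> * partial e v x = f (v x)) \<longrightarrow> (\<forall>x\<in>cball c R. v x > 1 - q) \<longrightarrow>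
      0 \<le> t \<longrightarrow> norm (x - (c + (\<kappa> * t) *\<^sub>R e)) \<le> \<kappa>1 * t \<longrightarrow> v x \<ge> 1/2)"
proof -
  note W = travelling_wave_DERIV[OF wave]
  note g'_pos = wave_deriv_pos[OF F1 F4 wave \<kappa>s]
  note g_mono = wave_strict_mono[OF F1 F4 wave \<kappa>s]
  define N where "N = real DIM('a)"
  obtain q \<sigma> where q: "0 < q" "q \<le> 1/4" and \<sigma>: "0 < \<sigma>"
    and strict: "\<And>s. q < g s \<Longrightarrow> \<sigma> \<le> (\<kappa>s - \<kappa>1) * deriv g s + f (g s - q) - f (g s)"
    using wave_lowered_is_strict_subsolution[OF F1 F2 F4 wave \<kappa>s, of "\<kappa>s - \<kappa>1"] \<kappa>1 by auto
  define h where "h s = \<kappa>s * deriv g s - f (g s)" for s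
  obtain M where M: "0 < M" "\<And>s. \<bar>deriv g s\<bar> \<le> M" "\<And>s. \<bar>h s\<bar> \<le> M"
    using wave_deriv_bounds(1)[OF F1 wave] \<kappa>s unfolding h_def by auto
  define \<epsilon> where "\<epsilon> = \<sigma> / (2 * (1 + N))"
  have N: "N \<ge> 0" unfolding N_def by simp
  have \<epsilon>: "0 < \<epsilon>" using \<sigma> N unfolding \<epsilon>_def by simp
  obtain T0 where T0: "\<And>s. s \<ge> T0 \<Longrightarrow> \<bar>deriv g s\<bar> \<le> \<epsilon>" "\<And>s. s \<ge> T0 \<Longrightarrow> \<bar>h s\<bar> \<le> \<epsilon>"
    using wave_deriv_bounds(2)[OF F1 wave _ \<epsilon>] \<kappa>s unfolding h_def by auto
  obtain sq where sq: "g sq = q" using wave_surj[OF F1 F4 wave \<kappa>s q(1)] q(2) by auto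
  obtain sp where sp: "g sp = 1 - q" using wave_surj[OF F1 F4 wave \<kappa>s, of "1 - q"] q by auto
  define w where "w = 1 + 2 * M * (1 + N) / \<sigma>"
  have w: "w \<ge> 1" unfolding w_def using M(1) N \<sigma> by simp
  have Mw: "M * (1 + N) / w < \<sigma>"
  proof -
    have "2 * M * (1 + N) / \<sigma> < w" unfolding w_def by simp
    then have "2 * M * (1 + N) < w * \<sigma>" using \<sigma> by (simp add: field_simps)
    moreover have "M * (1 + N) > 0" using M(1) N by simp
    ultimately have "M * (1 + N) < \<sigma> * w" by (simp add: mult.commute[of w])
    then show ?thesis using w by (simp add: field_simps)
  qed
  \<comment> \<open>If \<open>\<rho> \<ge> \<rho>0\<close> then \<open>\<rho> - S \<ge> T0\<close> or \<open>S \<ge> w\<close>, and each alternative makes the error small.\<close>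
  define \<rho>0 where "\<rho>0 = \<bar>T0\<bar> + w + \<bar>sp\<bar> + 1"
  define R where "R = \<rho>0 - sq"
  have error: "\<bar>h (\<rho> - S)\<bar> / S\<^sup>2 + deriv g (\<rho> - S) * (N / S) < \<sigma>" if "\<rho> \<ge> \<rho>0" and S: "S \<ge> 1" for \<rho> S
  proof (cases "\<rho> - S \<ge> T0")
    case True
    have "\<bar>h (\<rho> - S)\<bar> / S\<^sup>2 \<le> \<epsilon> / 1"
      using T0(2)[OF True] S \<epsilon> by (intro frac_le) auto
    moreover have "deriv g (\<rho> - S) * (N / S) \<le> \<epsilon> * (N / 1)"
      using T0(1)[OF True] S \<epsilon> N by (intro mult_mono frac_le) auto
    moreover have "\<epsilon> / 1 + \<epsilon> * (N / 1) = \<sigma> / 2"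
    proof -
      have cancel: "\<sigma> / (2 * P) * P = \<sigma> / 2" if "P > 0" for P using that by simp
      have "\<epsilon> * (1 + N) = \<sigma> / 2" unfolding \<epsilon>_def using N by (intro cancel) simp
      then show ?thesis by (simp add: algebra_simps)
    qed
    ultimately show ?thesis using \<sigma> by linarith
  next
    case False
    have Sw: "S \<ge> w" using False that(1) unfolding \<rho>0_def by linarith
    have "w * 1 \<le> S * S" using Sw w S by (intro mult_mono) auto
    then have "w \<le> S\<^sup>2" by (simp add: power2_eq_square)
    then have "\<bar>h (\<rho> - S)\<bar> / S\<^sup>2 \<le> M / w"
      using M w by (intro frac_le) auto
    moreover have "deriv g (\<rho> - S) * (N / S) \<le> M * (N / w)"
      using M(2)[of "\<rho> - S"] M(1) w N Sw by (intro mult_mono frac_le) auto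
    moreover have "M / w + M * (N / w) = M * (1 + N) / w" using w by (simp add: field_simps)
    ultimately show ?thesis using Mw by linarith
  qed
  have main: "v x0 \<ge> 1/2"
    if C2: "C_class 2 v" and range: "\<And>x. 0 < v x \<and> v x < 1"
      and eq: "\<And>x. - laplacian v x + \<kappa> * partial e v x = f (v x)"
      and ball: "\<And>x. x \<in> cball c R \<Longrightarrow> v x > 1 - q"
      and T: "0 \<le> T" and x0: "norm (x0 - (c + (\<kappa> * T) *\<^sub>R e)) \<le> \<kappa>1 * T" for \<kappa> v c T x0
  proof -
    define C where "C t = c + (\<kappa> * t) *\<^sub>R e" for t
    define S where "S t x = sqrt (1 + (norm (x - C t))\<^sup>2)" for t x
    define U where "U t x = g (\<rho>0 + \<kappa>1 * t - S t x) - q" for t x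
    have contv: "continuous_on UNIV v" using C2 by (simp add: numeral_2_eq_2)
    have S1: "S t x \<ge> 1" and Snorm: "norm (x - C t) \<le> S t x" for t x
    proof -
      show "S t x \<ge> 1" unfolding S_def by simp
      show "norm (x - C t) \<le> S t x" unfolding S_def by (intro real_le_rsqrt) simp
    qed
    have contS: "continuous_on UNIV (\<lambda>p. S (fst p) (snd p))"
      unfolding S_def C_def by (intro continuous_intros)
    have contg: "continuous_on UNIV g"
      using W(1) by (auto intro!: continuous_at_imp_continuous_on DERIV_isCont)
    have contU: "continuous_on UNIV (\<lambda>p. U (fst p) (snd p))"
      unfolding U_def
      by (intro continuous_intros continuous_on_compose2[OF contg] contS) auto
    have no_contact: "U t x < v x" if "0 \<le> t" for t x
    proof (rule ccontr)
      assume contact: "\<not> U t x < v x"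
      define K where "K = {0..t} \<times> cball c (R + \<kappa>1 * t + \<bar>\<kappa> * t\<bar>)"
      define Z where "Z = K \<inter> {p. v (snd p) - U (fst p) (snd p) \<le> 0}"
      have located: "x \<in> cball c (R + \<kappa>1 * t + \<bar>\<kappa> * t\<bar>)" if "0 \<le> s" "s \<le> t" "v x \<le> U s x" for s x
      proof -
        have "g sq < g (\<rho>0 + \<kappa>1 * s - S s x)" using that range[of x] sq unfolding U_def by linarith
        then have "sq < \<rho>0 + \<kappa>1 * s - S s x"
          using g_mono by (metis linorder_less_linear order_less_asym order_less_irrefl)
        then have "norm (x - C s) \<le> R + \<kappa>1 * s" using Snorm[of x s] unfolding R_def by linarith
        moreover have "norm (x - c) \<le> norm (x - C s) + norm ((\<kappa> * s) *\<^sub>R e)"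
          using norm_triangle_ineq[of "x - C s" "(\<kappa> * s) *\<^sub>R e"] unfolding C_def by simp
        moreover have "norm ((\<kappa> * s) *\<^sub>R e) \<le> \<bar>\<kappa> * t\<bar>"
          using e that by (simp add: abs_mult mult_left_mono)
        moreover have "\<kappa>1 * s \<le> \<kappa>1 * t" using \<kappa>1 that by simp
        ultimately show ?thesis by (simp add: dist_norm norm_minus_commute)
      qed
      have "closed {p. v (snd p) - U (fst p) (snd p) \<le> 0}"
        by (intro closed_Collect_le continuous_intros contU continuous_on_compose2[OF contv]) auto
      then have "compact Z" unfolding Z_def K_def
        by (intro compact_Int_closed compact_Times) auto
      moreover have "(t, x) \<in> Z" unfolding Z_def K_def using located[of t x] contact that by auto
      ultimately obtain p where p: "p \<in> Z" "\<And>p'. p' \<in> Z \<Longrightarrow> fst p \<le> fst p'"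
        using continuous_attains_inf[of Z fst] continuous_on_fst[OF continuous_on_id] by blast
      define t0 y where "t0 = fst p" and "y = snd p"
      have t0: "0 \<le> t0" "t0 \<le> t" and y: "v y \<le> U t0 y"
        using p(1) unfolding Z_def K_def t0_def y_def by auto
      have before: "U s z < v z" if "0 \<le> s" "s < t0" for s z
      proof (rule ccontr)
        assume "\<not> U s z < v z"
        then have "(s, z) \<in> Z" unfolding Z_def K_def using located[of s z] that t0 by auto
        then show False using p(2) that unfolding t0_def by force
      qed
      have t0_pos: "0 < t0"
      proof (rule ccontr)
        assume "\<not> 0 < t0"
        then have "t0 = 0" using t0 by simp
        have "U 0 y < v y"
        proof (cases "y \<in> cball c R")
          case True
          have "U 0 y < 1 - q" unfolding U_def using wave_range(2)[OF F1 F4 wave \<kappa>s] by simp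
          then show ?thesis using ball[OF True] by linarith
        next
          case False
          then have "R < S 0 y" using Snorm[of y 0] unfolding C_def by (simp add: dist_norm norm_minus_commute)
          then have "g (\<rho>0 + \<kappa>1 * 0 - S 0 y) < g sq" unfolding R_def by (intro g_mono) simp
          then show ?thesis unfolding U_def using sq range[of y] by linarith
        qed
        then show False using y \<open>t0 = 0\<close> by simp
      qed
      have contt: "isCont (\<lambda>s. U s z) t0" for z
      proof -
        have "continuous_on UNIV (\<lambda>s::real. (s, z))" by (intro continuous_intros)
        from continuous_on_compose2[OF contU this] have "continuous_on UNIV (\<lambda>s. U s z)" by simp
        then show ?thesis by (simp add: continuous_on_eq_continuous_at)
      qed
      have below: "U t0 z \<le> v z" for z
      proof (rule tendsto_upperbound)
        show "((\<lambda>s. U s z) \<longlongrightarrow> U t0 z) (at_left t0)"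
          using contt unfolding isCont_def by (rule filterlim_at_split[THEN iffD1, THEN conjunct1])
        have "\<forall>\<^sub>F s in at_left t0. s \<in> {0<..<t0}" using t0_pos by (rule eventually_at_left_real)
        then show "\<forall>\<^sub>F s in at_left t0. U s z \<le> v z"
          by eventually_elim (use before in \<open>auto intro: less_imp_le\<close>)
      qed simp
      have vy: "v y = U t0 y" using y below[of y] by simp
      define \<rho> where "\<rho> = \<rho>0 + \<kappa>1 * t0"
      define s0 where "s0 = S t0 y"
      define d where "d = \<rho> - s0"
      have s0: "s0 \<ge> 1" unfolding s0_def by (rule S1)
      have Ueq: "U t0 y = g d - q" unfolding U_def d_def \<rho>_def s0_def by simp
      have gd: "q < g d" using range[of y] vy Ueq by simp
      define m where "m b = (y - C t0) \<bullet> b" for b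
      have touch: "partial b v y = - deriv g d * (m b / s0) \<and>
          partial b (partial b v) y \<ge> h d * ((m b)\<^sup>2 / s0\<^sup>2) - deriv g d * (1 / s0 - (m b)\<^sup>2 / s0 ^ 3)"
        if b: "b \<in> Basis" for b
      proof -
        have "\<forall>\<^sub>F z in nhds y. v y - U t0 y \<le> v z - U t0 z" using below vy by simp
        then show ?thesis
          using jet_touching[OF jet_partial[OF C2 b] jet_radial_wave[OF b wave, where q = q and \<rho> = \<rho> and c = "C t0" and x = y]]
          unfolding U_def S_def \<rho>_def[symmetric] h_def m_def d_def s0_def by simp
      qed
      have sum_m: "(\<Sum>b\<in>Basis. (m b)\<^sup>2) = s0\<^sup>2 - 1"
        unfolding m_def s0_def S_def by (simp add: sum_Basis_inner_square)
      have lap: "laplacian v y \<ge> h d * ((s0\<^sup>2 - 1) / s0\<^sup>2) - deriv g d * (N / s0 - (s0\<^sup>2 - 1) / s0 ^ 3)"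
      proof -
        have "(\<Sum>b\<in>Basis. h d * ((m b)\<^sup>2 / s0\<^sup>2) - deriv g d * (1 / s0 - (m b)\<^sup>2 / s0 ^ 3))
            = h d * ((s0\<^sup>2 - 1) / s0\<^sup>2) - deriv g d * (N / s0 - (s0\<^sup>2 - 1) / s0 ^ 3)"
          unfolding sum_m[symmetric] N_def
          by (simp add: sum_subtractf sum_divide_distrib[symmetric] sum_distrib_left[symmetric])
        moreover have "(\<Sum>b\<in>Basis. h d * ((m b)\<^sup>2 / s0\<^sup>2) - deriv g d * (1 / s0 - (m b)\<^sup>2 / s0 ^ 3)) \<le> laplacian v y"
          unfolding laplacian_def using touch by (intro sum_mono) auto
        ultimately show ?thesis by simp
      qed
      have lap': "laplacian v y \<ge> h d - \<bar>h d\<bar> / s0\<^sup>2 - deriv g d * (N / s0)"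
      proof -
        have "(s0\<^sup>2 - 1) / s0\<^sup>2 = 1 - 1 / s0\<^sup>2" using s0 by (simp add: field_simps)
        then have "h d * ((s0\<^sup>2 - 1) / s0\<^sup>2) = h d - h d / s0\<^sup>2"
          by (simp only: right_diff_distrib mult_1_right times_divide_eq_right)
        moreover have "h d / s0\<^sup>2 \<le> \<bar>h d\<bar> / s0\<^sup>2" by (intro divide_right_mono) auto
        moreover have "1 \<le> s0\<^sup>2" using s0 by simp
        then have "0 \<le> deriv g d * ((s0\<^sup>2 - 1) / s0 ^ 3)" using g'_pos[of d] s0 by simp
        ultimately show ?thesis using lap by (simp add: algebra_simps)
      qed
      have time_der: "((\<lambda>s. U s y) has_real_derivative deriv g d * (\<kappa>1 + \<kappa> * (m e / s0))) (at t0)"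
      proof -
        have nrm: "(norm (y - C s))\<^sup>2 = (norm (y - c))\<^sup>2 - 2 * (\<kappa> * s) * ((y - c) \<bullet> e) + (\<kappa> * s)\<^sup>2" for s
        proof -
          have "y - C s = (y - c) - (\<kappa> * s) *\<^sub>R e" unfolding C_def by simp
          then show ?thesis
            using e by (simp only: power2_norm_eq_inner inner_diff_left[of "y - c"] inner_diff_right[of _ "y - c"])
              (simp add: inner_commute power2_eq_square)
        qed
        have arg_der: "((\<lambda>s. 1 + (norm (y - C s))\<^sup>2) has_real_derivative - 2 * \<kappa> * m e) (at t0)"
        proof -
          define a where "a = (y - c) \<bullet> e"
          have "m e = a - \<kappa> * t0"
            unfolding m_def C_def a_def using e by (simp add: inner_diff_left inner_add_left)
          then have "- 2 * \<kappa> * m e = - 2 * \<kappa> * a + 2 * (\<kappa> * t0) * \<kappa>"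
            by (simp only:) (simp add: algebra_simps)
          moreover have "((\<lambda>s. 1 + (norm (y - C s))\<^sup>2) has_real_derivative - 2 * \<kappa> * a + 2 * (\<kappa> * t0) * \<kappa>) (at t0)"
            unfolding nrm a_def[symmetric] by (auto intro!: derivative_eq_intros)
          ultimately show ?thesis by simp
        qed
        have arg_pos: "0 < 1 + (norm (y - C t0))\<^sup>2" by (simp add: add_pos_nonneg)
        have "((\<lambda>s. S s y) has_real_derivative inverse s0 / 2 * (- 2 * \<kappa> * m e)) (at t0)"
          using DERIV_chain2[OF DERIV_real_sqrt[OF arg_pos] arg_der] unfolding S_def s0_def .
        moreover have "inverse s0 / 2 * (- 2 * \<kappa> * m e) = - (\<kappa> * (m e / s0))"
          using s0 by (simp add: field_simps)
        ultimately have "((\<lambda>s. S s y) has_real_derivative - (\<kappa> * (m e / s0))) (at t0)" by (simp only:)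
        then have dist_der: "((\<lambda>s. \<rho>0 + \<kappa>1 * s - S s y) has_real_derivative \<kappa>1 + \<kappa> * (m e / s0)) (at t0)"
          by (auto intro!: derivative_eq_intros)
        have "(g has_real_derivative deriv g d) (at (\<rho>0 + \<kappa>1 * t0 - S t0 y))"
          using W(1)[of d] unfolding d_def \<rho>_def s0_def .
        from DERIV_diff[OF DERIV_chain2[OF this dist_der] DERIV_const[of q]]
        show ?thesis unfolding U_def by simp
      qed
      \<comment> \<open>Until \<open>t0\<close> the value of \<open>U\<close> at \<open>y\<close> was below \<open>v y\<close>, so it is not decreasing in time at \<open>t0\<close>.\<close>
      have "0 \<le> deriv g d * (\<kappa>1 + \<kappa> * (m e / s0))"
      proof (rule ccontr)
        assume "\<not> ?thesis"
        then obtain r where r: "r > 0" "\<And>a. a > 0 \<Longrightarrow> a < r \<Longrightarrow> U t0 y < U (t0 - a) y"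
          using DERIV_neg_dec_left[OF time_der] by auto
        obtain a where "0 < a" "a < r" "a < t0" using field_lbound_gt_zero[OF r(1) t0_pos] by blast
        then have "U t0 y < U (t0 - a) y" "U (t0 - a) y < v y" using r(2) before[of "t0 - a" y] by auto
        then show False using vy by simp
      qed
      then have "\<kappa> * partial e v y \<le> \<kappa>1 * deriv g d"
        using touch[OF e] by (simp add: algebra_simps)
      moreover have "f (v y) = f (g d - q)" using vy Ueq by simp
      ultimately have "h d - \<bar>h d\<bar> / s0\<^sup>2 - deriv g d * (N / s0) \<le> \<kappa>1 * deriv g d - f (g d - q)"
        using lap' eq[of y] by linarith
      then have "(\<kappa>s - \<kappa>1) * deriv g d + f (g d - q) - f (g d) \<le> \<bar>h d\<bar> / s0\<^sup>2 + deriv g d * (N / s0)"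
        unfolding h_def by (simp add: algebra_simps)
      moreover have "\<bar>h d\<bar> / s0\<^sup>2 + deriv g d * (N / s0) < \<sigma>"
        unfolding d_def by (rule error[OF _ s0]) (use \<kappa>1 t0 in \<open>simp add: \<rho>_def\<close>)
      ultimately show False using strict[OF gd] by linarith
    qed
    have "S T x0 \<le> 1 + \<kappa>1 * T"
    proof -
      have "S T x0 \<le> 1 + norm (x0 - C T)"
        unfolding S_def by (rule real_le_lsqrt) (auto simp: power2_eq_square algebra_simps)
      then show ?thesis using x0 unfolding C_def by linarith
    qed
    then have "sp < \<rho>0 + \<kappa>1 * T - S T x0" using w unfolding \<rho>0_def by linarith
    then have "1 - q < g (\<rho>0 + \<kappa>1 * T - S T x0)" using g_mono sp by metis
    then show ?thesis using no_contact[OF T, of x0] q unfolding U_def by linarith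
  qed
  show ?thesis
  proof (rule exI[of _ R], rule exI[of _ q], intro conjI allI impI)
    show "0 < q" "q < 1" using q by auto
    fix \<kappa> v c t x
    assume "C_class 2 v" "\<forall>x. 0 < v x \<and> v x < 1" "\<forall>x. - laplacian v x + \<kappa> * partial e v x = f (v x)"
      "\<forall>x\<in>cball c R. 1 - q < v x" "0 \<le> t" "norm (x - (c + (\<kappa> * t) *\<^sub>R e)) \<le> \<kappa>1 * t"
    then show "1/2 \<le> v x" by (intro main[of v \<kappa> c t x]) blast+
  qed
qed

section \<open>The level sets as Lipschitz graphs\<close>

lemma C_class_cmult: "C_class k u \<Longrightarrow> C_class k (\<lambda>x. c * u x)"
proof (induction k arbitrary: u)
  case 0
  then show ?case by (auto intro: continuous_on_mult_left)
next
  case (Suc k)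
  have "(\<lambda>s. c * u (x + s *\<^sub>R b)) differentiable at 0" "C_class k (partial b (\<lambda>x. c * u x))"
    if b: "b \<in> Basis" for x b
  proof -
    have der: "((\<lambda>s. c * u (x + s *\<^sub>R b)) has_real_derivative c * partial b u x) (at 0)" for x
      using DERIV_cmult[OF C_class_DERIV_along[OF Suc.prems b, of x 0]] by simp
    then show "(\<lambda>s. c * u (x + s *\<^sub>R b)) differentiable at 0"
      by (auto simp: real_differentiable_def)
    have "partial b (\<lambda>x. c * u x) = (\<lambda>x. c * partial b u x)"
      unfolding partial_def[of b "\<lambda>x. c * u x"] using DERIV_imp_deriv[OF der] by auto
    then show "C_class k (partial b (\<lambda>x. c * u x))" using Suc b by simp
  qed
  then show ?case using Suc.prems by (auto intro: continuous_on_mult_left)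
qed

text \<open>
  In the moving frame \<open>\<partial>\<^sub>t = \<kappa> \<partial>\<^sub>e\<close>, so all partial derivatives are again functions of this form.
\<close>

lemma C_class_moving_frame:
  fixes u :: "'a::euclidean_space \<Rightarrow> real"
  assumes e: "e \<in> Basis"
  shows "C_class k u \<Longrightarrow> C_class k (\<lambda>p. u (fst p + (\<kappa> * snd p) *\<^sub>R e))"
proof (induction k arbitrary: u)
  case 0
  then show ?case by (auto intro!: continuous_on_compose2[of UNIV u] continuous_intros)
next
  case (Suc k)
  define w where "w p = u (fst p + (\<kappa> * snd p) *\<^sub>R e)" for p
  have "(\<lambda>s. w (p + s *\<^sub>R b)) differentiable at 0 \<and> C_class k (partial b w)"
    if "b \<in> Basis" for p b
  proof -
    from that consider b' where "b = (b', 0)" "b' \<in> Basis" | "b = (0, 1)" unfolding Basis_prod_def by auto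
    then show ?thesis
    proof cases
      case 1
      have der: "((\<lambda>s. w (p + s *\<^sub>R b)) has_real_derivative partial b' u (fst p + (\<kappa> * snd p) *\<^sub>R e)) (at 0)" for p
        using C_class_DERIV_along[OF Suc.prems 1(2), of "fst p + (\<kappa> * snd p) *\<^sub>R e" 0]
        unfolding w_def 1(1) by (simp add: add_ac)
      then have "partial b w = (\<lambda>p. partial b' u (fst p + (\<kappa> * snd p) *\<^sub>R e))"
        unfolding partial_def[of b w] using DERIV_imp_deriv by blast
      moreover have "C_class k (partial b' u)" using Suc.prems 1(2) by simp
      ultimately have "C_class k (partial b w)" using Suc.IH by simp
      moreover have "(\<lambda>s. w (p + s *\<^sub>R b)) differentiable at 0"
        using der[of p] unfolding real_differentiable_def by blast
      ultimately show ?thesis by blast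
    next
      case 2
      have der: "((\<lambda>s. w (p + s *\<^sub>R b)) has_real_derivative \<kappa> * partial e u (fst p + (\<kappa> * snd p) *\<^sub>R e)) (at 0)" for p
      proof -
        define y where "y = fst p + (\<kappa> * snd p) *\<^sub>R e"
        have "((\<lambda>s. \<kappa> * s) has_real_derivative \<kappa>) (at 0)" by (auto intro!: derivative_eq_intros)
        from DERIV_chain2[where f = "\<lambda>s. u (y + s *\<^sub>R e)" and g = "\<lambda>s. \<kappa> * s",
            OF C_class_DERIV_along[OF Suc.prems e] this]
        have "((\<lambda>s. u (y + (\<kappa> * s) *\<^sub>R e)) has_real_derivative \<kappa> * partial e u y) (at 0)"
          by (simp add: mult.commute)
        moreover have "w (p + s *\<^sub>R b) = u (y + (\<kappa> * s) *\<^sub>R e)" for s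
          unfolding w_def y_def 2 by (simp add: algebra_simps)
        ultimately show ?thesis unfolding y_def by simp
      qed
      then have "partial b w = (\<lambda>p. \<kappa> * partial e u (fst p + (\<kappa> * snd p) *\<^sub>R e))"
        unfolding partial_def[of b w] using DERIV_imp_deriv by blast
      moreover have "C_class k (\<lambda>x. \<kappa> * partial e u x)" using Suc.prems e by (simp add: C_class_cmult)
      ultimately have "C_class k (partial b w)" using Suc.IH by simp
      moreover have "(\<lambda>s. w (p + s *\<^sub>R b)) differentiable at 0"
        using der[of p] unfolding real_differentiable_def by blast
      ultimately show ?thesis by blast
    qed
  qed
  moreover have "continuous_on UNIV w"
    unfolding w_def using Suc.prems by (auto intro!: continuous_on_compose2[of UNIV u] continuous_intros)
  ultimately show ?case unfolding w_def[symmetric] by (simp add: w_def[abs_def])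
qed

lemma partial_translate: "partial b (\<lambda>y. u (y + h)) x = partial b u (x + h)"
  unfolding partial_def by (simp add: add_ac)

lemma laplacian_translate: "laplacian (\<lambda>y. u (y + h)) x = laplacian u (x + h)"
proof -
  have "partial b (\<lambda>y. u (y + h)) = (\<lambda>y. partial b u (y + h))" for b :: 'a
    using partial_translate[of b u h] by auto
  then show ?thesis unfolding laplacian_def by (simp add: partial_translate)
qed

text \<open>
  The level set \<open>{w = 1 - b0}\<close> is the graph \<open>t = h x\<close>, and \<open>depth = -\<kappa> h\<close>. Each time line crosses the
  graph once. Below it \<open>w < 1 - b0\<close>, since \<open>w\<close> grows in time wherever it exceeds \<open>1 - b0\<close> and could
  not come back to this level; above it \<open>w > 1 - b0\<close>, since this connected region contains a point
  with \<open>w > 1 - b0\<close>. There \<open>\<partial>\<^sub>t w \<ge> c0 (1 - w)\<close> gives exponential convergence to 1. Below the graph, the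
  distance to \<open>{v \<ge> 1 - b0}\<close> is comparable to \<open>-depth\<close> because \<open>h\<close> is Lipschitz.
\<close>

lemma front_depth_function:
  fixes v :: "real ^ 'n \<Rightarrow> real"
  assumes adm: "admissible_b0 TYPE('n) f b0" and \<kappa>: "0 < \<kappa>" and e: "e \<in> Basis"
    and C2: "C_class 2 v" and range: "\<And>x. 0 < v x \<and> v x < 1"
    and eq: "\<And>x. - laplacian v x + \<kappa> * partial e v x = f (v x)"
    and sup: "(SUP x. v x) = 1"
    and lim: "(v \<longlongrightarrow> 0) (filtercomap (\<lambda>x. infdist x {y. v y \<ge> 1 - b0}) at_top)"
  shows "\<exists>depth K. 0 \<le> K \<and> (\<forall>x y. \<bar>depth x - depth y\<bar> \<le> K * norm (x - y)) \<and>
    (\<forall>x s. depth (x + s *\<^sub>R e) = depth x + s) \<and>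
    (\<forall>\<epsilon>>0. \<exists>D. \<forall>x. (D \<le> depth x \<longrightarrow> 1 - \<epsilon> < v x) \<and> (depth x \<le> - D \<longrightarrow> v x < \<epsilon>))"
proof -
  define w where "w p = v (fst p + (\<kappa> * snd p) *\<^sub>R e)" for p :: "(real ^ 'n) \<times> real"
  define W where "W x t = v (x + (\<kappa> * t) *\<^sub>R e)" for x t
  have wW: "w (x, t) = W x t" for x t unfolding w_def W_def by simp
  have contv: "continuous_on UNIV v" using C2 by (simp add: numeral_2_eq_2)
  have Wder: "(W x has_real_derivative \<kappa> * partial e v (x + (\<kappa> * t) *\<^sub>R e)) (at t)" for x t
  proof -
    have "C_class (Suc 1) v" using C2 by (simp add: numeral_2_eq_2)
    note der = C_class_DERIV_along[OF this e]
    have "((\<lambda>s. \<kappa> * s) has_real_derivative \<kappa>) (at t)" by (auto intro!: derivative_eq_intros)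
    from DERIV_chain2[where f = "\<lambda>s. v (x + s *\<^sub>R e)" and g = "\<lambda>s. \<kappa> * s", OF der this]
    show ?thesis unfolding W_def[abs_def] by (simp add: mult.commute)
  qed
  have td: "time_deriv w x t = \<kappa> * partial e v (x + (\<kappa> * t) *\<^sub>R e)" for x t
    unfolding wW using DERIV_imp_deriv[OF Wder[of x t]] by simp
  have entire: "entire_solution f w"
    unfolding entire_solution_def
  proof (intro conjI allI)
    show "C_class 2 w" unfolding w_def[abs_def] by (rule C_class_moving_frame[OF e C2])
    show "0 < w (x, t)" "w (x, t) < 1" for x t using range unfolding w_def by auto
    fix x t
    have "laplacian (\<lambda>y. w (y, t)) x = laplacian v (x + (\<kappa> * t) *\<^sub>R e)"
      unfolding w_def by (simp add: laplacian_translate)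
    then show "time_deriv w x t - laplacian (\<lambda>y. w (y, t)) x = f (w (x, t))"
      unfolding td using eq[of "x + (\<kappa> * t) *\<^sub>R e"] by (simp add: w_def)
  qed
  have supw: "(SUP x. w (x, t)) = 1" for t
  proof -
    have "range (\<lambda>x. w (x, t)) = range v"
    proof -
      have "v y \<in> range (\<lambda>x. w (x, t))" for y
        by (rule image_eqI[of _ _ "y - (\<kappa> * t) *\<^sub>R e"]) (simp_all add: w_def)
      then show ?thesis unfolding w_def by auto
    qed
    then show ?thesis using sup by simp
  qed
  have b0: "0 < b0" "b0 < 1" using adm unfolding admissible_b0_def by auto
  obtain c0 C0 where c0: "c0 > 0" and all: "\<forall>w :: (real ^ 'n) \<times> real \<Rightarrow> real.
        entire_solution f w \<and> (\<forall>t. (SUP x. w (x, t)) = 1) \<longrightarrow>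
          (\<forall>l\<in>{1 - b0..<1}. \<exists>h L. L-lipschitz_on UNIV h \<and> {p. w p = l} = {(x, t). t = h x}) \<and>
          (\<forall>x t. w (x, t) > 1 - b0 \<longrightarrow> time_deriv w x t \<ge> c0 * (1 - w (x, t)) \<and>
              norm (gradient (\<lambda>y. w (y, t)) x) + \<bar>time_deriv w x t\<bar> \<le> C0 * (1 - w (x, t)))"
    using adm unfolding admissible_b0_def by blast
  have props: "(\<forall>l\<in>{1 - b0..<1}. \<exists>h L. L-lipschitz_on UNIV h \<and> {p. w p = l} = {(x, t). t = h x}) \<and>
          (\<forall>x t. w (x, t) > 1 - b0 \<longrightarrow> time_deriv w x t \<ge> c0 * (1 - w (x, t)) \<and>
              norm (gradient (\<lambda>y. w (y, t)) x) + \<bar>time_deriv w x t\<bar> \<le> C0 * (1 - w (x, t)))"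
    by (rule all[THEN spec, THEN mp]) (intro conjI allI entire supw)
  note level = conjunct1[OF props]
  have growth: "time_deriv w x t \<ge> c0 * (1 - w (x, t))" if "w (x, t) > 1 - b0" for x t
    using conjunct2[OF props] that by blast
  have "1 - b0 \<in> {1 - b0..<1}" using b0 by simp
  then obtain h L where L: "L-lipschitz_on UNIV h" and h: "{p. w p = 1 - b0} = {(x, t). t = h x}"
    using level by blast
  have on_graph: "W x t = 1 - b0 \<longleftrightarrow> t = h x" for x t
    using h unfolding wW[symmetric] by (auto simp: set_eq_iff)
  have growthW: "\<kappa> * partial e v (x + (\<kappa> * t) *\<^sub>R e) \<ge> c0 * (1 - W x t)" if "W x t > 1 - b0" for x t
    using growth[unfolded td, unfolded wW] that by blast
  have Lnn: "L \<ge> 0" using L by (rule lipschitz_on_nonneg)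
  have hlip: "\<bar>h x - h y\<bar> \<le> L * norm (x - y)" for x y
    using lipschitz_onD[OF L, of x y] by (simp add: dist_norm)
  have conth: "continuous_on UNIV h" using L by (rule lipschitz_on_continuous_on)
  have contW: "continuous_on A (W x)" for A x
    using Wder by (auto intro!: continuous_at_imp_continuous_on DERIV_isCont)
  have below: "W x t < 1 - b0" if lt: "t < h x" for x t
  proof (rule ccontr)
    assume "\<not> W x t < 1 - b0"
    then have gt: "W x t > 1 - b0" using on_graph[of x t] lt by simp
    have gt': "W x s > 1 - b0" if s: "t \<le> s" "s < h x" for s
    proof (rule ccontr)
      assume "\<not> W x s > 1 - b0"
      then obtain r where "t \<le> r" "r \<le> s" "W x r = 1 - b0"
        using IVT2'[of "W x" s "1 - b0" t, OF _ _ s(1) contW] gt by (auto simp: less_imp_le)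
      then show False using on_graph[of x r] s by simp
    qed
    have "W x t < W x (h x)"
    proof (rule DERIV_pos_imp_increasing_open[OF lt])
      fix s assume s: "t < s" "s < h x"
      then have "W x s > 1 - b0" by (intro gt') auto
      moreover have "c0 * (1 - W x s) > 0" using c0 range unfolding W_def by simp
      ultimately have "\<kappa> * partial e v (x + (\<kappa> * s) *\<^sub>R e) > 0" using growthW[of x s] by linarith
      then show "\<exists>d. (W x has_real_derivative d) (at s) \<and> 0 < d" using Wder by blast
    qed (rule contW)
    then show False using gt on_graph[of x "h x"] by simp
  qed
  have above: "W x t > 1 - b0" if gt: "h x < t" for x t
  proof (rule ccontr)
    assume "\<not> W x t > 1 - b0"
    then have lt: "W x t < 1 - b0" using on_graph[of x t] gt by force
    obtain x1 where x1: "v x1 > 1 - b0"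
    proof -
      have "bdd_above (range v)" using range by (auto intro!: bdd_aboveI[of _ 1] less_imp_le)
      then show ?thesis using less_cSUP_iff[of UNIV v "1 - b0"] sup b0 that by auto
    qed
    then have Wx1: "W x1 0 > 1 - b0" unfolding W_def by simp
    have hx1: "h x1 < 0"
      using below[of 0 x1] on_graph[of x1 0] Wx1 by (cases "h x1" "0::real" rule: linorder_cases) auto
    define J where "J = (\<lambda>p. W (fst p) (h (fst p) + snd p)) ` (UNIV \<times> {0<..})"
    have "connected J"
      unfolding J_def W_def
      by (intro connected_continuous_image connected_Times connected_UNIV connected_Ioi
          continuous_on_compose2[OF contv] continuous_on_compose2[OF conth] continuous_intros) auto
    moreover have "W x t \<in> J"
      unfolding J_def using gt by (intro image_eqI[of _ _ "(x, t - h x)"]) auto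
    moreover have "W x1 0 \<in> J"
      unfolding J_def using hx1 by (intro image_eqI[of _ _ "(x1, - h x1)"]) auto
    ultimately have "{W x t..W x1 0} \<subseteq> J" by (rule connected_contains_Icc)
    then have "1 - b0 \<in> J" using lt Wx1 by auto
    then obtain y s where "0 < s" "W y (h y + s) = 1 - b0" unfolding J_def by force
    then show False using on_graph[of y "h y + s"] by simp
  qed
  have decay: "1 - W x t \<le> exp (- c0 * (t - h x - 1))" if t: "h x + 1 \<le> t" for x t
  proof -
    have "(1 - W x t) * exp (c0 * t) \<le> (1 - W x (h x + 1)) * exp (c0 * (h x + 1))"
    proof (rule DERIV_nonpos_imp_nonincreasing[OF t])
      fix s assume s: "h x + 1 \<le> s"
      define d where "d = \<kappa> * partial e v (x + (\<kappa> * s) *\<^sub>R e)"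
      have "((\<lambda>s. (1 - W x s) * exp (c0 * s)) has_real_derivative (c0 * (1 - W x s) - d) * exp (c0 * s)) (at s)"
        unfolding d_def by (auto intro!: derivative_eq_intros Wder simp: algebra_simps)
      moreover have "c0 * (1 - W x s) - d \<le> 0" unfolding d_def using growthW[OF above[of x s]] s by simp
      then have "(c0 * (1 - W x s) - d) * exp (c0 * s) \<le> 0" by (intro mult_nonpos_nonneg) auto
      ultimately show "\<exists>d. ((\<lambda>s. (1 - W x s) * exp (c0 * s)) has_real_derivative d) (at s) \<and> d \<le> 0" by blast
    qed
    also have "\<dots> \<le> 1 * exp (c0 * (h x + 1))"
      using range unfolding W_def by (intro mult_right_mono) (auto intro: less_imp_le)
    finally have "(1 - W x t) * exp (c0 * t) * exp (- c0 * t) \<le> exp (c0 * (h x + 1)) * exp (- c0 * t)"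
      by (intro mult_right_mono) auto
    then show ?thesis by (simp add: mult.assoc exp_add[symmetric] algebra_simps)
  qed
  define depth where "depth x = - \<kappa> * h x" for x
  have shift: "depth (x + s *\<^sub>R e) = depth x + s" for x s
  proof -
    have "W (x + s *\<^sub>R e) (h x - s / \<kappa>) = W x (h x)"
      unfolding W_def using \<kappa> by (simp add: algebra_simps)
    then have "h x - s / \<kappa> = h (x + s *\<^sub>R e)"
      using on_graph[of x "h x"] on_graph[of "x + s *\<^sub>R e" "h x - s / \<kappa>"] by simp
    then have "depth (x + s *\<^sub>R e) = - \<kappa> * (h x - s / \<kappa>)" unfolding depth_def by (simp only:)
    also have "\<dots> = depth x + s" unfolding depth_def right_diff_distrib using \<kappa> by simp
    finally show ?thesis .
  qed
  have lip: "\<bar>depth x - depth y\<bar> \<le> (\<kappa> * L) * norm (x - y)" for x y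
  proof -
    have "depth x - depth y = \<kappa> * (h y - h x)" unfolding depth_def by (simp add: algebra_simps)
    then have "\<bar>depth x - depth y\<bar> = \<kappa> * \<bar>h x - h y\<bar>" using \<kappa> by (simp add: abs_mult abs_minus_commute)
    also have "\<dots> \<le> \<kappa> * (L * norm (x - y))" using hlip \<kappa> by (intro mult_left_mono) auto
    finally show ?thesis by simp
  qed
  have v_h: "v x = W x 0" for x unfolding W_def by simp
  have far: "\<exists>D. \<forall>x. (D \<le> depth x \<longrightarrow> 1 - \<epsilon> < v x) \<and> (depth x \<le> - D \<longrightarrow> v x < \<epsilon>)" if \<epsilon>: "\<epsilon> > 0" for \<epsilon>
  proof -
    \<comment> \<open>The time after which the exponential decay has brought \<open>1 - w\<close> below \<open>\<epsilon>\<close>.\<close>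
    define T where "T = \<bar>(1 - ln \<epsilon>) / c0\<bar>"
    have T: "T \<ge> 0" "exp (- c0 * T) < \<epsilon>"
    proof -
      have "(1 - ln \<epsilon>) / c0 \<le> T" unfolding T_def by (rule abs_ge_self)
      then have "1 - ln \<epsilon> \<le> c0 * T" using c0 by (simp add: field_simps)
      then have "exp (- c0 * T) < exp (ln \<epsilon>)" by simp
      then show "exp (- c0 * T) < \<epsilon>" using \<epsilon> by simp
    qed (simp add: T_def)
    define \<Gamma> where "\<Gamma> = {y. v y \<ge> 1 - b0}"
    have "\<forall>\<^sub>F x in filtercomap (\<lambda>x. infdist x \<Gamma>) at_top. dist (v x) 0 < \<epsilon>"
      using lim \<epsilon> unfolding \<Gamma>_def by (rule tendstoD)
    then obtain N where N: "\<And>x. infdist x \<Gamma> \<ge> N \<Longrightarrow> v x < \<epsilon>"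
      unfolding eventually_filtercomap_at_top_linorder by (force simp: dist_real_def)
    define D where "D = max (\<kappa> * (T + 1)) (\<kappa> * ((L + 1) * \<bar>N\<bar>))"
    have "1 - \<epsilon> < v x" if "D \<le> depth x" for x
    proof -
      have "\<kappa> * (T + 1) \<le> \<kappa> * (- h x)" using that unfolding D_def depth_def by simp
      then have hx: "T + 1 \<le> - h x" using \<kappa> by (simp only: mult_le_cancel_left_pos)
      then have "1 - W x 0 \<le> exp (- c0 * (0 - h x - 1))" using T by (intro decay) simp
      also have "\<dots> \<le> exp (- c0 * T)" using hx c0 by simp
      finally show ?thesis using T(2) unfolding v_h by linarith
    qed
    moreover have "v x < \<epsilon>" if "depth x \<le> - D" for x
    proof (rule N)
      have "\<kappa> * ((L + 1) * \<bar>N\<bar>) \<le> \<kappa> * h x" using that unfolding D_def depth_def by simp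
      then have hx: "(L + 1) * \<bar>N\<bar> \<le> h x" using \<kappa> by (simp only: mult_le_cancel_left_pos)
      have ne: "\<Gamma> \<noteq> {}"
      proof -
        have "x + (\<kappa> * h x) *\<^sub>R e \<in> \<Gamma>" using on_graph[of x "h x"] unfolding \<Gamma>_def W_def by simp
        then show ?thesis by blast
      qed
      have "\<bar>N\<bar> \<le> dist x y" if "y \<in> \<Gamma>" for y
      proof -
        have "h y \<le> 0" using that below[of 0 y] unfolding \<Gamma>_def v_h by (cases "0 < h y") auto
        then have "(L + 1) * \<bar>N\<bar> \<le> L * norm (x - y)" using hx hlip[of x y] by linarith
        also have "\<dots> \<le> (L + 1) * norm (x - y)" by (intro mult_right_mono) auto
        finally show ?thesis using Lnn by (simp add: dist_norm)
      qed
      then have "\<bar>N\<bar> \<le> infdist x \<Gamma>" unfolding infdist_notempty[OF ne] using ne by (intro cINF_greatest)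
      then show "N \<le> infdist x \<Gamma>" by linarith
    qed
    ultimately show ?thesis by blast
  qed
  show ?thesis
    by (rule exI[of _ depth], rule exI[of _ "\<kappa> * L"]) (use lip shift far \<kappa> Lnn in auto)
qed

section \<open>Rigidity of fronts\<close>

text \<open>
  All that is used of the geometry of the front: \<open>depth\<close> measures, in the direction \<open>e\<close>, how deep a
  point lies in the invaded region.
\<close>

locale front =
  fixes f :: "real \<Rightarrow> real" and e :: "'a::euclidean_space" and \<kappa> :: real
    and v :: "'a \<Rightarrow> real" and depth :: "'a \<Rightarrow> real" and K :: real
  assumes F1: "F1 f" and F2: "F2 f" and F4: "F4 f"
    and e: "e \<in> Basis" and \<kappa>: "0 < \<kappa>"
    and C2: "C_class 2 v" and range: "0 < v x" "v x < 1"
    and eq: "- laplacian v x + \<kappa> * partial e v x = f (v x)"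
    and K: "0 \<le> K" and depth_lipschitz: "\<bar>depth x - depth y\<bar> \<le> K * norm (x - y)"
    and depth_shift: "depth (x + s *\<^sub>R e) = depth x + s"
    and deep: "\<epsilon> > 0 \<Longrightarrow> \<exists>D. \<forall>x. (D \<le> depth x \<longrightarrow> 1 - \<epsilon> < v x) \<and> (depth x \<le> - D \<longrightarrow> v x < \<epsilon>)"
begin

lemma norm_e: "norm e = 1" using e by simp

lemma continuous_v: "continuous_on UNIV v" using C2 by (simp add: numeral_2_eq_2)

lemma v_lipschitz: "\<exists>C\<ge>0. \<forall>x y. \<bar>v x - v y\<bar> \<le> C * norm (x - y)"
proof -
  obtain L where L: "L \<ge> 0" "\<And>u w. u \<in> {0..1} \<Longrightarrow> w \<in> {0..1} \<Longrightarrow> \<bar>f u - f w\<bar> \<le> L * \<bar>u - w\<bar>"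
    using F1_lipschitz_bound[OF F1] by blast
  have "\<bar>(\<Sum>b\<in>Basis. partial b (partial b v) x) - \<kappa> * partial e v x\<bar> \<le> L" for x
  proof -
    have "\<bar>f (v x) - f 0\<bar> \<le> L * \<bar>v x - 0\<bar>" using range[of x] by (intro L) auto
    also have "\<dots> \<le> L * 1" using range[of x] L(1) by (intro mult_left_mono) auto
    finally have "\<bar>f (v x)\<bar> \<le> L" using F1 unfolding F1_def by simp
    moreover have "(\<Sum>b\<in>Basis. partial b (partial b v) x) - \<kappa> * partial e v x = - f (v x)"
      using eq[of x] unfolding laplacian_def by linarith
    ultimately show ?thesis by simp
  qed
  moreover have "\<bar>v x\<bar> \<le> 1" for x using range[of x] by simp
  ultimately show ?thesis
    by (intro bounded_solution_lipschitz[OF e continuous_v less_imp_le[OF \<kappa>] jet_partial[OF C2]])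
qed

text \<open>
  The spreading of balls, expressed through \<open>depth\<close> alone: the constant \<open>A\<close> is independent of time.
\<close>

lemma spreading:
  assumes wave: "travelling_wave f \<kappa>s g" and \<kappa>1: "0 < \<kappa>1" "\<kappa>1 < \<kappa>s"
  shows "\<exists>A. \<forall>c t x. A \<le> depth c \<longrightarrow> 0 \<le> t \<longrightarrow> norm (x - (c + (\<kappa> * t) *\<^sub>R e)) \<le> \<kappa>1 * t \<longrightarrow> - A < depth x"
proof -
  obtain R q where q: "0 < q" "q < 1" and spread: "\<forall>\<kappa> v c t x. C_class 2 v \<longrightarrow> (\<forall>x. 0 < v x \<and> v x < 1) \<longrightarrow>
      (\<forall>x. - laplacian v x + \<kappa> * partial e v x = f (v x)) \<longrightarrow> (\<forall>x\<in>cball c R. v x > 1 - q) \<longrightarrow>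
      0 \<le> t \<longrightarrow> norm (x - (c + (\<kappa> * t) *\<^sub>R e)) \<le> \<kappa>1 * t \<longrightarrow> v x \<ge> 1/2"
    using front_spreading[OF F1 F2 F4 wave less_trans[OF \<kappa>1] \<kappa>1 e] by (elim exE conjE)
  obtain D1 where D1: "\<And>x. D1 \<le> depth x \<Longrightarrow> 1 - q < v x" using deep[OF q(1)] by blast
  obtain D2 where D2: "\<And>x. depth x \<le> - D2 \<Longrightarrow> v x < 1/2" using deep[of "1/2"] by auto
  show ?thesis
  proof (intro exI[of _ "max (D1 + K * \<bar>R\<bar>) D2"] allI impI)
    fix c t x
    assume c: "max (D1 + K * \<bar>R\<bar>) D2 \<le> depth c" and tx: "0 \<le> t" "norm (x - (c + (\<kappa> * t) *\<^sub>R e)) \<le> \<kappa>1 * t"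
    have "1 - q < v y" if "y \<in> cball c R" for y
    proof (rule D1)
      have "\<bar>depth c - depth y\<bar> \<le> K * norm (c - y)" by (rule depth_lipschitz)
      also have "\<dots> \<le> K * \<bar>R\<bar>" using that K by (intro mult_left_mono) (auto simp: dist_norm)
      finally show "D1 \<le> depth y" using c by linarith
    qed
    then have "1/2 \<le> v x"
      by (intro spread[rule_format, OF C2 _ _ _ tx]) (use range eq in auto)
    then have "- D2 < depth x" using D2[of x] by force
    then show "- max (D1 + K * \<bar>R\<bar>) D2 < depth x" by linarith
  qed
qed

text \<open>
  If \<open>\<kappa> < \<kappa>1 < \<kappa>s\<close>, the lowest point of the growing ball moves down at speed \<open>\<kappa>1 - \<kappa>\<close> and would invade
  points of arbitrarily negative depth.
\<close>

lemma speed_at_least_planar: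
  assumes wave: "travelling_wave f \<kappa>s g" and \<kappa>s: "0 < \<kappa>s"
  shows "\<kappa>s \<le> \<kappa>"
proof (rule ccontr)
  assume less: "\<not> \<kappa>s \<le> \<kappa>"
  define \<kappa>1 where "\<kappa>1 = (\<kappa> + \<kappa>s) / 2"
  have \<kappa>1: "0 < \<kappa>1" "\<kappa>1 < \<kappa>s" "\<kappa> < \<kappa>1" using less \<kappa> unfolding \<kappa>1_def by auto
  obtain A where A: "\<And>c t x. A \<le> depth c \<Longrightarrow> 0 \<le> t \<Longrightarrow> norm (x - (c + (\<kappa> * t) *\<^sub>R e)) \<le> \<kappa>1 * t \<Longrightarrow> - A < depth x"
    using spreading[OF wave \<kappa>1(1,2)] by blast
  define c where "c = 0 + (A - depth 0) *\<^sub>R e"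
  have lc: "depth c = A" unfolding c_def depth_shift by simp
  define t where "t = \<bar>2 * A\<bar> / (\<kappa>1 - \<kappa>)"
  have t: "0 \<le> t" "(\<kappa>1 - \<kappa>) * t = \<bar>2 * A\<bar>" using \<kappa>1 unfolding t_def by auto
  define x where "x = c + (- ((\<kappa>1 - \<kappa>) * t)) *\<^sub>R e"
  have "x - (c + (\<kappa> * t) *\<^sub>R e) = (- (\<kappa>1 * t)) *\<^sub>R e"
    unfolding x_def by (simp add: algebra_simps)
  then have "norm (x - (c + (\<kappa> * t) *\<^sub>R e)) = \<kappa>1 * t"
    using norm_e t \<kappa>1 by simp
  then have "- A < depth x" using A[of c t x] lc t by simp
  moreover have "depth x = A - \<bar>2 * A\<bar>" unfolding x_def depth_shift lc t(2) by simp
  ultimately show False by linarith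
qed

text \<open>
  The balls of radius \<open>\<kappa>1 t\<close> centred at height \<open>\<kappa> t\<close> over a point fill a cone. With \<open>\<kappa>1 = \<kappa> / sqrt (1 + \<sigma>\<^sup>2)\<close>
  the boundary of this cone has slope \<open>\<sigma>\<close>, and it is reached at the horizontal distance \<open>|h|\<close> by the
  time \<open>t\<close> with \<open>\<kappa> t = |h| (\<sigma> + 1/\<sigma>)\<close>.
\<close>

lemma depth_sublinear:
  assumes wave: "travelling_wave f \<kappa> g" and \<sigma>: "0 < \<sigma>"
  shows "\<exists>C. \<forall>x h. h \<bullet> e = 0 \<longrightarrow> depth x - \<sigma> * norm h - C \<le> depth (x + h)"
proof -
  define r where "r = sqrt (1 + \<sigma>\<^sup>2)"
  have r: "1 < r" "r\<^sup>2 = 1 + \<sigma>\<^sup>2" using \<sigma> unfolding r_def by auto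
  define \<kappa>1 where "\<kappa>1 = \<kappa> / r"
  have \<kappa>1: "0 < \<kappa>1" "\<kappa>1 < \<kappa>" using \<kappa> r unfolding \<kappa>1_def by (auto simp: field_simps)
  obtain A where A: "\<And>c t x. A \<le> depth c \<Longrightarrow> 0 \<le> t \<Longrightarrow> norm (x - (c + (\<kappa> * t) *\<^sub>R e)) \<le> \<kappa>1 * t \<Longrightarrow> - A < depth x"
    using spreading[OF wave \<kappa>1] by blast
  have "depth x - \<sigma> * norm h - 2 * A \<le> depth (x + h)" if h: "h \<bullet> e = 0" for x h
  proof -
    define c where "c = x + (A - depth x) *\<^sub>R e"
    have lc: "depth c = A" unfolding c_def depth_shift by simp
    define t where "t = norm h * (r\<^sup>2 / \<sigma>) / \<kappa>"
    have t: "0 \<le> t" using \<sigma> \<kappa> unfolding t_def by simp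
    have \<kappa>t: "\<kappa> * t = norm h * (r\<^sup>2 / \<sigma>)" using \<kappa> unfolding t_def by simp
    have \<kappa>1t: "\<kappa>1 * t = norm h * (r / \<sigma>)"
      using \<kappa> r(1) unfolding t_def \<kappa>1_def by (simp add: power2_eq_square)
    define y where "y = (x + h) + (A - depth x + \<sigma> * norm h) *\<^sub>R e"
    have "y - (c + (\<kappa> * t) *\<^sub>R e) = h + (- (norm h / \<sigma>)) *\<^sub>R e"
    proof -
      have "\<sigma> * norm h - \<kappa> * t = - (norm h / \<sigma>)"
      proof -
        have "(1 + \<sigma>\<^sup>2) / \<sigma> = 1 / \<sigma> + \<sigma>" using \<sigma> by (simp add: add_divide_distrib power2_eq_square)
        then show ?thesis unfolding \<kappa>t r(2) by (simp add: distrib_left)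
      qed
      then have "h + (\<sigma> * norm h - \<kappa> * t) *\<^sub>R e = h + (- (norm h / \<sigma>)) *\<^sub>R e" by (simp only:)
      then show ?thesis unfolding y_def c_def by (simp add: algebra_simps)
    qed
    moreover have "norm (h + (- (norm h / \<sigma>)) *\<^sub>R e) = norm h * (r / \<sigma>)"
    proof (rule power2_eq_imp_eq)
      have "(norm (h + (- (norm h / \<sigma>)) *\<^sub>R e))\<^sup>2 = (norm h)\<^sup>2 + (norm h / \<sigma>)\<^sup>2"
      proof -
        have "e \<bullet> h = 0" using h by (simp add: inner_commute)
        then show ?thesis
          using h e by (simp add: power2_norm_eq_inner inner_diff_left inner_diff_right)
            (simp add: power2_eq_square)
      qed
      also have "\<dots> = (norm h * (r / \<sigma>))\<^sup>2"
        using \<sigma> by (simp add: power_mult_distrib power_divide r(2) add_divide_distrib distrib_left)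
      finally show "(norm (h + (- (norm h / \<sigma>)) *\<^sub>R e))\<^sup>2 = (norm h * (r / \<sigma>))\<^sup>2" .
    qed (use r \<sigma> in auto)
    ultimately have "norm (y - (c + (\<kappa> * t) *\<^sub>R e)) \<le> \<kappa>1 * t" unfolding \<kappa>1t by simp
    then have "- A < depth y" using A[of c t y] lc t by simp
    moreover have "depth y = depth (x + h) + (A - depth x + \<sigma> * norm h)" unfolding y_def by (rule depth_shift)
    ultimately show ?thesis by linarith
  qed
  then show ?thesis by blast
qed

definition "difference_partial p x b = partial b v (x + p) - partial b v x" for p x b
definition "difference_second_partial p x b = partial b (partial b v) (x + p) - partial b (partial b v) x" for p x b

lemma jet_difference:
  assumes "b \<in> Basis"
  shows "jet (\<lambda>x. v (x + p) - v x) x b (difference_partial p x b) (difference_second_partial p x b)"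
  unfolding difference_partial_def difference_second_partial_def by (intro jet_diff jet_translate jet_partial C2 assms)

lemma difference_equation:
  "(\<Sum>b\<in>Basis. difference_second_partial p x b) - \<kappa> * difference_partial p x e = f (v x) - f (v (x + p))"
  using eq[of x] eq[of "x + p"] unfolding difference_partial_def difference_second_partial_def laplacian_def sum_subtractf
  by (simp add: algebra_simps)

text \<open>
  In the two outer zones \<open>f\<close> is nonincreasing, so the difference \<open>z\<close> is a supersolution wherever it is
  negative. An infimum \<open>-m < 0\<close> need not be attained, and in the combustion case there is no strict
  inequality to exploit at infinity. Instead, from every point with \<open>z < 0\<close> a step of bounded length
  along \<open>-e\<close> or \<open>e\<close> leads to a ball on which \<open>v < m/2\<close>, or the shifted function exceeds \<open>1 - m/2\<close>, and
  hence \<open>z + m \<ge> m/2\<close>. By \<open>positivity_propagation\<close> then \<open>z + m\<close> is bounded away from 0 everywhere.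
\<close>

lemma comparison:
  assumes \<eta>: "0 < \<eta>" "\<eta> < 1/2"
    and low: "\<And>u w. u \<in> {0..\<eta>} \<Longrightarrow> w \<in> {0..\<eta>} \<Longrightarrow> w \<le> u \<Longrightarrow> f u \<le> f w"
    and high: "\<And>u w. u \<in> {1-\<eta>..1} \<Longrightarrow> w \<in> {1-\<eta>..1} \<Longrightarrow> w \<le> u \<Longrightarrow> f u \<le> f w"
    and zones: "\<And>x. v x \<le> \<eta> \<or> 1 - \<eta> \<le> v (x + p) \<or> v x \<le> v (x + p)"
  shows "v x \<le> v (x + p)"
proof (rule ccontr)
  assume "\<not> v x \<le> v (x + p)"
  define z where "z x = v (x + p) - v x" for x
  define m where "m = - Inf (range z)"
  have z_ge: "- 1 \<le> z x" for x using range[of x] range[of "x + p"] unfolding z_def by linarith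
  then have bdd: "bdd_below (range z)" by (intro bdd_belowI[of _ "-1"]) auto
  have zm: "- m \<le> z x" for x unfolding m_def using bdd by (simp add: cINF_lower)
  have m: "0 < m" using zm[of x] \<open>\<not> v x \<le> v (x + p)\<close> unfolding z_def by linarith
  obtain D1 where D1: "\<And>x. D1 \<le> depth x \<Longrightarrow> 1 - m/2 < v x" "\<And>x. depth x \<le> - D1 \<Longrightarrow> v x < m/2"
    using deep[of "m/2"] m by auto
  obtain D2 where D2: "\<And>x. D2 \<le> depth x \<Longrightarrow> \<eta> < v x" "\<And>x. depth x \<le> - D2 \<Longrightarrow> v x < 1 - \<eta>"
    using deep[of "1 - \<eta>"] \<eta> by auto
  define A where "A = \<bar>D1 + D2 + K\<bar>"
  obtain c where c: "0 < c" and propagate: "\<forall>a>0. \<forall>y. \<forall>\<zeta> P Q. continuous_on UNIV \<zeta> \<longrightarrow>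
      (\<forall>x. \<forall>b\<in>Basis. jet \<zeta> x b (P x b) (Q x b)) \<longrightarrow> (\<forall>x. 0 \<le> \<zeta> x) \<longrightarrow>
      (\<forall>x. \<zeta> x < a \<longrightarrow> (\<Sum>b\<in>Basis. Q x b) - \<kappa> * P x e \<le> 0 * \<zeta> x) \<longrightarrow>
      (\<forall>x\<in>cball y 1. a \<le> \<zeta> x) \<longrightarrow> (\<forall>x\<in>cball y A. c * a \<le> \<zeta> x)"
    using positivity_propagation[OF e, of 1 "A + 2" A 0 \<kappa>] \<kappa> unfolding A_def by auto
  have cont: "continuous_on UNIV (\<lambda>x. z x + m)"
    unfolding z_def
    by (intro continuous_intros continuous_on_compose2[OF continuous_v]) auto
  have jets: "jet (\<lambda>x. z x + m) x b (difference_partial p x b) (difference_second_partial p x b)" if "b \<in> Basis" for x b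
    unfolding z_def by (intro jet_add_const jet_difference that)
  have super: "(\<Sum>b\<in>Basis. difference_second_partial p x b) - \<kappa> * difference_partial p x e \<le> 0" if "z x < 0" for x
  proof -
    have lt: "v (x + p) < v x" using that unfolding z_def by simp
    have "f (v x) \<le> f (v (x + p))"
    proof (cases "v x \<le> \<eta>")
      case True
      then show ?thesis using lt range[of "x + p"] by (intro low) auto
    next
      case False
      then have "1 - \<eta> \<le> v (x + p)" using zones[of x] lt by auto
      then show ?thesis using lt range[of x] by (intro high) auto
    qed
    then show ?thesis unfolding difference_equation by simp
  qed
  have lower: "c * (m/2) \<le> z x + m" if neg: "z x < 0" for x
  proof -
    obtain y where y: "x \<in> cball y A" and ball: "\<And>y'. y' \<in> cball y 1 \<Longrightarrow> - (m/2) \<le> z y'"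
    proof (cases "v x \<le> \<eta>")
      case True
      then have lx: "depth x < D2" using D2(1)[of x] by force
      define y where "y = x + (- A) *\<^sub>R e"
      have "- (m/2) \<le> z y'" if "y' \<in> cball y 1" for y'
      proof -
        have "\<bar>depth y - depth y'\<bar> \<le> K * norm (y - y')" by (rule depth_lipschitz)
        also have "\<dots> \<le> K * 1" using that K by (intro mult_left_mono) (auto simp: dist_norm)
        finally have "depth y' \<le> - D1" using lx unfolding y_def depth_shift A_def by linarith
        then show ?thesis using D1(2)[of y'] range[of "y' + p"] unfolding z_def by linarith
      qed
      moreover have "x \<in> cball y A" unfolding y_def using norm_e by (simp add: dist_norm A_def)
      ultimately show ?thesis using that by blast
    next
      case False
      then have "1 - \<eta> \<le> v (x + p)" using zones[of x] neg unfolding z_def by auto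
      then have lx: "- D2 < depth (x + p)" using D2(2)[of "x + p"] by force
      define y where "y = x + A *\<^sub>R e"
      have yp: "y + p = (x + p) + A *\<^sub>R e" unfolding y_def by simp
      have "- (m/2) \<le> z y'" if "y' \<in> cball y 1" for y'
      proof -
        have "\<bar>depth (y + p) - depth (y' + p)\<bar> \<le> K * norm ((y + p) - (y' + p))" by (rule depth_lipschitz)
        also have "\<dots> \<le> K * 1" using that K by (intro mult_left_mono) (auto simp: dist_norm)
        finally have "D1 \<le> depth (y' + p)" using lx unfolding yp depth_shift A_def by linarith
        then show ?thesis using D1(1)[of "y' + p"] range[of y'] unfolding z_def by linarith
      qed
      moreover have "x \<in> cball y A" unfolding y_def using norm_e by (simp add: dist_norm A_def)
      ultimately show ?thesis using that by blast
    qed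
    have "\<forall>x\<in>cball y A. c * (m/2) \<le> z x + m"
    proof (rule propagate[rule_format, of "m/2" "\<lambda>x. z x + m" "difference_partial p" "difference_second_partial p" y, THEN ballI])
      show "0 \<le> z x + m" for x using zm[of x] by linarith
      show "(\<Sum>b\<in>Basis. difference_second_partial p x b) - \<kappa> * difference_partial p x e \<le> 0 * (z x + m)" if "z x + m < m/2" for x
        using super[of x] that m by simp
      show "m/2 \<le> z x + m" if "x \<in> cball y 1" for x using ball[OF that] by linarith
    qed (use m cont jets in auto)
    then show ?thesis using y by blast
  qed
  define d where "d = min (c * (m/2)) m"
  have d: "0 < d" using c m unfolding d_def by simp
  have "d - m \<le> z x" for x using lower[of x] unfolding d_def by (cases "z x < 0") auto
  then have "d - m \<le> Inf (range z)" by (intro cINF_greatest) auto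
  then show False using d unfolding m_def by simp
qed

text \<open>
  The sliding argument. The crucial bound is \<open>\<beta>\<close>: at the critical shift \<open>P = h + \<tau>s e\<close> with \<open>\<tau>s > 0\<close>
  the difference \<open>z\<close> is bounded below on the transition layer. Indeed \<open>M\<close> steps of length \<open>P\<close> lead
  from the layer to a place where \<open>v\<close> is closer to 1, with \<open>M\<close> independent of the point by the
  sublinearity of \<open>depth\<close>; so \<open>z\<close> is not small at one of these \<open>M\<close> points, and positivity propagates
  back.
\<close>

lemma monotone_along_transversal:
  assumes wave: "travelling_wave f \<kappa> g" and h: "h \<bullet> e = 0"
  shows "v x \<le> v (x + h)"
proof -
  obtain \<eta> \<mu> where \<eta>: "0 < \<eta>" "\<eta> < 1/2" and \<mu>: "0 < \<mu>"
    and low: "\<And>u w. u \<in> {0..\<eta>} \<Longrightarrow> w \<in> {0..\<eta>} \<Longrightarrow> w \<le> u \<Longrightarrow> f u \<le> f w"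
    and high': "\<And>u w. u \<in> {1-\<eta>..1} \<Longrightarrow> w \<in> {1-\<eta>..1} \<Longrightarrow> w \<le> u \<Longrightarrow> f u - f w \<le> - \<mu> * (u - w)"
    using monotone_near_endpoints[OF F1 F2 F4] by auto
  have high: "f u \<le> f w" if "u \<in> {1-\<eta>..1}" "w \<in> {1-\<eta>..1}" "w \<le> u" for u w
  proof -
    have "0 \<le> \<mu> * (u - w)" using \<mu> that by simp
    then show ?thesis using high'[OF that] by simp
  qed
  obtain L where L: "L \<ge> 0" "\<And>u w. u \<in> {0..1} \<Longrightarrow> w \<in> {0..1} \<Longrightarrow> \<bar>f u - f w\<bar> \<le> L * \<bar>u - w\<bar>"
    using F1_lipschitz_bound[OF F1] by blast
  obtain C where C: "C \<ge> 0" "\<And>x y. \<bar>v x - v y\<bar> \<le> C * norm (x - y)" using v_lipschitz by blast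
  obtain D where D: "\<And>x. D \<le> depth x \<Longrightarrow> 1 - \<eta> < v x" "\<And>x. depth x \<le> - D \<Longrightarrow> v x < \<eta>"
    using deep[OF \<eta>(1)] by blast
  define p where "p \<tau> = h + \<tau> *\<^sub>R e" for \<tau>
  define S where "S = {\<tau>. \<forall>\<tau>'\<ge>\<tau>. \<forall>x. v x \<le> v (x + p \<tau>')}"
  have up: "\<tau>' \<in> S" if "\<tau> \<in> S" "\<tau> \<le> \<tau>'" for \<tau> \<tau>' using that unfolding S_def by auto
  have "2 * D + K * norm h \<in> S"
    unfolding S_def
  proof (intro CollectI allI impI)
    fix \<tau> x assume \<tau>: "2 * D + K * norm h \<le> \<tau>"
    show "v x \<le> v (x + p \<tau>)"
    proof (rule comparison[OF \<eta> low high])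
      fix x
      have "1 - \<eta> \<le> v (x + p \<tau>)" if "\<not> v x \<le> \<eta>"
      proof -
        have "- D < depth x" using D(2)[of x] that by force
        moreover have "\<bar>depth (x + h) - depth x\<bar> \<le> K * norm h" using depth_lipschitz[of "x + h" x] by simp
        moreover have "depth (x + p \<tau>) = depth (x + h) + \<tau>" using depth_shift[of "x + h" \<tau>] unfolding p_def by (simp add: add_ac)
        ultimately have "D \<le> depth (x + p \<tau>)" using \<tau> by linarith
        then show ?thesis using D(1) by (simp add: less_imp_le)
      qed
      then show "v x \<le> \<eta> \<or> 1 - \<eta> \<le> v (x + p \<tau>) \<or> v x \<le> v (x + p \<tau>)" by blast
    qed
  qed
  then have S_ne: "S \<noteq> {}" by auto
  have "0 \<in> S"
  proof (rule ccontr)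
    assume "0 \<notin> S"
    then have S_pos: "0 < \<tau>" if "\<tau> \<in> S" for \<tau> using up[OF that, of 0] by (cases "0 < \<tau>") auto
    have bdd: "bdd_below S"
    proof (rule bdd_belowI[of _ 0])
      show "0 \<le> \<tau>" if "\<tau> \<in> S" for \<tau> using S_pos[OF that] by simp
    qed
    define \<tau>s where "\<tau>s = Inf S"
    have above: "v x \<le> v (x + p \<tau>)" if gt: "\<tau>s < \<tau>" for x \<tau>
    proof -
      obtain \<tau>' where "\<tau>' \<in> S" "\<tau>' < \<tau>"
        using cInf_lessD[OF S_ne gt[unfolded \<tau>s_def]] by blast
      then have "\<tau> \<in> S" by (intro up[of \<tau>' \<tau>]) simp_all
      then show ?thesis unfolding S_def by simp
    qed
    have p_lip: "\<bar>v (x + p \<tau>) - v (x + p \<tau>')\<bar> \<le> C * \<bar>\<tau> - \<tau>'\<bar>" for x \<tau> \<tau>'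
    proof -
      have "(x + p \<tau>) - (x + p \<tau>') = (\<tau> - \<tau>') *\<^sub>R e" unfolding p_def by (simp add: algebra_simps)
      then show ?thesis using C(2)[of "x + p \<tau>" "x + p \<tau>'"] norm_e by simp
    qed
    have at: "v x \<le> v (x + p \<tau>s)" for x
    proof (rule field_le_epsilon)
      fix \<epsilon> :: real assume \<epsilon>: "0 < \<epsilon>"
      define \<tau> where "\<tau> = \<tau>s + \<epsilon> / (C + 1)"
      have "\<tau>s < \<tau>" using \<epsilon> C(1) unfolding \<tau>_def by simp
      then have "v x \<le> v (x + p \<tau>)" by (rule above)
      also have "\<dots> \<le> v (x + p \<tau>s) + C * (\<epsilon> / (C + 1))"
        using p_lip[of x \<tau> \<tau>s] \<epsilon> C(1) unfolding \<tau>_def by simp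
      also have "C * (\<epsilon> / (C + 1)) \<le> \<epsilon>" using \<epsilon> C(1) by (simp add: field_simps)
      finally show "v x \<le> v (x + p \<tau>s) + \<epsilon>" by simp
    qed
    have "\<tau>s \<in> S"
      unfolding S_def
    proof (intro CollectI allI impI)
      show "v x \<le> v (x + p \<tau>)" if "\<tau>s \<le> \<tau>" for x \<tau>
        using at[of x] above[of \<tau> x] that by (cases "\<tau> = \<tau>s") auto
    qed
    then have \<tau>s: "0 < \<tau>s" by (rule S_pos)
    define P where "P = p \<tau>s"
    define z where "z x = v (x + P) - v x" for x
    have z_nonneg: "0 \<le> z x" for x using at unfolding z_def P_def by simp
    have z_super: "(\<Sum>b\<in>Basis. difference_second_partial P x b) - \<kappa> * difference_partial P x e \<le> L * z x" for x
    proof -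
      have "\<bar>f (v x) - f (v (x + P))\<bar> \<le> L * \<bar>v x - v (x + P)\<bar>"
        using range[of x] range[of "x + P"] by (intro L) auto
      also have "\<bar>v x - v (x + P)\<bar> = z x" using z_nonneg[of x] unfolding z_def by simp
      finally show ?thesis unfolding difference_equation by simp
    qed
    have z_lip: "\<bar>z x - z y\<bar> \<le> 2 * C * norm (x - y)" for x y
      using C(2)[of "x + P" "y + P"] C(2)[of x y] unfolding z_def by simp
    obtain \<beta> where \<beta>: "0 < \<beta>" "\<And>x. \<eta> < v x \<Longrightarrow> v (x + P) < 1 - \<eta>/2 \<Longrightarrow> \<beta> \<le> z x"
    proof -
      define H where "H = norm h + 1"
      have H: "0 < H" "norm h \<le> H" unfolding H_def by (auto intro: add_nonneg_pos)
      define \<sigma> where "\<sigma> = \<tau>s / (2 * H)"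
      have \<sigma>: "0 < \<sigma>" using \<tau>s H unfolding \<sigma>_def by simp
      have "\<sigma> * norm h \<le> \<sigma> * H" using \<sigma> H by (intro mult_left_mono) auto
      also have "\<dots> = \<tau>s / 2" using H unfolding \<sigma>_def by simp
      finally have \<sigma>h: "\<sigma> * norm h \<le> \<tau>s / 2" .
      obtain C' where C': "\<And>x h. h \<bullet> e = 0 \<Longrightarrow> depth x - \<sigma> * norm h - C' \<le> depth (x + h)"
        using depth_sublinear[OF wave \<sigma>] by blast
      obtain D' where D': "\<And>x. D' \<le> depth x \<Longrightarrow> 1 - \<eta>/4 < v x" using deep[of "\<eta>/4"] \<eta> by auto
      obtain N where N: "2 * (D + C' + \<bar>D'\<bar>) / \<tau>s < real N" using reals_Archimedean2 by blast
      define M where "M = max 1 N"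
      have M: "1 \<le> M" "D + C' + \<bar>D'\<bar> \<le> real M * \<tau>s / 2"
      proof -
        have "2 * (D + C' + \<bar>D'\<bar>) / \<tau>s \<le> real M" using N unfolding M_def by linarith
        then show "D + C' + \<bar>D'\<bar> \<le> real M * \<tau>s / 2" using \<tau>s by (simp add: field_simps)
      qed (simp add: M_def)
      \<comment> \<open>Of the \<open>M\<close> increments with sum above \<open>\<eta>/4\<close> one is at least \<open>2 a\<close>, and by the Lipschitz bound
        the increment stays above \<open>a\<close> on a ball of radius \<open>r\<close>.\<close>
      define a where "a = \<eta> / (8 * real M)"
      have a: "0 < a" using \<eta> M unfolding a_def by simp
      define r where "r = a / (2 * C + 1)"
      have r: "0 < r" using a C(1) unfolding r_def by simp
      define R0 where "R0 = real M * norm P"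
      obtain c where c: "0 < c" and propagate: "\<forall>a>0. \<forall>y. \<forall>\<zeta> P Q. continuous_on UNIV \<zeta> \<longrightarrow>
        (\<forall>x. \<forall>b\<in>Basis. jet \<zeta> x b (P x b) (Q x b)) \<longrightarrow> (\<forall>x. 0 \<le> \<zeta> x) \<longrightarrow>
        (\<forall>x. \<zeta> x < a \<longrightarrow> (\<Sum>b\<in>Basis. Q x b) - \<kappa> * P x e \<le> L * \<zeta> x) \<longrightarrow>
        (\<forall>x\<in>cball y r. a \<le> \<zeta> x) \<longrightarrow> (\<forall>x\<in>cball y R0. c * a \<le> \<zeta> x)"
        using positivity_propagation[OF e r, of "R0 + r + 1" R0 L \<kappa>] r \<kappa> L(1) unfolding R0_def by auto
      have contz: "continuous_on UNIV z"
        unfolding z_def by (intro continuous_intros continuous_on_compose2[OF continuous_v]) auto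
      have jetz: "jet z x b (difference_partial P x b) (difference_second_partial P x b)" if "b \<in> Basis" for x b
        unfolding z_def by (rule jet_difference[OF that])
      have "c * a \<le> z x" if x: "\<eta> < v x" "v (x + P) < 1 - \<eta>/2" for x
      proof -
        have "D' \<le> depth (x + real M *\<^sub>R P)"
        proof -
          have "- D < depth x" using D(2)[of x] x by force
          moreover have "depth x - \<sigma> * norm (real M *\<^sub>R h) - C' \<le> depth (x + real M *\<^sub>R h)" using h by (intro C') simp
          moreover have "\<sigma> * norm (real M *\<^sub>R h) \<le> real M * \<tau>s / 2"
            using mult_left_mono[OF \<sigma>h, of "real M"] by (simp add: mult_ac)
          moreover have "depth (x + real M *\<^sub>R P) = depth (x + real M *\<^sub>R h) + real M * \<tau>s"
            using depth_shift[of "x + real M *\<^sub>R h" "real M * \<tau>s"] unfolding P_def p_def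
            by (simp add: scaleR_add_right add_ac)
          ultimately show ?thesis using M(2) by linarith
        qed
        then have "1 - \<eta>/4 < v (x + real M *\<^sub>R P)" by (rule D')
        moreover have "v x < 1 - \<eta>/2" using x z_nonneg[of x] unfolding z_def by linarith
        moreover have "(\<Sum>j<M. z (x + real j *\<^sub>R P)) = v (x + real M *\<^sub>R P) - v x"
        proof -
          have "z (x + real j *\<^sub>R P) = v (x + real (Suc j) *\<^sub>R P) - v (x + real j *\<^sub>R P)" for j
            unfolding z_def by (simp add: algebra_simps)
          then show ?thesis
            using sum_lessThan_telescope[of "\<lambda>j. v (x + real j *\<^sub>R P)" M] by simp
        qed
        ultimately have big: "\<eta>/4 < (\<Sum>j<M. z (x + real j *\<^sub>R P))" by linarith
        have "\<exists>j<M. 2 * a \<le> z (x + real j *\<^sub>R P)"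
        proof (rule ccontr)
          assume "\<not> ?thesis"
          then have "z (x + real j *\<^sub>R P) \<le> 2 * a" if "j < M" for j using that by (auto simp: not_le less_imp_le)
          then have "(\<Sum>j<M. z (x + real j *\<^sub>R P)) \<le> (\<Sum>j<M. 2 * a)" by (intro sum_mono) auto
          also have "\<dots> = \<eta>/4" using M unfolding a_def by simp
          finally show False using big by simp
        qed
        then obtain j where j: "j < M" "2 * a \<le> z (x + real j *\<^sub>R P)" by blast
        define y where "y = x + real j *\<^sub>R P"
        have "\<forall>x\<in>cball y R0. c * a \<le> z x"
        proof (rule propagate[rule_format, of a z "difference_partial P" "difference_second_partial P" y, THEN ballI])
          show "a \<le> z x" if "x \<in> cball y r" for x
          proof -
            have "\<bar>z y - z x\<bar> \<le> 2 * C * norm (y - x)" by (rule z_lip)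
            also have "\<dots> \<le> 2 * C * r" using that C(1) by (intro mult_left_mono) (auto simp: dist_norm)
            also have "\<dots> \<le> (2 * C + 1) * r" using r by (intro mult_right_mono) auto
            also have "\<dots> = a" using C(1) unfolding r_def by simp
            finally show ?thesis using j(2) unfolding y_def[symmetric] by linarith
          qed
        qed (use a contz jetz z_nonneg z_super in auto)
        moreover have "x \<in> cball y R0"
        proof -
          have "dist y x = real j * norm P" unfolding y_def by (simp add: dist_norm)
          also have "\<dots> \<le> R0" unfolding R0_def using j(1) by (intro mult_right_mono) auto
          finally show ?thesis by simp
        qed
        ultimately show ?thesis by blast
      qed
      then show ?thesis using that[of "c * a"] c a by auto
    qed
    \<comment> \<open>A smaller shift still satisfies the zone condition of the comparison lemma, contrary to the
      choice of \<open>\<tau>s\<close>.\<close>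
    define \<epsilon> where "\<epsilon> = min \<beta> (\<eta>/2) / (C + 1)"
    have \<epsilon>: "0 < \<epsilon>" "C * \<epsilon> \<le> \<beta>" "C * \<epsilon> \<le> \<eta>/2"
    proof -
      have mn: "0 < min \<beta> (\<eta>/2)" using \<beta>(1) \<eta> by simp
      then show "0 < \<epsilon>" using C(1) unfolding \<epsilon>_def by simp
      then have "C * \<epsilon> \<le> (C + 1) * \<epsilon>" by (intro mult_right_mono) auto
      also have "\<dots> = min \<beta> (\<eta>/2)" using C(1) unfolding \<epsilon>_def by simp
      finally show "C * \<epsilon> \<le> \<beta>" "C * \<epsilon> \<le> \<eta>/2" by auto
    qed
    have "\<tau>s - \<epsilon> \<in> S"
      unfolding S_def
    proof (intro CollectI allI impI)
      fix \<tau> x assume \<tau>: "\<tau>s - \<epsilon> \<le> \<tau>"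
      show "v x \<le> v (x + p \<tau>)"
      proof (cases "\<tau> > \<tau>s")
        case True
        then show ?thesis by (rule above)
      next
        case False
        then have "\<bar>\<tau> - \<tau>s\<bar> \<le> \<epsilon>" using \<tau> by simp
        then have "C * \<bar>\<tau> - \<tau>s\<bar> \<le> C * \<epsilon>" using C(1) by (intro mult_left_mono)
        then have near: "\<bar>v (x + p \<tau>) - v (x + P)\<bar> \<le> C * \<epsilon>" for x
          using p_lip[of x \<tau> \<tau>s] unfolding P_def by linarith
        show ?thesis
        proof (rule comparison[OF \<eta> low high])
          fix x
          have "v x \<le> v (x + p \<tau>)" if "\<not> v x \<le> \<eta>" "\<not> 1 - \<eta> \<le> v (x + p \<tau>)"
          proof -
            have "v (x + P) < 1 - \<eta>/2" using near[of x] \<epsilon>(3) that by linarith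
            then have "\<beta> \<le> z x" using that by (intro \<beta>(2)) auto
            then show ?thesis using near[of x] \<epsilon>(2) unfolding z_def by linarith
          qed
          then show "v x \<le> \<eta> \<or> 1 - \<eta> \<le> v (x + p \<tau>) \<or> v x \<le> v (x + p \<tau>)" by blast
        qed
      qed
    qed
    then have "\<tau>s \<le> \<tau>s - \<epsilon>" unfolding \<tau>s_def using bdd by (rule cInf_lower)
    then show False using \<epsilon>(1) by simp
  qed
  then show ?thesis unfolding S_def p_def by auto
qed

text \<open>
  Monotonicity along both \<open>h\<close> and \<open>-h\<close> leaves a function of \<open>x \<bullet> e\<close>, which is a travelling wave.
\<close>

lemma planar:
  assumes wave: "travelling_wave f \<kappa> g"
  shows "\<exists>t. \<forall>x. v x = g (x \<bullet> e + t)"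
proof -
  have const: "v (x + h) = v x" if "h \<bullet> e = 0" for x h
  proof (rule antisym)
    show "v x \<le> v (x + h)" by (rule monotone_along_transversal[OF wave that])
    show "v (x + h) \<le> v x"
      using monotone_along_transversal[OF wave, of "- h" "x + h"] that by simp
  qed
  define V where "V s = v (s *\<^sub>R e)" for s
  have vV: "v x = V (x \<bullet> e)" for x
  proof -
    have "(x - (x \<bullet> e) *\<^sub>R e) \<bullet> e = 0" using e by (simp add: inner_diff_left)
    then show ?thesis using const[of "x - (x \<bullet> e) *\<^sub>R e" "(x \<bullet> e) *\<^sub>R e"] unfolding V_def by simp
  qed
  have Cs: "C_class (Suc 1) v" "C_class (Suc 0) (partial e v)" using C2 e by (simp_all add: numeral_2_eq_2)
  have dV: "(V has_real_derivative partial e v (s *\<^sub>R e)) (at s)" for s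
    using C_class_DERIV_along[OF Cs(1) e, of 0 s] unfolding V_def[abs_def] by simp
  then have dV': "deriv V = (\<lambda>s. partial e v (s *\<^sub>R e))" using DERIV_imp_deriv by blast
  have ddV: "(deriv V has_real_derivative partial e (partial e v) (s *\<^sub>R e)) (at s)" for s
    using C_class_DERIV_along[OF Cs(2) e, of 0 s] unfolding dV' by simp
  have flat: "partial b v = (\<lambda>_. 0)" if "b \<in> Basis" "b \<noteq> e" for b
  proof
    fix x
    have "v (x + s *\<^sub>R b) = v x" for s using e that by (intro const) (simp add: inner_Basis)
    then show "partial b v x = 0" unfolding partial_def by simp
  qed
  have lap: "laplacian v x = partial e (partial e v) x" for x
  proof -
    have "laplacian v x = (\<Sum>b\<in>Basis. if b = e then partial e (partial e v) x else 0)"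
      unfolding laplacian_def
    proof (intro sum.cong refl)
      fix b :: 'a assume "b \<in> Basis"
      then show "partial b (partial b v) x = (if b = e then partial e (partial e v) x else 0)"
        using flat[of b] by (cases "b = e") (auto simp: partial_def)
    qed
    then show ?thesis using e by simp
  qed
  have deepV: "\<exists>D. \<forall>s. (D \<le> s \<longrightarrow> 1 - \<epsilon> < V s) \<and> (s \<le> - D \<longrightarrow> V s < \<epsilon>)" if \<epsilon>: "\<epsilon> > 0" for \<epsilon>
  proof -
    obtain D where D: "\<And>x. D \<le> depth x \<Longrightarrow> 1 - \<epsilon> < v x" "\<And>x. depth x \<le> - D \<Longrightarrow> v x < \<epsilon>"
      using deep[OF \<epsilon>] by blast
    have l: "depth (s *\<^sub>R e) = depth 0 + s" for s using depth_shift[of 0 s] by simp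
    show ?thesis
      unfolding V_def
    proof (intro exI[of _ "D + \<bar>depth 0\<bar>"] allI conjI impI)
      show "1 - \<epsilon> < v (s *\<^sub>R e)" if "D + \<bar>depth 0\<bar> \<le> s" for s by (rule D(1)) (use that l[of s] in linarith)
      show "v (s *\<^sub>R e) < \<epsilon>" if "s \<le> - (D + \<bar>depth 0\<bar>)" for s by (rule D(2)) (use that l[of s] in linarith)
    qed
  qed
  have "travelling_wave f \<kappa> V"
    unfolding travelling_wave_def
  proof (intro conjI allI)
    show "V s \<in> {0..1}" for s using range[of "s *\<^sub>R e"] unfolding V_def by simp
    show "V differentiable at s" for s using dV unfolding real_differentiable_def by blast
    show "deriv V differentiable at s" for s using ddV unfolding real_differentiable_def by blast
    show "- deriv (deriv V) s + \<kappa> * deriv V s = f (V s)" for s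
      using eq[of "s *\<^sub>R e"] DERIV_imp_deriv[OF ddV, of s] unfolding lap dV' V_def by simp
    show "(V \<longlongrightarrow> 0) at_bot"
    proof (rule tendstoI)
      fix \<epsilon> :: real assume "0 < \<epsilon>"
      then obtain D where D: "\<And>s. s \<le> - D \<Longrightarrow> V s < \<epsilon>" using deepV by blast
      have "dist (V s) 0 < \<epsilon>" if "s \<le> - D" for s
        using D[OF that] range(1)[of "s *\<^sub>R e"] unfolding V_def by (simp add: dist_real_def)
      then show "\<forall>\<^sub>F s in at_bot. dist (V s) 0 < \<epsilon>" unfolding eventually_at_bot_linorder by blast
    qed
    show "(V \<longlongrightarrow> 1) at_top"
    proof (rule tendstoI)
      fix \<epsilon> :: real assume "0 < \<epsilon>"
      then obtain D where D: "\<And>s. D \<le> s \<Longrightarrow> 1 - \<epsilon> < V s" using deepV by blast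
      have "dist (V s) 1 < \<epsilon>" if "D \<le> s" for s
        using D[OF that] range(2)[of "s *\<^sub>R e"] unfolding V_def by (simp add: dist_real_def)
      then show "\<forall>\<^sub>F s in at_top. dist (V s) 1 < \<epsilon>" unfolding eventually_at_top_linorder by blast
    qed
  qed
  then obtain t where "\<And>s. V s = g (s + t)"
    using travelling_wave_unique[OF F1 F4 \<kappa> wave] by blast
  then show ?thesis using vV by (intro exI[of _ t]) auto
qed

end

section \<open>The theorem\<close>

theorem theorem1p8:
  fixes f :: "real \<Rightarrow> real"
    and kappa_star :: real and g :: "real \<Rightarrow> real"
    and b0 :: real
    and \<kappa> :: real
    and v :: "real ^ 'n \<Rightarrow> real"
    and n :: 'n
  assumes "F1 f" and "F2 f" and "F3 f" and "F4 f"
    and "kappa_star > 0" and "travelling_wave f kappa_star g"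
    and "admissible_b0 TYPE('n) f b0"
    and "\<kappa> > 0"
    and "C_class 2 v"
    and "\<forall>x. 0 < v x \<and> v x < 1"
    and "\<forall>x. - laplacian v x + \<kappa> * partial (axis n 1) v x = f (v x)"
    and "(SUP x. v x) = 1"
    and "(v \<longlongrightarrow> 0) (filtercomap (\<lambda>x. infdist x {y. v y \<ge> 1 - b0}) at_top)"
  shows "\<kappa> \<ge> kappa_star \<and> (\<kappa> = kappa_star \<longrightarrow> (\<exists>t. \<forall>x. v x = g (x $ n + t)))"
proof -
  have e: "axis n (1::real) \<in> Basis" by (simp add: axis_in_Basis_iff)
  have range: "0 < v x \<and> v x < 1" and eq: "- laplacian v x + \<kappa> * partial (axis n 1) v x = f (v x)" for x
    using assms(10,11) by blast+
  obtain depth K where depth: "0 \<le> K" "\<forall>x y. \<bar>depth x - depth y\<bar> \<le> K * norm (x - y)"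
      "\<forall>x s. depth (x + s *\<^sub>R axis n 1) = depth x + s"
      "\<forall>\<epsilon>>0. \<exists>D. \<forall>x. (D \<le> depth x \<longrightarrow> 1 - \<epsilon> < v x) \<and> (depth x \<le> - D \<longrightarrow> v x < \<epsilon>)"
    using front_depth_function[OF assms(7,8) e assms(9) range eq assms(12,13)] by blast
  interpret front f "axis n 1" \<kappa> v depth K
    by (rule front.intro) (use assms(1,2,4,8,9) e range eq depth in blast)+
  show ?thesis
  proof (intro conjI impI)
    show "kappa_star \<le> \<kappa>" by (rule speed_at_least_planar[OF assms(6,5)])
    assume "\<kappa> = kappa_star"
    then have "\<exists>t. \<forall>x. v x = g (x \<bullet> axis n 1 + t)" using planar[of g] assms(6) by simp
    then show "\<exists>t. \<forall>x. v x = g (x $ n + t)" by (simp add: inner_axis)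
  qed
qed

end
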